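(* Let the data $(\ell_i)_{i}$, $\ell_*$, $(g_i)_i$, $g_*$ satisfy the standing assumptions listed in the context. Then for each $(x,t)\in\mathcal G\times[0,T]$, $\Gamma_t^{\rm opt}[x]\neq\emptyset$, i.e. there exists $y\in\Gamma_t[x]$ such that $u(x,t)=J_t(x;y)$. Moreover, there exist positive numbers $M(|x|)$ and $R(|x|)$ (depending on $(x,t)$ only through $|x|$) such that if $y\in\Gamma_t^{\rm opt}[x]$, then $\|y\|_{W^{1,p}(t,T;\mathbb R^N)}\le M(|x|)$ and $\max_{s\in[t,T]}|y(s)|\le R(|x|)$.
   Context: Junction: $N>1$ is an integer, $(e_i)_{1\le i\le N}$ is the canonical basis of $\mathbb R^N$, $\mathbb R_+=[0,\infty)$, $J_i=\mathbb R_+e_i$ are the edges, $\mathcal G=\bigcup_{i=1}^N J_i\subset\mathbb R^N$, and the origin $0$ is the vertex. The geodesic distance on $\mathcal G$ is $d(x,y)=|x-y|$ if $x,y$ lie in the same edge and $d(x,y)=|x|+|y|$ otherwise. Fix $T>0$ and $p>1$. Trajectories: for $x\in\mathcal G$, $t\in[0,T]$, $\Gamma_t[x]$ is the set of $y\in C([t,T];\mathcal G)\cap W^{1,p}(t,T;\mathbb R^N)$ with $y(t)=x$. For such $y$ set $\bar y=|y|\in W^{1,p}(t,T)$; then for a.e. $s$, $y'(s)=\bar y'(s)e_i$ if $y(s)\in J_i\setminus\{0\}$ and $y'(s)=0$ if $y(s)=0$. Data: $g_*\in\mathbb R$; $g_i\in C_b(\mathbb R_+)$ (bounded continuous); $\ell_*\in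 C([0,T])$; $\ell_i\in C(\mathbb R_+\times\mathbb R\times[0,T])$, $(y,a,s)\mapsto\ell_i(y,a,s)$, differentiable in $(y,a)$ with $\partial_y\ell_i,\partial_a\ell_i$ continuous in $(y,a,s)$. Standing assumptions (for all $i$): (H1) there is $C_0>0$ with $\ell_i(y,a,s)\ge C_0(|a|^p-1)$ and $\ell_*(s)\ge -C_0$ for all $(y,a,s)\in\mathbb R_+\times\mathbb R\times[0,T]$; (H2) for any $r>0$ there is a modulus of continuity $\omega_r$ with $|\ell_i(y,a,t_1)-\ell_i(y,a,t_2)|\le(1+|a|^p)\omega_r(|t_1-t_2|)$ for $y\in[0,r]$, $a\in\mathbb R$, $t_1,t_2\in[0,T]$; (H3) for any $r>0$ there is $\tilde c(r)\ge0$ with $|\partial_y\ell_i(y,a,s)|\le\tilde c(r)(|a|^p+1)$ and $|\partial_a\ell_i(y,a,s)|\le\tilde c(r)(|a|^{p-1}+1)$ for $(y,a,s)\in[0,r]\times\mathbb R\times[0,T]$; (H4) $a\mapsto\ell_i(y,a,s)$ is strictly convex. Costs: $g(y)=\sum_i g_i(|y|)\mathbf 1_{y\in J_i\setminus\{0\}}+\min\{g_*,\min_i g_i(0)\}\mathbf 1_{y=0}$; $\ell_0(\tau)=\min\{\ell_*(\tau),\min_i\ell_i(0,0,\tau)\}$; $L(y(\tau),y'(\tau),\tau)=\sum_i\ell_i(\bar y(\tau),\bar y'(\tau),\tau)\mathbf 1_{y(\tau)\in J_i\setminus\{0\}}+\ell_0(\tau)\mathbf 1_{y(\tau)=0}$;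 $J_t(x;y)=\int_t^TL(y(\tau),y'(\tau),\tau)\,d\tau+g(y(T))$ for $y\in\Gamma_t[x]$. Value function: $u(x,t)=\inf_{y\in\Gamma_t[x]}J_t(x;y)$. Optimal trajectories: $\Gamma_t^{\rm opt}[x]=\{y\in\Gamma_t[x]:J_t(x;y)=u(x,t)\}$. *)

theory Defs
  imports "HOL-Analysis.Analysis"
begin

section \<open>The junction\<close>

definition edge :: "'n::finite \<Rightarrow> (real ^ 'n) set" where
  "edge i = {r *\<^sub>R axis i 1 | r. r \<ge> 0}"

text \<open>The geodesic distance of the junction and the Euclidean distance are equivalent, so the
  Euclidean topology is used for continuity of curves in the junction.\<close>

definition junction :: "(real ^ 'n::finite) set" where
  "junction = (\<Union>i. edge i)"

section \<open>Sobolev spaces on a bounded interval\<close>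

text \<open>Elements of \<open>L\<^sup>p(a,b)\<close> are given by representatives, Borel measurable on \<open>[a,b]\<close>; the
  endpoints form a null set. Values outside \<open>[a,b]\<close> are irrelevant.\<close>

definition in_Lp :: "real \<Rightarrow> real \<Rightarrow> real \<Rightarrow> (real \<Rightarrow> 'a::euclidean_space) \<Rightarrow> bool" where
  "in_Lp p a b v \<longleftrightarrow> set_borel_measurable lborel {a..b} v \<and>
     set_integrable lborel {a..b} (\<lambda>s. norm (v s) powr p)"

text \<open>\<open>C\<^sup>1\<close> test functions with compact support in the open interval \<open>(a,b)\<close>, as in Brezis.
  If \<open>a \<ge> b\<close>, the only test function is zero.\<close>

definition test_function :: "real \<Rightarrow> real \<Rightarrow> (real \<Rightarrow> real) \<Rightarrow> bool" where
  "test_function a b \<phi> \<longleftrightarrow> \<phi> C1_differentiable_on UNIV \<and>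
     (\<exists>c d. a < c \<and> d < b \<and> (\<forall>s. s \<notin> {c..d} \<longrightarrow> \<phi> s = 0))"

text \<open>Integrability on \<open>[a,b]\<close> of both functions is required, since otherwise the Bochner
  integrals would have the default value zero.\<close>

definition has_weak_deriv ::
    "real \<Rightarrow> real \<Rightarrow> (real \<Rightarrow> 'a::euclidean_space) \<Rightarrow> (real \<Rightarrow> 'a) \<Rightarrow> bool" where
  "has_weak_deriv a b y v \<longleftrightarrow>
     set_integrable lborel {a..b} y \<and> set_integrable lborel {a..b} v \<and>
     (\<forall>\<phi>. test_function a b \<phi> \<longrightarrow>
        (LINT s:{a..b}|lborel. deriv \<phi> s *\<^sub>R y s) = - (LINT s:{a..b}|lborel. \<phi> s *\<^sub>R v s))"

definition W1p :: "real \<Rightarrow> real \<Rightarrow> real \<Rightarrow> (real \<Rightarrow> 'a::euclidean_space) set" where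
  "W1p p a b = {y. in_Lp p a b y \<and> (\<exists>v. in_Lp p a b v \<and> has_weak_deriv a b y v)}"

text \<open>A weak derivative is unique only almost everywhere; below the chosen representative only
  occurs under an integral.\<close>

definition weak_deriv ::
    "real \<Rightarrow> real \<Rightarrow> (real \<Rightarrow> 'a::euclidean_space) \<Rightarrow> real \<Rightarrow> 'a" where
  "weak_deriv a b y = (SOME v. has_weak_deriv a b y v)"

definition W1p_norm :: "real \<Rightarrow> real \<Rightarrow> real \<Rightarrow> (real \<Rightarrow> 'a::euclidean_space) \<Rightarrow> real" where
  "W1p_norm p a b y =
     ((LINT s:{a..b}|lborel. norm (y s) powr p) +
      (LINT s:{a..b}|lborel. norm (weak_deriv a b y s) powr p)) powr (1 / p)"

section \<open>Trajectories, costs and value function\<close>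

definition trajectories ::
    "real \<Rightarrow> real \<Rightarrow> real \<Rightarrow> real ^ 'n::finite \<Rightarrow> (real \<Rightarrow> real ^ 'n) set" where
  "trajectories p T t x =
     {y. continuous_on {t..T} y \<and> y ` {t..T} \<subseteq> junction \<and> y \<in> W1p p t T \<and> y t = x}"

definition terminal_cost ::
    "('n::finite \<Rightarrow> real \<Rightarrow> real) \<Rightarrow> real \<Rightarrow> real ^ 'n \<Rightarrow> real" where
  "terminal_cost g g_star z =
     (\<Sum>i\<in>UNIV. g i (norm z) * indicator (edge i - {0}) z) +
     min g_star (MIN i. g i 0) * indicator {0} z"

definition vertex_cost ::
    "('n::finite \<Rightarrow> real \<Rightarrow> real \<Rightarrow> real \<Rightarrow> real) \<Rightarrow> (real \<Rightarrow> real) \<Rightarrow> real \<Rightarrow> real" where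
  "vertex_cost l l_star \<tau> = min (l_star \<tau>) (MIN i. l i 0 0 \<tau>)"

text \<open>The velocity of a trajectory enters only through the derivative \<open>a\<close> of its modulus.\<close>

definition running_cost ::
    "('n::finite \<Rightarrow> real \<Rightarrow> real \<Rightarrow> real \<Rightarrow> real) \<Rightarrow> (real \<Rightarrow> real) \<Rightarrow>
     real ^ 'n \<Rightarrow> real \<Rightarrow> real \<Rightarrow> real" where
  "running_cost l l_star z a \<tau> =
     (\<Sum>i\<in>UNIV. l i (norm z) a \<tau> * indicator (edge i - {0}) z) +
     vertex_cost l l_star \<tau> * indicator {0} z"

definition total_cost ::
    "real \<Rightarrow> ('n::finite \<Rightarrow> real \<Rightarrow> real \<Rightarrow> real \<Rightarrow> real) \<Rightarrow> (real \<Rightarrow> real) \<Rightarrow>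
     ('n \<Rightarrow> real \<Rightarrow> real) \<Rightarrow> real \<Rightarrow> real \<Rightarrow> (real \<Rightarrow> real ^ 'n) \<Rightarrow> real" where
  "total_cost T l l_star g g_star t y =
     (LINT \<tau>:{t..T}|lborel.
        running_cost l l_star (y \<tau>) (weak_deriv t T (\<lambda>s. norm (y s)) \<tau>) \<tau>) +
     terminal_cost g g_star (y T)"

text \<open>Under the growth assumptions on the data the costs of the trajectories form a nonempty set
  of reals that is bounded below, so the real-valued infimum is the intended one.\<close>

definition value_function ::
    "real \<Rightarrow> real \<Rightarrow> ('n::finite \<Rightarrow> real \<Rightarrow> real \<Rightarrow> real \<Rightarrow> real) \<Rightarrow> (real \<Rightarrow> real) \<Rightarrow>
     ('n \<Rightarrow> real \<Rightarrow> real) \<Rightarrow> real \<Rightarrow> real ^ 'n \<Rightarrow> real \<Rightarrow> real" where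
  "value_function p T l l_star g g_star x t =
     (INF y\<in>trajectories p T t x. total_cost T l l_star g g_star t y)"

definition optimal_trajectories ::
    "real \<Rightarrow> real \<Rightarrow> ('n::finite \<Rightarrow> real \<Rightarrow> real \<Rightarrow> real \<Rightarrow> real) \<Rightarrow> (real \<Rightarrow> real) \<Rightarrow>
     ('n \<Rightarrow> real \<Rightarrow> real) \<Rightarrow> real \<Rightarrow> real \<Rightarrow> real ^ 'n \<Rightarrow> (real \<Rightarrow> real ^ 'n) set" where
  "optimal_trajectories p T l l_star g g_star t x =
     {y \<in> trajectories p T t x.
        total_cost T l l_star g g_star t y = value_function p T l l_star g g_star x t}"

section \<open>Notions used in the assumptions on the data\<close>

definition modulus_of_continuity :: "(real \<Rightarrow> real) \<Rightarrow> bool" where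
  "modulus_of_continuity \<omega> \<longleftrightarrow> (\<forall>s\<ge>0. \<omega> s \<ge> 0) \<and> \<omega> 0 = 0 \<and> (\<omega> \<longlongrightarrow> 0) (at_right 0)"

definition strictly_convex :: "(real \<Rightarrow> real) \<Rightarrow> bool" where
  "strictly_convex f \<longleftrightarrow>
     (\<forall>a b \<theta>. a \<noteq> b \<longrightarrow> 0 < \<theta> \<longrightarrow> \<theta> < 1 \<longrightarrow>
        f ((1 - \<theta>) * a + \<theta> * b) < (1 - \<theta>) * f a + \<theta> * f b)"

end

theory Submission
  imports Defs "HOL-Complex_Analysis.Great_Picard"
begin

text \<open>Direct method. On the junction the components of a curve are nonnegative and at most one is
  nonzero, so \<open>\<bar>y\<bar>\<close> is the sum of the components of \<open>y\<close>, and the derivative of a component vanishes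
  almost everywhere where the component does. Coercivity bounds the velocities of a minimizing
  sequence in \<open>L\<^sup>p\<close>, and Arzela-Ascoli gives a uniform limit \<open>y\<close> of the curves. Instead of weak
  compactness, convex combinations of the velocities are chosen that converge almost everywhere and
  in \<open>L\<^sup>1\<close>; their limit is the derivative of \<open>y\<close>. Lower semicontinuity then follows from Fatou's lemma
  for integrands convex in the velocity: the running cost itself along the edge of \<open>y(s)\<close> if
  \<open>y(s) \<noteq> 0\<close>, and an affine minorant at the vertex. The bounds come from comparison with the constant
  curve.\<close>

section \<open>Integration over an interval\<close>

text \<open>Two obstacles shape the proof. Convex combinations of curves leave the junction in
  general, and the running cost jumps at the vertex, so convexity cannot be applied to the cost of a
  combined curve. Only velocities are combined, while position and time stay frozen at
  \<open>y s\<close> and \<open>s\<close>. Secondly, combined velocities need not vanish at the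
  vertex, and the affine minorant there is unbounded below. A multiple of the l1 norm of the
  velocity is therefore added before Fatou's lemma and removed afterwards, which uses convergence in
  L1. The combinations are selected by almost minimizing a strongly convex functional. It has to be
  finite on L^p for every p > 1, with an explicit lower bound for its convexity;
  \<open>entropy\<close> offers both. The limit velocity is at first only integrable; coercivity of
  the limit cost puts it back into L^p.\<close>

abbreviation lborel_on :: "real \<Rightarrow> real \<Rightarrow> real measure" where
  "lborel_on a b \<equiv> restrict_space lborel {a..b}"

lemma finite_measure_lborel_on: "finite_measure (lborel_on a b)"
  by (rule finite_measureI) (simp add: space_restrict_space emeasure_restrict_space emeasure_lborel_Icc_eq)

lemma set_integrable_iff_lborel_on:
  fixes f :: "real \<Rightarrow> 'a::{banach, second_countable_topology}"
  shows "set_integrable lborel {a..b} f \<longleftrightarrow> integrable (lborel_on a b) f"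
  unfolding set_integrable_def by (simp add: integrable_restrict_space)

lemma set_integral_eq_lborel_on:
  fixes f :: "real \<Rightarrow> 'a::{banach, second_countable_topology}"
  shows "(LINT s:{a..b}|lborel. f s) = (LINT s|lborel_on a b. f s)"
  unfolding set_lebesgue_integral_def by (simp add: integral_restrict_space)

lemma set_borel_measurable_iff_lborel_on:
  fixes f :: "real \<Rightarrow> 'a::euclidean_space"
  shows "set_borel_measurable lborel {a..b} f \<longleftrightarrow> f \<in> borel_measurable (lborel_on a b)"
  unfolding set_borel_measurable_def by (subst borel_measurable_restrict_space_iff) simp_all

lemma AE_lborel_on: "(AE s in lborel_on a b. P s) \<longleftrightarrow> (AE s in lborel. s \<in> {a..b} \<longrightarrow> P s)"
  by (subst AE_restrict_space_iff) simp_all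

lemma continuous_imp_integrable_lborel_on:
  fixes f :: "real \<Rightarrow> 'a::euclidean_space"
  assumes "continuous_on {a..b} f"
  shows "integrable (lborel_on a b) f"
  using borel_integrable_compact[OF compact_Icc assms]
  by (simp add: integrable_restrict_space indicator_def scaleR_left.zero if_distrib cong: if_cong)

lemma continuous_imp_measurable_lborel_on:
  fixes f :: "real \<Rightarrow> 'a::euclidean_space"
  assumes "continuous_on {a..b} f"
  shows "f \<in> borel_measurable (lborel_on a b)"
  using continuous_imp_integrable_lborel_on[OF assms] by auto

lemma indicator_measurable_lborel_on:
  "A \<in> sets borel \<Longrightarrow> (indicator A :: real \<Rightarrow> real) \<in> borel_measurable (lborel_on a b)"
  by (rule measurable_restrict_space1) simp

lemma integrable_bounded_mult_lborel_on:
  fixes f :: "real \<Rightarrow> 'a::euclidean_space" and \<phi> :: "real \<Rightarrow> real"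
  assumes f: "integrable (lborel_on a b) f"
    and \<phi>: "\<phi> \<in> borel_measurable (lborel_on a b)"
    and B: "\<And>s. s \<in> {a..b} \<Longrightarrow> \<bar>\<phi> s\<bar> \<le> B"
  shows "integrable (lborel_on a b) (\<lambda>s. \<phi> s *\<^sub>R f s)"
proof (rule Bochner_Integration.integrable_bound)
  show "integrable (lborel_on a b) (\<lambda>s. B * norm (f s))" using f by simp
  show "(\<lambda>s. \<phi> s *\<^sub>R f s) \<in> borel_measurable (lborel_on a b)"
    using \<phi> f by measurable
  show "AE s in lborel_on a b. norm (\<phi> s *\<^sub>R f s) \<le> norm (B * norm (f s))"
  proof (rule AE_I2)
    fix s assume "s \<in> space (lborel_on a b)"
    then have "\<bar>\<phi> s\<bar> \<le> B" using B by (simp add: space_restrict_space)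
    then have "\<bar>\<phi> s\<bar> * norm (f s) \<le> \<bar>B\<bar> * norm (f s)"
      by (intro mult_right_mono) auto
    then show "norm (\<phi> s *\<^sub>R f s) \<le> norm (B * norm (f s))" by (simp add: abs_mult)
  qed
qed

section \<open>Weak derivatives and primitives\<close>

definition ramp :: "real \<Rightarrow> real" where
  "ramp x = 2 * ((max 0 x)\<^sup>2 - 2 * (max 0 (x - 1/2))\<^sup>2 + (max 0 (x - 1))\<^sup>2)"

text \<open>The tent of height 2 and mass one on [0,1]. Thus \<open>ramp\<close> climbs from 0 to 1
  on [0,1] and is C1, which is all the regularity that \<open>test_function\<close> asks
  for.\<close>

definition ramp' :: "real \<Rightarrow> real" where
  "ramp' x = 4 * (max 0 x - 2 * max 0 (x - 1/2) + max 0 (x - 1))"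

lemma DERIV_max_0_square: "((\<lambda>x::real. (max 0 x)\<^sup>2) has_real_derivative 2 * max 0 x) (at x)"
proof -
  consider "x > 0" | "x < 0" | "x = 0" by linarith
  then show ?thesis
  proof cases
    case 1
    have "((\<lambda>x::real. x\<^sup>2) has_real_derivative 2 * max 0 x) (at x)"
      using 1 by (auto intro!: derivative_eq_intros)
    then show ?thesis
      by (rule DERIV_cong_ev[THEN iffD1, rotated -1])
        (use 1 in \<open>auto intro!: eventually_nhds_in_open[of "{0<..}", THEN eventually_mono]\<close>)
  next
    case 2
    have "((\<lambda>x::real. 0) has_real_derivative 2 * max 0 x) (at x)"
      using 2 by (auto intro!: derivative_eq_intros)
    then show ?thesis
      by (rule DERIV_cong_ev[THEN iffD1, rotated -1])
        (use 2 in \<open>auto intro!: eventually_nhds_in_open[of "{..<0}", THEN eventually_mono]\<close>)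
  next
    case 3
    have "((\<lambda>h::real. (max 0 h)\<^sup>2 / h) \<longlongrightarrow> 0) (at 0)"
    proof (rule Lim_null_comparison)
      show "\<forall>\<^sub>F h in at 0. norm ((max 0 h)\<^sup>2 / h) \<le> \<bar>h\<bar>"
        by (intro always_eventually) (auto simp: max_def power2_eq_square)
    qed (auto intro!: tendsto_eq_intros)
    then show ?thesis using 3 by (simp add: DERIV_def)
  qed
qed

lemma DERIV_ramp: "(ramp has_real_derivative ramp' x) (at x)"
proof -
  have sh: "((\<lambda>x::real. (max 0 (x - k))\<^sup>2) has_real_derivative 2 * max 0 (x - k)) (at x)" for k
  proof -
    have "((\<lambda>x. x - k) has_real_derivative 1) (at x)" by (auto intro!: derivative_eq_intros)
    from DERIV_chain2[OF DERIV_max_0_square this] show ?thesis by simp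
  qed
  show ?thesis unfolding ramp_def ramp'_def
    by (rule derivative_eq_intros sh DERIV_max_0_square refl)+ (simp add: algebra_simps)
qed

lemma ramp_eq_0: "x \<le> 0 \<Longrightarrow> ramp x = 0"
  by (simp add: ramp_def)

lemma ramp_eq_1: "x \<ge> 1 \<Longrightarrow> ramp x = 1"
  by (simp add: ramp_def power2_eq_square algebra_simps)

lemma ramp'_nonneg: "ramp' x \<ge> 0"
  by (simp add: ramp'_def max_def)

lemma ramp'_eq_0: "x \<le> 0 \<or> x \<ge> 1 \<Longrightarrow> ramp' x = 0"
  by (auto simp: ramp'_def max_def)

lemma ramp_bounds: "0 \<le> ramp x" "ramp x \<le> 1"
proof -
  have mono: "ramp u \<le> ramp w" if "u \<le> w" for u w
    by (rule DERIV_nonneg_imp_nondecreasing[OF that]) (use DERIV_ramp ramp'_nonneg in blast)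
  show "0 \<le> ramp x" using mono[of "min x 0" x] ramp_eq_0[of "min x 0"] by simp
  show "ramp x \<le> 1" using mono[of x "max x 1"] ramp_eq_1[of "max x 1"] by simp
qed

lemma continuous_on_ramp [continuous_intros]:
  "continuous_on A f \<Longrightarrow> continuous_on A (\<lambda>x. ramp (f x))"
  "continuous_on A f \<Longrightarrow> continuous_on A (\<lambda>x. ramp' (f x))"
  unfolding ramp_def ramp'_def by (intro continuous_intros; assumption)+

lemma DERIV_ramp_scaled:
  "((\<lambda>s. ramp (k * (s - c))) has_real_derivative k * ramp' (k * (s - c))) (at s within A)"
proof -
  have "((\<lambda>s. k * (s - c)) has_real_derivative k) (at s within A)"
    by (auto intro!: derivative_eq_intros)
  from DERIV_chain2[OF DERIV_ramp this] show ?thesis by (simp add: mult.commute)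
qed

text \<open>For large n the kernels \<open>n * ramp' (n * (s - c))\<close> have mass one and live
  between c and c + 1/n: an approximate identity from the right of c.\<close>

lemma integral_ramp'_tendsto:
  fixes y :: "real \<Rightarrow> 'a::euclidean_space"
  assumes y: "continuous_on {a..b} y" and c: "a < c" "c < b"
  shows "(\<lambda>n. LINT s|lborel_on a b. (real n * ramp' (real n * (s - c))) *\<^sub>R y s) \<longlonglongrightarrow> y c"
proof (rule LIMSEQ_I)
  fix e :: real assume e: "e > 0"
  have "isCont y c" using continuous_on_interior[OF y] c by simp
  then obtain d where d: "d > 0" "\<And>s. \<bar>s - c\<bar> < d \<Longrightarrow> norm (y s - y c) < e/2"
    using e unfolding isCont_def by (metis LIM_def dist_norm dist_real_def half_gt_zero norm_zero diff_self)
  \<comment> \<open>The bound 1/d places the support of the kernel within distance d of c; the bound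
    1/(b - c) keeps it in [a,b], so that no mass is lost.\<close>
  obtain n0 where n0: "real n0 > max (1/d) (1/(b-c))" using reals_Archimedean2 by blast
  show "\<exists>n0. \<forall>n\<ge>n0. norm ((LINT s|lborel_on a b. (real n * ramp' (real n * (s - c))) *\<^sub>R y s) - y c) < e"
  proof (intro exI allI impI)
    fix n assume "n \<ge> n0"
    then have n: "real n > 1/d" "real n > 1/(b-c)" using n0 by (auto intro: less_le_trans)
    have npos: "real n > 0" using n d by (meson less_trans zero_less_divide_1_iff)
    let ?k = "\<lambda>s. real n * ramp' (real n * (s - c))"
    have k0: "?k s \<ge> 0" for s using ramp'_nonneg by simp
    have kcont: "continuous_on {a..b} ?k" by (intro continuous_intros)
    have "(?k has_integral (ramp (real n * (b - c)) - ramp (real n * (a - c)))) {a..b}"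
      using c by (intro fundamental_theorem_of_calculus)
        (auto simp flip: has_real_derivative_iff_has_vector_derivative intro!: DERIV_ramp_scaled)
    moreover have "ramp (real n * (b - c)) = 1"
      using n c by (intro ramp_eq_1) (simp add: field_simps)
    moreover have "ramp (real n * (a - c)) = 0"
      using c by (intro ramp_eq_0) (simp add: mult_le_0_iff)
    ultimately have hi: "(?k has_integral 1) {a..b}" by simp
    have ik: "integrable (lborel_on a b) ?k" by (rule continuous_imp_integrable_lborel_on[OF kcont])
    have Ik: "(LINT s|lborel_on a b. ?k s) = 1"
      using set_borel_integral_eq_integral(2)[of "{a..b}" ?k] ik integral_unique[OF hi]
      unfolding set_integral_eq_lborel_on set_integrable_iff_lborel_on by metis
    have i1: "integrable (lborel_on a b) (\<lambda>s. ?k s *\<^sub>R y s)"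
      by (intro continuous_imp_integrable_lborel_on continuous_intros kcont y)
    have i2: "integrable (lborel_on a b) (\<lambda>s. ?k s *\<^sub>R y c)"
      by (intro continuous_imp_integrable_lborel_on continuous_intros kcont y)
    have "(LINT s|lborel_on a b. ?k s *\<^sub>R y s) - y c
        = (LINT s|lborel_on a b. ?k s *\<^sub>R y s) - (LINT s|lborel_on a b. ?k s *\<^sub>R y c)"
      using Ik ik by simp
    also have "\<dots> = (LINT s|lborel_on a b. ?k s *\<^sub>R (y s - y c))"
      using i1 i2 by (simp add: scaleR_diff_right del: integral_scaleR_left)
    also have "norm \<dots> \<le> (LINT s|lborel_on a b. ?k s * (e/2))"
    proof (rule Bochner_Integration.integral_norm_bound_integral)
      show "integrable (lborel_on a b) (\<lambda>s. ?k s *\<^sub>R (y s - y c))"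
        using i1 i2 by (simp add: scaleR_diff_right)
      show "integrable (lborel_on a b) (\<lambda>s. ?k s * (e/2))" using ik by simp
      fix s
      show "norm (?k s *\<^sub>R (y s - y c)) \<le> ?k s * (e/2)"
      proof (cases "\<bar>s - c\<bar> < d")
        case True
        have "?k s * norm (y s - y c) \<le> ?k s * (e/2)"
          using d(2)[OF True] k0 by (intro mult_left_mono) auto
        then show ?thesis using k0[of s] by simp
      next
        case False
        then have "real n * (s - c) \<le> 0 \<or> real n * (s - c) \<ge> 1"
        proof (cases "s < c")
          case True
          then show ?thesis by (simp add: mult_le_0_iff)
        next
          case False
          with \<open>\<not> \<bar>s - c\<bar> < d\<close> have "real n * d \<le> real n * (s - c)"
            by (intro mult_left_mono) auto
          moreover have "1 \<le> real n * d" using n(1) d(1) by (simp add: field_simps)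
          ultimately show ?thesis by linarith
        qed
        then show ?thesis using ramp'_eq_0 by simp
      qed
    qed
    also have "\<dots> = e/2" using Ik by simp
    finally show "norm ((LINT s|lborel_on a b. ?k s *\<^sub>R y s) - y c) < e" using e by simp
  qed
qed

text \<open>The test functions are differences of two ever steeper steps: their derivatives are
  differences of two approximate identities, while they themselves tend to the indicator of the
  interval.\<close>

lemma has_weak_deriv_increment:
  fixes y v :: "real \<Rightarrow> 'a::euclidean_space"
  assumes wd: "has_weak_deriv a b y v" and y: "continuous_on {a..b} y"
    and c: "a < c" "c \<le> d" "d < b"
  shows "y d - y c = (LINT s|lborel_on a b. indicator {c<..d} s *\<^sub>R v s)"
proof -
  have v: "integrable (lborel_on a b) v"
    using wd by (simp add: has_weak_deriv_def set_integrable_iff_lborel_on)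
  define \<phi> where "\<phi> n s = ramp (real n * (s - c)) - ramp (real n * (s - d))" for n s
  define \<phi>' where "\<phi>' n s = real n * ramp' (real n * (s - c)) - real n * ramp' (real n * (s - d))" for n s
  have d\<phi>: "(\<phi> n has_real_derivative \<phi>' n s) (at s)" for n s
    unfolding \<phi>_def \<phi>'_def by (intro DERIV_diff DERIV_ramp_scaled)
  have \<phi>1: "\<bar>\<phi> n s\<bar> \<le> 1" for n s
    using ramp_bounds[of "real n * (s - c)"] ramp_bounds[of "real n * (s - d)"]
    by (auto simp: \<phi>_def)
  have cont: "continuous_on A (\<phi> n)" "continuous_on A (\<phi>' n)" for A n
    unfolding \<phi>_def \<phi>'_def by (intro continuous_intros)+
  have lim1: "(\<lambda>n. LINT s|lborel_on a b. \<phi>' n s *\<^sub>R y s) \<longlonglongrightarrow> y c - y d"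
  proof -
    have "(\<lambda>n. (LINT s|lborel_on a b. (real n * ramp' (real n * (s - c))) *\<^sub>R y s)
       - (LINT s|lborel_on a b. (real n * ramp' (real n * (s - d))) *\<^sub>R y s)) \<longlonglongrightarrow> y c - y d"
      using c by (intro tendsto_diff integral_ramp'_tendsto y) auto
    moreover have "(LINT s|lborel_on a b. \<phi>' n s *\<^sub>R y s)
       = (LINT s|lborel_on a b. (real n * ramp' (real n * (s - c))) *\<^sub>R y s)
       - (LINT s|lborel_on a b. (real n * ramp' (real n * (s - d))) *\<^sub>R y s)" for n
      unfolding \<phi>'_def scaleR_diff_left
      by (intro Bochner_Integration.integral_diff continuous_imp_integrable_lborel_on
          continuous_intros y)
    ultimately show ?thesis by simp
  qed
  have lim2: "(\<lambda>n. LINT s|lborel_on a b. \<phi> n s *\<^sub>R v s)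
      \<longlonglongrightarrow> (LINT s|lborel_on a b. indicator {c<..d} s *\<^sub>R v s)"
  proof (rule integral_dominated_convergence[where w = "\<lambda>s. norm (v s)"])
    show "(\<lambda>s. indicator {c<..d} s *\<^sub>R v s) \<in> borel_measurable (lborel_on a b)"
      using v by (intro borel_measurable_scaleR indicator_measurable_lborel_on) auto
    show "(\<lambda>s. \<phi> n s *\<^sub>R v s) \<in> borel_measurable (lborel_on a b)" for n
      using v continuous_imp_measurable_lborel_on[OF cont(1)]
      by (intro borel_measurable_scaleR) auto
    show "integrable (lborel_on a b) (\<lambda>s. norm (v s))" using v by simp
    show "AE s in lborel_on a b. norm (\<phi> n s *\<^sub>R v s) \<le> norm (v s)" for n
      using \<phi>1 by (intro AE_I2) (simp add: mult_left_le_one_le)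
    show "AE s in lborel_on a b. (\<lambda>n. \<phi> n s *\<^sub>R v s) \<longlonglongrightarrow> indicator {c<..d} s *\<^sub>R v s"
    proof (intro AE_I2 tendsto_scaleR tendsto_const)
      fix s
      have L: "(\<lambda>n. ramp (real n * (s - k))) \<longlonglongrightarrow> indicator {k<..} s" for k
      proof (cases "k < s")
        case True
        obtain N where N: "real N > 1 / (s - k)" using reals_Archimedean2 by blast
        have "ramp (real n * (s - k)) = 1" if "n \<ge> N" for n
        proof (rule ramp_eq_1)
          have "real n > 1 / (s - k)" using that N by (meson less_le_trans of_nat_mono)
          then show "real n * (s - k) \<ge> 1" using True by (simp add: field_simps)
        qed
        then show ?thesis using True by (intro tendsto_eventually) (auto simp: eventually_sequentially)
      next
        case False
        then show ?thesis by (simp add: ramp_eq_0 mult_le_0_iff)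
      qed
      have "(\<lambda>n. \<phi> n s) \<longlonglongrightarrow> indicator {c<..} s - indicator {d<..} s"
        unfolding \<phi>_def by (intro tendsto_diff L)
      then show "(\<lambda>n. \<phi> n s) \<longlonglongrightarrow> indicator {c<..d} s"
        using c by (auto simp: indicator_def split: if_splits)
    qed
  qed
  \<comment> \<open>The step at d is completed only at d + 1/n, which must stay below b for the
    support to be compact in the open interval.\<close>
  obtain N where N: "real N > 1 / (b - d)" using reals_Archimedean2 by blast
  have test: "test_function a b (\<phi> n)" if "n \<ge> N" for n
  proof -
    have n: "real n > 1 / (b - d)" using that N by (meson less_le_trans of_nat_mono)
    then have n0: "real n > 0" using c by (meson diff_gt_0_iff_gt less_trans zero_less_divide_1_iff)
    have "\<phi> n C1_differentiable_on UNIV"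
      unfolding C1_differentiable_on_def has_real_derivative_iff_has_vector_derivative[symmetric]
      using d\<phi> cont(2) by blast
    moreover have "\<phi> n s = 0" if "s \<notin> {c..d + 1 / n}" for s
    proof (cases "s < c")
      case True
      then show ?thesis using c by (simp add: \<phi>_def ramp_eq_0 mult_le_0_iff)
    next
      case False
      then have "s > d + 1 / n" using that by auto
      then have "real n * (s - d) \<ge> 1" using n0 by (simp add: field_simps)
      moreover have "real n * (s - c) \<ge> real n * (s - d)" using n0 c by simp
      ultimately show ?thesis by (simp add: \<phi>_def ramp_eq_1)
    qed
    moreover have "d + 1 / n < b" using n n0 c by (simp add: field_simps)
    ultimately show ?thesis unfolding test_function_def using c by blast
  qed
  have "(LINT s|lborel_on a b. \<phi>' n s *\<^sub>R y s) = - (LINT s|lborel_on a b. \<phi> n s *\<^sub>R v s)"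
    if "n \<ge> N" for n
  proof -
    have "deriv (\<phi> n) = \<phi>' n" using d\<phi> by (auto intro: DERIV_imp_deriv)
    moreover have "(LINT s|lborel_on a b. deriv (\<phi> n) s *\<^sub>R y s) = - (LINT s|lborel_on a b. \<phi> n s *\<^sub>R v s)"
      using wd test[OF that] unfolding has_weak_deriv_def set_integral_eq_lborel_on by blast
    ultimately show ?thesis by simp
  qed
  then have "(\<lambda>n. LINT s|lborel_on a b. \<phi>' n s *\<^sub>R y s)
      \<longlonglongrightarrow> - (LINT s|lborel_on a b. indicator {c<..d} s *\<^sub>R v s)"
    by (intro Lim_transform_eventually[OF tendsto_minus[OF lim2]])
      (auto intro: eventually_sequentiallyI[of N])
  with lim1 have "y c - y d = - (LINT s|lborel_on a b. indicator {c<..d} s *\<^sub>R v s)"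
    by (rule LIMSEQ_unique)
  then show ?thesis by (metis minus_diff_eq minus_minus)
qed

section \<open>Curves as integrals of their velocities\<close>

lemma AE_lborel_on_neq: "AE s in lborel_on a b. s \<noteq> c"
  unfolding AE_lborel_on using AE_lborel_singleton[of c] by eventually_elim simp

lemma AE_lborel_on_Icc: "AE s in lborel_on a b. s \<in> {a..b}"
  unfolding AE_lborel_on by simp

text \<open>Absolute continuity in integral form. The indicator of \<open>{..s}\<close> under the
  measure on [a,b] stands for integration from a to s, so that all these integrals share one measure
  space.\<close>

definition primitive_on :: "real \<Rightarrow> real \<Rightarrow> (real \<Rightarrow> 'a::euclidean_space) \<Rightarrow> (real \<Rightarrow> 'a) \<Rightarrow> bool" where
  "primitive_on a b y v \<longleftrightarrow> integrable (lborel_on a b) v \<and>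
     (\<forall>s\<in>{a..b}. y s = y a + (LINT r|lborel_on a b. indicator {..s} r *\<^sub>R v r))"

lemma integrable_indicator_scaleR:
  fixes v :: "real \<Rightarrow> 'a::euclidean_space"
  assumes "integrable (lborel_on a b) v" "A \<in> sets borel"
  shows "integrable (lborel_on a b) (\<lambda>r. indicator A r *\<^sub>R v r)"
  using assms by (intro integrable_bounded_mult_lborel_on[where B = 1] indicator_measurable_lborel_on)
    (auto simp: indicator_def)

lemma integrable_continuous_scaleR:
  fixes v :: "real \<Rightarrow> 'a::euclidean_space" and \<phi> :: "real \<Rightarrow> real"
  assumes \<phi>: "continuous_on {a..b} \<phi>" and v: "integrable (lborel_on a b) v"
  shows "integrable (lborel_on a b) (\<lambda>s. \<phi> s *\<^sub>R v s)"
proof -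
  obtain B where "\<forall>x\<in>{a..b}. norm (\<phi> x) \<le> B"
    using compact_imp_bounded[OF compact_continuous_image[OF \<phi> compact_Icc]]
    unfolding bounded_iff by blast
  then show ?thesis
    by (intro integrable_bounded_mult_lborel_on[OF v continuous_imp_measurable_lborel_on[OF \<phi>]]) auto
qed

lemma continuous_on_integral_atMost:
  fixes v :: "real \<Rightarrow> 'a::euclidean_space"
  assumes v: "integrable (lborel_on a b) v"
  shows "continuous_on S (\<lambda>s. LINT r|lborel_on a b. indicator {..s} r *\<^sub>R v r)"
proof (rule continuous_on_sequentiallyI)
  fix u s assume us: "u \<longlonglongrightarrow> (s::real)"
  show "(\<lambda>n. LINT r|lborel_on a b. indicator {..u n} r *\<^sub>R v r)
     \<longlonglongrightarrow> (LINT r|lborel_on a b. indicator {..s} r *\<^sub>R v r)"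
  proof (rule integral_dominated_convergence[where w = "\<lambda>s. norm (v s)"])
    show "AE r in lborel_on a b. (\<lambda>n. indicator {..u n} r *\<^sub>R v r) \<longlonglongrightarrow> indicator {..s} r *\<^sub>R v r"
      \<comment> \<open>The indicators converge pointwise except possibly at r = s.\<close>
      using AE_lborel_on_neq[of s]
    proof eventually_elim
      fix r assume r: "r \<noteq> s"
      have "\<forall>\<^sub>F n in sequentially. indicator {..u n} r = (indicator {..s} r :: real)"
      proof (cases "r < s")
        case True
        then show ?thesis using order_tendstoD(1)[OF us, of r]
          by (auto elim!: eventually_mono simp: indicator_def)
      next
        case False
        then show ?thesis using order_tendstoD(2)[OF us, of r] r
          by (auto elim!: eventually_mono simp: indicator_def)
      qed
      then show "(\<lambda>n. indicator {..u n} r *\<^sub>R v r) \<longlonglongrightarrow> indicator {..s} r *\<^sub>R v r"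
        by (intro tendsto_eventually) (auto elim: eventually_mono)
    qed
    show "(\<lambda>r. indicator {..u n} r *\<^sub>R v r) \<in> borel_measurable (lborel_on a b)" for n
      using integrable_indicator_scaleR[OF v, of "{..u n}"] by auto
    show "(\<lambda>r. indicator {..s} r *\<^sub>R v r) \<in> borel_measurable (lborel_on a b)"
      using integrable_indicator_scaleR[OF v, of "{..s}"] by auto
    show "AE r in lborel_on a b. norm (indicator {..u n} r *\<^sub>R v r) \<le> norm (v r)" for n
      by (intro AE_I2) (simp add: indicator_def)
  qed (use v in simp)
qed

lemma has_weak_derivD:
  assumes "has_weak_deriv a b y v"
  shows "integrable (lborel_on a b) y" "integrable (lborel_on a b) v"
    "test_function a b \<phi> \<Longrightarrow>
      (LINT s|lborel_on a b. deriv \<phi> s *\<^sub>R y s) = - (LINT s|lborel_on a b. \<phi> s *\<^sub>R v s)"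
  using assms unfolding has_weak_deriv_def set_integrable_iff_lborel_on set_integral_eq_lborel_on
  by blast+

text \<open>In the open interval y minus the integral of v has no increments; continuity carries
  this to the endpoints, which test functions never see.\<close>

lemma has_weak_deriv_imp_primitive_on:
  fixes y v :: "real \<Rightarrow> 'a::euclidean_space"
  assumes wd: "has_weak_deriv a b y v" and y: "continuous_on {a..b} y" and "a \<le> b"
  shows "primitive_on a b y v"
proof -
  have v: "integrable (lborel_on a b) v"
    by (rule has_weak_derivD(2)[OF wd])
  define F where "F s = (LINT r|lborel_on a b. indicator {..s} r *\<^sub>R v r)" for s
  have Fa: "F a = 0"
  proof -
    have "F a = (LINT r|lborel_on a b. 0)" unfolding F_def
    proof (rule integral_cong_AE)
      have "AE r in lborel_on a b. r \<noteq> a \<and> r \<ge> a"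
        using AE_lborel_on_neq[of a a b] AE_space[of "lborel_on a b"]
        by eventually_elim (auto simp: space_restrict_space)
      then show "AE r in lborel_on a b. indicator {..a} r *\<^sub>R v r = 0"
        by eventually_elim (auto simp: indicator_def)
    qed (use integrable_indicator_scaleR[OF v, of "{..a}"] in auto)
    then show ?thesis by simp
  qed
  have const: "y s - F s = y a - F a" if "s \<in> {a..b}" for s
  proof (cases "a = b")
    \<comment> \<open>The degenerate interval arises from the initial time \<open>t = T\<close>; it
      has no interior point to start from.\<close>
    case True
    with that show ?thesis by simp
  next
    case False
    with \<open>a \<le> b\<close> have ab: "a < b" by simp
    define m where "m = (a + b) / 2"
    have m: "a < m" "m < b" using ab by (auto simp: m_def)
    have mono: "y d - F d = y c - F c" if "a < c" "c \<le> d" "d < b" for c d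
    proof -
      have "F d - F c = (LINT r|lborel_on a b. indicator {..d} r *\<^sub>R v r - indicator {..c} r *\<^sub>R v r)"
        unfolding F_def
        by (intro Bochner_Integration.integral_diff[symmetric] integrable_indicator_scaleR[OF v]) auto
      also have "\<dots> = (LINT r|lborel_on a b. indicator {c<..d} r *\<^sub>R v r)"
        using that by (intro Bochner_Integration.integral_cong refl) (auto simp: indicator_def)
      also have "\<dots> = y d - y c" using has_weak_deriv_increment[OF wd y that] by simp
      finally show ?thesis by (simp add: algebra_simps)
    qed
    have inner: "y s - F s = y m - F m" if "s \<in> {a<..<b}" for s
      using mono[of s m] mono[of m s] m that by (cases "s \<le> m") auto
    have cont: "continuous_on {a..b} (\<lambda>s. y s - F s)"
      using y continuous_on_integral_atMost[OF v] unfolding F_def by (intro continuous_intros)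
    have "y s - F s = y m - F m" if "s \<in> {a..b}" for s
      using continuous_constant_on_closure[of "{a<..<b}" "\<lambda>s. y s - F s" "y m - F m" s] inner cont that ab
      by simp
    then show ?thesis using that ab by simp
  qed
  have "y s = y a + F s" if "s \<in> {a..b}" for s
    using const[OF that] unfolding Fa diff_zero by (metis add.commute diff_add_cancel)
  then show ?thesis using v unfolding primitive_on_def F_def by blast
qed

lemma primitive_on_continuous:
  assumes "primitive_on a b y v"
  shows "continuous_on {a..b} y"
proof -
  have "continuous_on {a..b} (\<lambda>s. y a + (LINT r|lborel_on a b. indicator {..s} r *\<^sub>R v r))"
    using assms continuous_on_integral_atMost[of a b v] unfolding primitive_on_def
    by (intro continuous_intros) auto
  then show ?thesis
    by (rule continuous_on_eq) (use assms in \<open>unfold primitive_on_def, blast intro: sym\<close>)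
qed

lemma primitive_on_increment:
  fixes y v :: "real \<Rightarrow> 'a::euclidean_space"
  assumes p: "primitive_on a b y v" and "a \<le> c" "c \<le> d" "d \<le> b"
  shows "y d - y c = (LINT s|lborel_on a b. indicator {c<..d} s *\<^sub>R v s)"
proof -
  have v: "integrable (lborel_on a b) v" using p by (simp add: primitive_on_def)
  have "y d - y c = (LINT r|lborel_on a b. indicator {..d} r *\<^sub>R v r) - (LINT r|lborel_on a b. indicator {..c} r *\<^sub>R v r)"
  proof -
    have eq: "y s = y a + (LINT r|lborel_on a b. indicator {..s} r *\<^sub>R v r)" if "s \<in> {a..b}" for s
      using p that unfolding primitive_on_def by blast
    have "c \<in> {a..b}" "d \<in> {a..b}" using assms by auto
    from eq[OF this(1)] eq[OF this(2)] show ?thesis by (simp only: add_diff_cancel_left)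
  qed
  also have "\<dots> = (LINT r|lborel_on a b. indicator {..d} r *\<^sub>R v r - indicator {..c} r *\<^sub>R v r)"
    by (intro Bochner_Integration.integral_diff[symmetric] integrable_indicator_scaleR[OF v]) auto
  also have "\<dots> = (LINT r|lborel_on a b. indicator {c<..d} r *\<^sub>R v r)"
    using assms by (intro Bochner_Integration.integral_cong refl) (auto simp: indicator_def)
  finally show ?thesis .
qed

section \<open>Integration by parts against test functions\<close>

lemma test_function_DERIV:
  assumes "test_function a b \<phi>"
  shows "(\<phi> has_real_derivative deriv \<phi> s) (at s)" "continuous_on UNIV (deriv \<phi>)"
proof -
  obtain D where D: "\<And>s. (\<phi> has_real_derivative D s) (at s)" "continuous_on UNIV D"
    using assms unfolding test_function_def C1_differentiable_on_def
      has_real_derivative_iff_has_vector_derivative[symmetric] by blast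
  moreover have "deriv \<phi> = D" using D by (auto intro: DERIV_imp_deriv)
  ultimately show "(\<phi> has_real_derivative deriv \<phi> s) (at s)" "continuous_on UNIV (deriv \<phi>)"
    by auto
qed

text \<open>The truncation \<open>if r \<le> s\<close> is the form in which the inner integral
  appears once the order of integration is exchanged.\<close>

lemma integral_deriv_lborel_on:
  fixes \<phi> \<phi>' :: "real \<Rightarrow> real"
  assumes d: "\<And>s. (\<phi> has_real_derivative \<phi>' s) (at s)" and c: "continuous_on UNIV \<phi>'"
    and "a \<le> r" "r \<le> b"
  shows "(LINT s|lborel_on a b. (if r \<le> s then \<phi>' s else 0)) = \<phi> b - \<phi> r"
proof -
  have "(LINT s|lborel_on a b. (if r \<le> s then \<phi>' s else 0)) = (LINT s:{a..b}|lborel. (if r \<le> s then \<phi>' s else 0))"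
    by (simp add: set_integral_eq_lborel_on)
  also have "\<dots> = (LINT s:{r..b}|lborel. \<phi>' s)"
    unfolding set_lebesgue_integral_def using assms
    by (intro Bochner_Integration.integral_cong refl) (auto simp: indicator_def)
  also have "\<dots> = integral {r..b} \<phi>'"
    using c by (intro set_borel_integral_eq_integral borel_integrable_atLeastAtMost')
      (auto intro: continuous_on_subset)
  also have "\<dots> = \<phi> b - \<phi> r"
    using assms by (intro integral_unique fundamental_theorem_of_calculus)
      (auto simp flip: has_real_derivative_iff_has_vector_derivative intro: has_field_derivative_at_within)
  finally show ?thesis .
qed

text \<open>Fubini on the triangle r \<le> s: the derivative of the test function, integrated from r
  to b, leaves minus its value at r because its value at b is zero.\<close>

lemma primitive_on_imp_has_weak_deriv:
  fixes y v :: "real \<Rightarrow> 'a::euclidean_space"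
  assumes p: "primitive_on a b y v" and ab: "a \<le> b"
  shows "has_weak_deriv a b y v"
  unfolding has_weak_deriv_def
proof (intro conjI allI impI)
  have v: "integrable (lborel_on a b) v" using p by (simp add: primitive_on_def)
  have y: "continuous_on {a..b} y" by (rule primitive_on_continuous[OF p])
  show "set_integrable lborel {a..b} y"
    using continuous_imp_integrable_lborel_on[OF y] by (simp add: set_integrable_iff_lborel_on)
  show "set_integrable lborel {a..b} v" using v by (simp add: set_integrable_iff_lborel_on)
  fix \<phi> assume test: "test_function a b \<phi>"
  note d = test_function_DERIV[OF test]
  have dcont: "continuous_on {a..b} (deriv \<phi>)" using d(2) continuous_on_subset by blast
  obtain c' d' where "a < c'" "d' < b" "\<And>s. s \<notin> {c'..d'} \<Longrightarrow> \<phi> s = 0"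
    using test unfolding test_function_def by blast
  then have \<phi>0: "\<phi> a = 0" "\<phi> b = 0" by auto
  interpret L: finite_measure "lborel_on a b" by (rule finite_measure_lborel_on)
  interpret P: pair_sigma_finite "lborel_on a b" "lborel_on a b" ..
  obtain B where "\<forall>x\<in>{a..b}. norm (deriv \<phi> x) \<le> B"
    using compact_imp_bounded[OF compact_continuous_image[OF dcont compact_Icc]]
    unfolding bounded_iff by blast
  then have B: "\<bar>deriv \<phi> s\<bar> \<le> B" if "s \<in> {a..b}" for s using that by auto
  have id: "(\<lambda>s. s) \<in> borel_measurable (lborel_on a b)"
    by (rule continuous_imp_measurable_lborel_on) (intro continuous_intros)
  let ?L2 = "lborel_on a b \<Otimes>\<^sub>M lborel_on a b"
  have mfst: "fst \<in> borel_measurable ?L2" by (rule measurable_compose[OF measurable_fst id])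
  have msnd: "snd \<in> borel_measurable ?L2" by (rule measurable_compose[OF measurable_snd id])
  let ?f = "\<lambda>s r. (deriv \<phi> s * (if r \<le> s then 1 else 0)) *\<^sub>R v r"
  have m1: "(\<lambda>z. deriv \<phi> (fst z)) \<in> borel_measurable ?L2"
    by (rule measurable_compose[OF measurable_fst]) (rule continuous_imp_measurable_lborel_on[OF dcont])
  have m2: "(\<lambda>z. v (snd z)) \<in> borel_measurable ?L2"
    by (rule measurable_compose[OF measurable_snd]) (use v in auto)
  have m3: "{z \<in> space ?L2. snd z \<le> fst z} \<in> sets ?L2"
    by (rule borel_measurable_le[OF msnd mfst])
  have mf: "case_prod ?f \<in> borel_measurable ?L2"
    unfolding case_prod_beta'
    by (intro borel_measurable_scaleR borel_measurable_times measurable_If m1 m2 m3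
        borel_measurable_const)
  \<comment> \<open>The derivative of the test function is bounded on the compact interval and v is
    integrable, which gives an integrable majorant on the product.\<close>
  have int: "integrable (lborel_on a b \<Otimes>\<^sub>M lborel_on a b) (case_prod ?f)"
  proof (rule Bochner_Integration.integrable_bound)
    show "integrable (lborel_on a b \<Otimes>\<^sub>M lborel_on a b) (\<lambda>(s, r). B * norm (v r))"
    proof (rule P.Fubini_integrable)
      show "(\<lambda>(s, r). B * norm (v r)) \<in> borel_measurable ?L2"
        unfolding case_prod_beta'
        by (intro borel_measurable_times borel_measurable_norm borel_measurable_const measurable_compose[OF m2])
    qed (use v in auto)
    show "AE z in lborel_on a b \<Otimes>\<^sub>M lborel_on a b. norm (case_prod ?f z) \<le> norm (case z of (s, r) \<Rightarrow> B * norm (v r))"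
    proof (intro AE_I2, clarify)
      fix s r assume "(s, r) \<in> space (lborel_on a b \<Otimes>\<^sub>M lborel_on a b)"
      then have "s \<in> {a..b}" by (simp add: space_pair_measure space_restrict_space)
      then have "\<bar>deriv \<phi> s\<bar> * norm (v r) \<le> \<bar>B\<bar> * norm (v r)" 
        using B[of s] by (intro mult_right_mono) auto
      then show "norm (?f s r) \<le> norm (B * norm (v r))"
        by (auto simp: abs_mult)
    qed
  qed (rule mf)
  have "(LINT s|lborel_on a b. deriv \<phi> s *\<^sub>R y s)
     = (LINT s|lborel_on a b. deriv \<phi> s *\<^sub>R y a + (LINT r|lborel_on a b. ?f s r))"
  proof (intro Bochner_Integration.integral_cong refl)
    fix s assume "s \<in> space (lborel_on a b)"
    then have s: "s \<in> {a..b}" by (simp add: space_restrict_space)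
    have "(LINT r|lborel_on a b. ?f s r) = (LINT r|lborel_on a b. deriv \<phi> s *\<^sub>R (indicator {..s} r *\<^sub>R v r))"
      by (intro Bochner_Integration.integral_cong refl) (auto simp: indicator_def)
    also have "\<dots> = deriv \<phi> s *\<^sub>R (LINT r|lborel_on a b. indicator {..s} r *\<^sub>R v r)"
      by (simp del: scaleR_scaleR)
    finally show "deriv \<phi> s *\<^sub>R y s = deriv \<phi> s *\<^sub>R y a + (LINT r|lborel_on a b. ?f s r)"
      using p s unfolding primitive_on_def by (metis scaleR_add_right)
  qed
  also have "\<dots> = (LINT s|lborel_on a b. deriv \<phi> s *\<^sub>R y a) + (LINT s|lborel_on a b. LINT r|lborel_on a b. ?f s r)"
  proof (rule Bochner_Integration.integral_add)
    show "integrable (lborel_on a b) (\<lambda>s. deriv \<phi> s *\<^sub>R y a)"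
      by (intro continuous_imp_integrable_lborel_on continuous_intros dcont)
    show "integrable (lborel_on a b) (\<lambda>s. LINT r|lborel_on a b. ?f s r)"
      using P.integrable_fst'[OF int] by simp
  qed
  also have "(LINT s|lborel_on a b. deriv \<phi> s *\<^sub>R y a) = (LINT s|lborel_on a b. deriv \<phi> s) *\<^sub>R y a"
    using continuous_imp_integrable_lborel_on[OF dcont] by simp
  also have "(LINT s|lborel_on a b. deriv \<phi> s) = (LINT s|lborel_on a b. (if a \<le> s then deriv \<phi> s else 0))"
    by (intro Bochner_Integration.integral_cong refl) (auto simp: space_restrict_space)
  also have "\<dots> = 0" using integral_deriv_lborel_on[OF d, of a a b] ab \<phi>0 by simp
  also have "(LINT s|lborel_on a b. LINT r|lborel_on a b. ?f s r) = (LINT r|lborel_on a b. LINT s|lborel_on a b. ?f s r)"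
    by (rule P.Fubini_integral[OF int, symmetric])
  also have "\<dots> = (LINT r|lborel_on a b. - (\<phi> r *\<^sub>R v r))"
  proof (intro Bochner_Integration.integral_cong refl)
    fix r assume "r \<in> space (lborel_on a b)"
    then have r: "a \<le> r" "r \<le> b" by (auto simp: space_restrict_space)
    have i: "integrable (lborel_on a b) (\<lambda>s. deriv \<phi> s * (if r \<le> s then 1 else 0))"
    proof -
      have "integrable (lborel_on a b) (\<lambda>s. indicator {r..} s *\<^sub>R deriv \<phi> s)"
        by (intro integrable_indicator_scaleR continuous_imp_integrable_lborel_on dcont) auto
      then show ?thesis
        by (rule Bochner_Integration.integrable_cong[THEN iffD1, rotated -1]) (auto simp: indicator_def)
    qed
    have "(LINT s|lborel_on a b. ?f s r) = (LINT s|lborel_on a b. deriv \<phi> s * (if r \<le> s then 1 else 0)) *\<^sub>R v r"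
      using i by simp
    also have "(LINT s|lborel_on a b. deriv \<phi> s * (if r \<le> s then 1 else 0)) = (LINT s|lborel_on a b. (if r \<le> s then deriv \<phi> s else 0))"
      by (intro Bochner_Integration.integral_cong refl) auto
    also have "\<dots> = - \<phi> r" using integral_deriv_lborel_on[OF d r] \<phi>0 by simp
    finally show "(LINT s|lborel_on a b. ?f s r) = - (\<phi> r *\<^sub>R v r)" by simp
  qed
  finally show "(LINT s:{a..b}|lborel. deriv \<phi> s *\<^sub>R y s) = - (LINT s:{a..b}|lborel. \<phi> s *\<^sub>R v s)"
    by (simp add: set_integral_eq_lborel_on)
qed

text \<open>Lebesgue differentiation. The right difference quotient alone settles both uniqueness
  and the behaviour at zeros of a nonnegative function.\<close>

lemma primitive_on_right_derivative:
  fixes y v :: "real \<Rightarrow> 'a::euclidean_space"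
  assumes p: "primitive_on a b y v"
  shows "AE x in lborel_on a b. \<forall>e>0. \<exists>d>0. \<forall>h. 0 < h \<longrightarrow> h < d \<longrightarrow> x + h \<le> b \<longrightarrow>
    norm ((y (x + h) - y x) /\<^sub>R h - v x) < e"
proof -
  have v: "integrable (lborel_on a b) v" using p by (simp add: primitive_on_def)
  \<comment> \<open>Extension by zero allows differentiation on the whole line; the condition
    \<open>x + h \<le> b\<close> keeps the quotient inside [a,b].\<close>
  define f where "f s = indicator {a..b} s *\<^sub>R v s" for s
  have f: "integrable lborel f"
    using v unfolding f_def by (simp add: integrable_restrict_space)
  have fs: "set_integrable lborel A f" if "A \<in> sets borel" for A
    using f that by (auto simp: set_integrable_def intro: integrable_mult_indicator)
  have "f integrable_on cbox c d" for c d
    using set_borel_integral_eq_integral(1)[OF fs, of "cbox c d"] by simp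
  then obtain N where N: "negligible N"
    "\<And>x e. \<lbrakk>x \<notin> N; 0 < e\<rbrakk> \<Longrightarrow> \<exists>d>0. \<forall>h. 0 < h \<and> h < d \<longrightarrow>
       norm (integral (cbox x (x + h *\<^sub>R One)) f /\<^sub>R h ^ DIM(real) - f x) < e"
    by (rule integrable_ccontinuous_explicit) blast
  have "AE x in lebesgue. x \<notin> N"
    using N(1) by (auto simp: negligible_iff_null_sets intro: AE_not_in)
  then have "AE x in lborel. x \<notin> N" by (simp add: AE_completion_iff)
  then have "AE x in lborel_on a b. x \<notin> N"
    unfolding AE_lborel_on by eventually_elim simp
  moreover have "AE x in lborel_on a b. x \<in> {a..b}"
    unfolding AE_lborel_on by simp
  ultimately show ?thesis
  proof eventually_elim
    fix x assume x: "x \<notin> N" "x \<in> {a..b}"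
    show "\<forall>e>0. \<exists>d>0. \<forall>h. 0 < h \<longrightarrow> h < d \<longrightarrow> x + h \<le> b \<longrightarrow>
      norm ((y (x + h) - y x) /\<^sub>R h - v x) < e"
    proof (intro allI impI)
      fix e :: real assume "e > 0"
      from N(2)[OF x(1) this] obtain d where d: "d > 0"
        "\<And>h. 0 < h \<Longrightarrow> h < d \<Longrightarrow> norm (integral (cbox x (x + h *\<^sub>R One)) f /\<^sub>R h ^ DIM(real) - f x) < e"
        by blast
      have "integral (cbox x (x + h *\<^sub>R One)) f = y (x + h) - y x" if h: "0 < h" "x + h \<le> b" for h
      proof -
        have "integral (cbox x (x + h *\<^sub>R One)) f = (LINT s:{x..x+h}|lborel. f s)"
          using set_borel_integral_eq_integral(2)[OF fs, of "{x..x+h}"] by simp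
        also have "\<dots> = (LINT s:{a..b}|lborel. indicator {x..x+h} s *\<^sub>R v s)"
          unfolding set_lebesgue_integral_def f_def using x h
          by (intro Bochner_Integration.integral_cong refl) (auto simp: indicator_def)
        also have "\<dots> = (LINT s|lborel_on a b. indicator {x..x+h} s *\<^sub>R v s)"
          by (simp add: set_integral_eq_lborel_on)
        also have "\<dots> = (LINT s|lborel_on a b. indicator {x<..x+h} s *\<^sub>R v s)"
        proof (rule integral_cong_AE)
          show "AE s in lborel_on a b. indicator {x..x + h} s *\<^sub>R v s = indicator {x<..x + h} s *\<^sub>R v s"
            using AE_lborel_on_neq[of x] by eventually_elim (auto simp: indicator_def)
        qed (use integrable_indicator_scaleR[OF v] in auto)
        also have "\<dots> = y (x + h) - y x"
          using primitive_on_increment[OF p, of x "x + h"] x h by simp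
        finally show ?thesis .
      qed
      with d x show "\<exists>d>0. \<forall>h. 0 < h \<longrightarrow> h < d \<longrightarrow> x + h \<le> b \<longrightarrow>
          norm ((y (x + h) - y x) /\<^sub>R h - v x) < e"
        by (intro exI[of _ d]) (force simp: f_def)
    qed
  qed
qed

section \<open>Uniqueness and linear images of weak derivatives; derivatives at zeros\<close>

lemma primitive_on_zero:
  fixes v :: "real \<Rightarrow> 'a::euclidean_space"
  assumes "primitive_on a b (\<lambda>_. 0) v"
  shows "AE s in lborel_on a b. v s = 0"
proof -
  show ?thesis
    using primitive_on_right_derivative[OF assms] AE_lborel_on_neq[of b a b] AE_lborel_on_Icc[of a b]
  proof eventually_elim
    fix x assume *: "\<forall>e>0. \<exists>d>0. \<forall>h. 0 < h \<longrightarrow> h < d \<longrightarrow> x + h \<le> b \<longrightarrow> norm ((0 - 0) /\<^sub>R h - v x) < e"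
      and x: "x \<noteq> b" "x \<in> {a..b}"
    have "norm (v x) < e" if "e > 0" for e
    proof -
      from *[rule_format, OF that] obtain d where d: "d > 0"
        "\<forall>h. 0 < h \<longrightarrow> h < d \<longrightarrow> x + h \<le> b \<longrightarrow> norm ((0 - 0) /\<^sub>R h - v x) < e" by (elim exE conjE)
      have "norm ((0 - 0) /\<^sub>R min (d/2) (b - x) - v x) < e"
        using d(1) x by (intro d(2)[rule_format]) auto
      then show ?thesis by simp
    qed
    then show "v x = 0" by (metis less_irrefl norm_eq_zero zero_less_norm_iff)
  qed
qed

text \<open>Here y itself may be discontinuous: the difference of the two candidates is a weak
  derivative of the zero function, and that function is continuous, so the representation as a
  primitive applies to it.\<close>

lemma has_weak_deriv_unique:
  fixes y v w :: "real \<Rightarrow> 'a::euclidean_space"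
  assumes v: "has_weak_deriv a b y v" and w: "has_weak_deriv a b y w" and "a \<le> b"
  shows "AE s in lborel_on a b. v s = w s"
proof -
  have iv: "integrable (lborel_on a b) v" "integrable (lborel_on a b) w"
    using has_weak_derivD(2)[OF v] has_weak_derivD(2)[OF w] .
  have "has_weak_deriv a b (\<lambda>_. 0) (\<lambda>s. v s - w s)"
    unfolding has_weak_deriv_def set_integrable_iff_lborel_on set_integral_eq_lborel_on
  proof (intro conjI allI impI)
    show "integrable (lborel_on a b) (\<lambda>s. v s - w s)" using iv by simp
    fix \<phi> assume test: "test_function a b \<phi>"
    have c\<phi>: "continuous_on {a..b} \<phi>"
      by (rule DERIV_continuous_on) (rule has_field_derivative_at_within[OF test_function_DERIV(1)[OF test]])
    have "integrable (lborel_on a b) (\<lambda>s. \<phi> s *\<^sub>R v s)" "integrable (lborel_on a b) (\<lambda>s. \<phi> s *\<^sub>R w s)"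
      using iv by (simp_all add: integrable_continuous_scaleR[OF c\<phi>])
    then have "(LINT s|lborel_on a b. \<phi> s *\<^sub>R (v s - w s))
      = (LINT s|lborel_on a b. \<phi> s *\<^sub>R v s) - (LINT s|lborel_on a b. \<phi> s *\<^sub>R w s)"
      by (simp add: scaleR_diff_right)
    also have "\<dots> = 0"
      using has_weak_derivD(3)[OF v test] has_weak_derivD(3)[OF w test] by simp
    finally show "(LINT s|lborel_on a b. deriv \<phi> s *\<^sub>R 0) = - (LINT s|lborel_on a b. \<phi> s *\<^sub>R (v s - w s))"
      by simp
  qed simp
  then have "primitive_on a b (\<lambda>_. 0) (\<lambda>s. v s - w s)"
    by (rule has_weak_deriv_imp_primitive_on) (use \<open>a \<le> b\<close> in auto)
  from primitive_on_zero[OF this] show ?thesis by eventually_elim simp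
qed

text \<open>Replaces the representative picked by \<open>SOME\<close> with any convenient one, at
  the price of a null set.\<close>

lemma weak_deriv_AE_eq:
  assumes "has_weak_deriv a b y v" "a \<le> b"
  shows "AE s in lborel_on a b. weak_deriv a b y s = v s"
proof -
  have "has_weak_deriv a b y (weak_deriv a b y)"
    unfolding weak_deriv_def by (rule someI[where P = "has_weak_deriv a b y", OF assms(1)])
  from has_weak_deriv_unique[OF this assms] show ?thesis .
qed

lemma has_weak_deriv_bounded_linear:
  fixes y v :: "real \<Rightarrow> 'a::euclidean_space" and f :: "'a \<Rightarrow> 'b::euclidean_space"
  assumes f: "bounded_linear f" and wd: "has_weak_deriv a b y v"
  shows "has_weak_deriv a b (\<lambda>s. f (y s)) (\<lambda>s. f (v s))"
  unfolding has_weak_deriv_def set_integrable_iff_lborel_on set_integral_eq_lborel_on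
proof (intro conjI allI impI)
  interpret f: bounded_linear f by fact
  have i: "integrable (lborel_on a b) y" "integrable (lborel_on a b) v"
    using has_weak_derivD(1,2)[OF wd] .
  show "integrable (lborel_on a b) (\<lambda>s. f (y s))" "integrable (lborel_on a b) (\<lambda>s. f (v s))"
    using integrable_bounded_linear[OF f] i by blast+
  have *: "(LINT s|lborel_on a b. \<phi> s *\<^sub>R f (z s)) = f (LINT s|lborel_on a b. \<phi> s *\<^sub>R z s)"
    if \<phi>: "continuous_on {a..b} \<phi>" and z: "integrable (lborel_on a b) z" for \<phi> z
  proof -
    have "integrable (lborel_on a b) (\<lambda>s. \<phi> s *\<^sub>R z s)"
      by (rule integrable_continuous_scaleR[OF \<phi> z])
    from integral_bounded_linear[OF f this] show ?thesis by (simp add: f.scaleR)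
  qed
  fix \<phi> assume test: "test_function a b \<phi>"
  have "continuous_on {a..b} \<phi>"
    by (rule DERIV_continuous_on) (rule has_field_derivative_at_within[OF test_function_DERIV(1)[OF test]])
  moreover have "continuous_on {a..b} (deriv \<phi>)"
    using test_function_DERIV(2)[OF test] continuous_on_subset by blast
  moreover have "(LINT s|lborel_on a b. deriv \<phi> s *\<^sub>R y s) = - (LINT s|lborel_on a b. \<phi> s *\<^sub>R v s)"
    by (rule has_weak_derivD(3)[OF wd test])
  ultimately show "(LINT s|lborel_on a b. deriv \<phi> s *\<^sub>R f (y s)) = - (LINT s|lborel_on a b. \<phi> s *\<^sub>R f (v s))"
    using i by (simp only: * linear_neg[OF bounded_linear.linear[OF f]])
qed

lemma has_weak_deriv_cong:
  assumes "has_weak_deriv a b y v" "\<And>s. s \<in> {a..b} \<Longrightarrow> y s = z s"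
  shows "has_weak_deriv a b z v"
proof -
  have "set_integrable lborel {a..b} z = set_integrable lborel {a..b} y"
    using assms(2) by (intro set_integrable_cong) auto
  moreover have "(LINT s:{a..b}|lborel. k s *\<^sub>R z s) = (LINT s:{a..b}|lborel. k s *\<^sub>R y s)" for k
    using assms(2) by (intro set_lebesgue_integral_cong) auto
  ultimately show ?thesis using assms(1) unfolding has_weak_deriv_def by simp
qed

text \<open>Where the derivative is positive at a zero, the zero is isolated from the right, and there
  are only countably many such zeros. Negative derivatives at a zero contradict \<open>y \<ge> 0\<close>.\<close>

lemma primitive_on_nonneg_zero_deriv:
  fixes y v :: "real \<Rightarrow> real"
  assumes p: "primitive_on a b y v" and nonneg: "\<And>s. s \<in> {a..b} \<Longrightarrow> y s \<ge> 0"
  shows "AE s in lborel_on a b. y s = 0 \<longrightarrow> v s = 0"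
proof -
  define Z where "Z = {x \<in> {a..b}. y x = 0 \<and> (\<exists>d>0. \<forall>h. 0 < h \<longrightarrow> h < d \<longrightarrow> x + h \<le> b \<longrightarrow> y (x + h) > 0)}"
  have "\<forall>x\<in>Z. \<exists>d>0. \<forall>h. 0 < h \<longrightarrow> h < d \<longrightarrow> x + h \<le> b \<longrightarrow> y (x + h) > 0"
    by (auto simp: Z_def)
  then obtain d where d: "\<And>x. x \<in> Z \<Longrightarrow> d x > 0"
    "\<And>x h. x \<in> Z \<Longrightarrow> 0 < h \<Longrightarrow> h < d x \<Longrightarrow> x + h \<le> b \<Longrightarrow> y (x + h) > 0"
    by metis
  \<comment> \<open>The interval to the right of a point of \<open>Z\<close> contains no zero of y,
    hence no other point of \<open>Z\<close>. The intervals are therefore disjoint, and a disjoint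
    family of open intervals is countable.\<close>
  have sep: "x + d x \<le> x'" if "x \<in> Z" "x' \<in> Z" "x < x'" for x x'
  proof (rule ccontr)
    assume "\<not> x + d x \<le> x'"
    then have "y (x + (x' - x)) > 0" using that by (intro d(2)) (auto simp: Z_def)
    then show False using that by (simp add: Z_def)
  qed
  have "countable ((\<lambda>x. {x<..<x + d x}) ` Z)"
  proof (rule countable_disjoint_open_subsets)
    show "pairwise disjnt ((\<lambda>x. {x<..<x + d x}) ` Z)"
    proof (rule pairwise_imageI)
      fix x x' assume "x \<in> Z" "x' \<in> Z" "x \<noteq> x'"
      then show "disjnt {x<..<x + d x} {x'<..<x' + d x'}"
        using sep[of x x'] sep[of x' x] by (cases x x' rule: linorder_cases) (auto simp: disjnt_def)
    qed
  qed auto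
  moreover have "inj_on (\<lambda>x. {x<..<x + d x}) Z"
  proof (rule inj_onI)
    fix x x' assume *: "x \<in> Z" "x' \<in> Z" "{x<..<x + d x} = {x'<..<x' + d x'}"
    have "x + d x / 2 \<in> {x'<..<x' + d x'}" using d(1)[OF *(1)] by (simp flip: *(3))
    then show "x = x'"
      using *(1,2) d(1)[OF *(1)] sep[of x x'] sep[of x' x] by (cases x x' rule: linorder_cases) auto
  qed
  ultimately have "countable Z" by (metis countable_image_inj_on)
  then have "AE x in lborel. x \<notin> Z" by (intro AE_not_in countable_imp_null_set_lborel)
  then have "AE x in lborel_on a b. x \<notin> Z"
    unfolding AE_lborel_on by eventually_elim simp
  then show ?thesis
    using AE_lborel_on_neq[of b a b] AE_lborel_on_Icc[of a b] primitive_on_right_derivative[OF p]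
  proof eventually_elim
    fix x assume Z: "x \<notin> Z" and x: "x \<noteq> b" "x \<in> {a..b}"
      and *: "\<forall>e>0. \<exists>d>0. \<forall>h. 0 < h \<longrightarrow> h < d \<longrightarrow> x + h \<le> b \<longrightarrow> norm ((y (x + h) - y x) /\<^sub>R h - v x) < e"
    show "y x = 0 \<longrightarrow> v x = 0"
    proof (intro impI, rule ccontr)
      assume y0: "y x = 0" and v0: "v x \<noteq> 0"
      then obtain d where d: "d > 0"
        "\<And>h. 0 < h \<Longrightarrow> h < d \<Longrightarrow> x + h \<le> b \<Longrightarrow> norm (y (x + h) / h - v x) < \<bar>v x\<bar>"
        using *[rule_format, of "\<bar>v x\<bar>"] by (auto simp: divide_inverse mult.commute)
      show False
      proof (cases "v x > 0")
        case True
        have "y (x + h) > 0" if h: "0 < h" "h < d" "x + h \<le> b" for h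
        proof -
          have "y (x + h) / h > 0" using d(2)[OF h] True by (auto simp: abs_real_def split: if_splits)
          then show ?thesis using h by (simp add: zero_less_divide_iff)
        qed
        then have "x \<in> Z" using d(1) y0 x by (auto simp: Z_def)
        with Z show False by simp
      next
        case False
        \<comment> \<open>A step to a point strictly to the right of x and still in [a,b], where a
          negative quotient would make y negative.\<close>
        define h where "h = min (d/2) (b - x)"
        have h: "0 < h" "h < d" "x + h \<le> b" using d(1) x by (auto simp: h_def)
        have "y (x + h) / h < 0" using d(2)[OF h] False v0 by (auto simp: abs_real_def split: if_splits)
        moreover have "y (x + h) \<ge> 0" using nonneg[of "x + h"] x h by auto
        ultimately show False using h by (simp add: divide_less_0_iff)
      qed
    qed
  qed
qed

section \<open>Convex combinations converging in mean\<close>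

text \<open>A convex function with superlinear growth slower than every power \<open>p > 1\<close> and with explicit
  second derivative.\<close>

definition entropy :: "real \<Rightarrow> real" where
  "entropy x = x * arsinh x - sqrt (x\<^sup>2 + 1) + 1"

lemma entropy_has_derivative: "(entropy has_real_derivative arsinh x) (at x within A)"
proof -
  have "x\<^sup>2 + 1 > 0" by (smt (verit) zero_le_power2)
  then show ?thesis unfolding entropy_def
    by (auto intro!: derivative_eq_intros simp: field_simps power2_eq_square)
qed

lemma continuous_on_entropy: "continuous_on A entropy"
  by (rule DERIV_continuous_on) (rule entropy_has_derivative)

lemma entropy_nonneg: "entropy x \<ge> 0"
proof (cases "x \<ge> 0")
  case True
  have "entropy 0 \<le> entropy x"
    by (rule DERIV_nonneg_imp_nondecreasing[OF True])
      (use entropy_has_derivative[where A = UNIV] in \<open>meson arsinh_real_neg_iff not_le\<close>)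
  then show ?thesis by (simp add: entropy_def)
next
  case False
  then have "x \<le> 0" by simp
  then have "entropy 0 \<le> entropy x"
    by (rule DERIV_nonpos_imp_nonincreasing)
      (use entropy_has_derivative[where A = UNIV] in \<open>meson arsinh_real_pos_iff not_le\<close>)
  then show ?thesis by (simp add: entropy_def)
qed

text \<open>Strong convexity: the second derivative \<open>1 / sqrt (x\<^sup>2 + 1)\<close> is at least
  \<open>1 / (1 + \<bar>a\<bar> + \<bar>b\<bar>)\<close> between \<open>a\<close> and \<open>b\<close>.\<close>

lemma entropy_midpoint:
  "(a - b)\<^sup>2 / (4 * (1 + \<bar>a\<bar> + \<bar>b\<bar>)) \<le> entropy a + entropy b - 2 * entropy ((a + b) / 2)"
proof -
  define K where "K = max \<bar>a\<bar> \<bar>b\<bar>"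
  define m where "m = 1 / (1 + \<bar>a\<bar> + \<bar>b\<bar>)"
  have "convex_on {-K..K} (\<lambda>x. entropy x - m / 2 * x\<^sup>2)"
  proof (rule f''_ge0_imp_convex)
    fix x assume x: "x \<in> {-K..K}"
    show "((\<lambda>x. entropy x - m / 2 * x\<^sup>2) has_real_derivative arsinh x - m * x) (at x)"
      by (auto intro!: derivative_eq_intros entropy_has_derivative)
    show "((\<lambda>x. arsinh x - m * x) has_real_derivative 1 / sqrt (x\<^sup>2 + 1) - m) (at x)"
      by (auto intro!: derivative_eq_intros)
    have "sqrt (x\<^sup>2 + 1) \<le> 1 + \<bar>x\<bar>"
      by (rule real_le_lsqrt) (auto simp: power2_eq_square algebra_simps)
    also have "\<dots> \<le> 1 + \<bar>a\<bar> + \<bar>b\<bar>" using x by (auto simp: K_def)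
    finally show "1 / sqrt (x\<^sup>2 + 1) - m \<ge> 0"
      unfolding m_def by (simp add: frac_le add_nonneg_pos)
  qed simp
  moreover have "a \<in> {-K..K}" "b \<in> {-K..K}" by (auto simp: K_def)
  ultimately have "entropy (a / 2 + b / 2) - m / 2 * (a / 2 + b / 2)\<^sup>2
      \<le> 1/2 * (entropy a - m / 2 * a\<^sup>2) + 1/2 * (entropy b - m / 2 * b\<^sup>2)"
    using convex_onD[of "{-K..K}" "\<lambda>x. entropy x - m / 2 * x\<^sup>2" "1/2" a b] by simp
  \<comment> \<open>The quadratic correction enters through a^2 + b^2 - 2 ((a + b)/2)^2 = (a - b)^2
    / 2.\<close>
  then have "m / 4 * (a - b)\<^sup>2 \<le> entropy a + entropy b - 2 * entropy ((a + b) / 2)"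
    by (simp add: power2_eq_square algebra_simps add_divide_distrib diff_divide_distrib)
  then show ?thesis by (simp add: m_def mult.commute)
qed

text \<open>Young's inequality, by completing a square, applied to the quadratic bound. In this form
  it can be integrated: the second term is small for large c because the integral of its numerator
  is bounded, the first one for small convexity gap.\<close>

lemma abs_diff_le_entropy_gap:
  assumes "c > 0"
  shows "\<bar>a - b\<bar> \<le> c * (entropy a + entropy b - 2 * entropy ((a + b) / 2)) + (1 + \<bar>a\<bar> + \<bar>b\<bar>) / c"
proof -
  define w where "w = 1 + \<bar>a\<bar> + \<bar>b\<bar>"
  have w: "w > 0" by (simp add: w_def)
  have "0 \<le> (c * \<bar>a - b\<bar> - 2 * w)\<^sup>2 / (4 * c * w)" using assms w by simp
  also have "\<dots> = c * ((a - b)\<^sup>2 / (4 * w)) + w / c - \<bar>a - b\<bar>"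
    using assms w by (simp add: power2_eq_square field_simps)
  finally have "\<bar>a - b\<bar> \<le> c * ((a - b)\<^sup>2 / (4 * w)) + w / c" by simp
  moreover have "c * ((a - b)\<^sup>2 / (4 * w)) \<le> c * (entropy a + entropy b - 2 * entropy ((a + b) / 2))"
    using entropy_midpoint[of a b] assms unfolding w_def by (intro mult_left_mono) auto
  ultimately show ?thesis unfolding w_def by linarith
qed

text \<open>The gap estimate for x and -x with c = 2; the midpoint 0 has entropy zero.\<close>

lemma abs_le_entropy: "\<bar>x\<bar> \<le> 4 * entropy x + 1"
proof -
  have "entropy 0 = 0" "entropy (- x) = entropy x" by (simp_all add: entropy_def)
  moreover have "\<bar>x - - x\<bar> = 2 * \<bar>x\<bar>" by (simp add: abs_mult)
  ultimately have "2 * \<bar>x\<bar> \<le> 4 * entropy x + (2 * \<bar>x\<bar> + 1) / 2"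
    using abs_diff_le_entropy_gap[of 2 x "- x"] by simp
  then have "2 * \<bar>x\<bar> \<le> 4 * entropy x + \<bar>x\<bar> + 1 / 2" by (simp add: add_divide_distrib)
  then show ?thesis by simp
qed

text \<open>Ensures that velocities bounded in L^p have bounded entropy. The factor
  \<open>arsinh x\<close> is at most ln (1 + 2x), and a logarithm grows more slowly than the power p
  - 1.\<close>

lemma entropy_le_powr:
  assumes "p > 1"
  shows "\<exists>C\<ge>0. \<forall>x. entropy x \<le> C * (1 + \<bar>x\<bar> powr p)"
proof (intro exI conjI allI)
  show "0 \<le> 3 powr p / (p - 1)" using assms by simp
  fix x
  have *: "entropy x \<le> 3 powr p / (p - 1) * (1 + x powr p)" if "x \<ge> 0" for x
  proof -
    have s: "sqrt (x\<^sup>2 + 1) \<le> 1 + x"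
      using that by (intro real_le_lsqrt) (auto simp: power2_eq_square algebra_simps)
    have "arsinh x = ln (x + sqrt (x\<^sup>2 + 1))" by (simp add: arsinh_real_def)
    also have "\<dots> \<le> ln (1 + 2 * x)"
      using s that arsinh_real_aux[of x] by (intro ln_mono) auto
    also have "\<dots> \<le> (1 + 2 * x) powr (p - 1) / (p - 1)"
      using that assms by (intro ln_powr_bound) auto
    finally have ar: "arsinh x \<le> (1 + 2 * x) powr (p - 1) / (p - 1)" .
    have "entropy x \<le> x * arsinh x" by (simp add: entropy_def)
    also have "\<dots> \<le> (1 + 2 * x) * ((1 + 2 * x) powr (p - 1) / (p - 1))"
    proof (intro mult_mono ar)
      show "0 \<le> arsinh x" using that by (meson arsinh_real_neg_iff not_le)
    qed (use that in auto)
    also have "\<dots> = (1 + 2 * x) powr p / (p - 1)"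
      using that powr_mult_base[of "1 + 2 * x" "p - 1"] by simp
    also have "\<dots> \<le> 3 powr p * (1 + x powr p) / (p - 1)"
    proof (intro divide_right_mono)
      \<comment> \<open>The base 3 comes from 1 + 2x \<le> 3 max(1,x).\<close>
      have "(1 + 2 * x) powr p \<le> (3 * max 1 x) powr p"
        using that assms by (intro powr_mono2) auto
      also have "\<dots> = 3 powr p * max 1 x powr p" by (simp add: powr_mult)
      also have "max 1 x powr p \<le> 1 + x powr p" by (auto simp: max_def)
      finally show "(1 + 2 * x) powr p \<le> 3 powr p * (1 + x powr p)" by simp
    qed (use assms in simp)
    finally show ?thesis by simp
  qed
  have "entropy (- x) = entropy x" by (simp add: entropy_def)
  then show "entropy x \<le> 3 powr p / (p - 1) * (1 + \<bar>x\<bar> powr p)"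
    using *[of x] *[of "-x"] by (cases "x \<ge> 0") auto
qed

text \<open>Fatou's lemma for Bochner integrals. Integrability of the limit is a conclusion, and the
  bound is asked only eventually and up to each e, as a limsup estimate delivers it.\<close>

lemma real_fatou:
  fixes f :: "nat \<Rightarrow> 'a \<Rightarrow> real"
  assumes f: "\<And>n. integrable M (f n)" and nonneg: "\<And>n. AE x in M. f n x \<ge> 0"
    and lim: "AE x in M. (\<lambda>n. f n x) \<longlonglongrightarrow> g x" and g: "g \<in> borel_measurable M"
    and c: "\<And>e. e > 0 \<Longrightarrow> \<forall>\<^sub>F n in sequentially. (LINT x|M. f n x) \<le> c + e"
  shows "integrable M g" "(LINT x|M. g x) \<le> c"
proof -
  have g0: "AE x in M. g x \<ge> 0"
  proof -
    have "AE x in M. \<forall>n. f n x \<ge> 0" using nonneg by (simp add: AE_all_countable)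
    with lim show ?thesis by eventually_elim (blast intro: LIMSEQ_le_const)
  qed
  have nn: "(\<integral>\<^sup>+x. ennreal (f n x) \<partial>M) = ennreal (LINT x|M. f n x)" for n
    by (rule nn_integral_eq_integral[OF f nonneg])
  have le: "(\<integral>\<^sup>+x. ennreal (g x) \<partial>M) \<le> ennreal (c + e)" if "e > 0" for e
  proof -
    have "(\<integral>\<^sup>+x. ennreal (g x) \<partial>M) = (\<integral>\<^sup>+x. liminf (\<lambda>n. ennreal (f n x)) \<partial>M)"
    proof (rule nn_integral_cong_AE)
      show "AE x in M. ennreal (g x) = liminf (\<lambda>n. ennreal (f n x))"
        using lim by eventually_elim
          (metis lim_imp_Liminf sequentially_bot tendsto_ennrealI)
    qed
    also have "\<dots> \<le> liminf (\<lambda>n. \<integral>\<^sup>+x. ennreal (f n x) \<partial>M)"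
      using f by (intro nn_integral_liminf) auto
    also have "\<dots> \<le> liminf (\<lambda>n. ennreal (c + e))"
      using c[OF that] by (intro Liminf_mono) (auto simp: nn elim!: eventually_mono intro: ennreal_leI)
    finally show ?thesis by (simp add: Liminf_const)
  qed
  show ig: "integrable M g"
    using le[of 1] g g0 by (intro integrableI_nonneg) (auto simp: less_top[symmetric] top_unique)
  have "(LINT x|M. g x) \<ge> 0" using g0 by (rule integral_nonneg_AE)
  have "(LINT x|M. g x) \<le> c + e" if "e > 0" for e
  proof -
    have "ennreal (LINT x|M. g x) \<le> ennreal (c + e)"
      using le[OF that] nn_integral_eq_integral[OF ig g0] by simp
    \<comment> \<open>\<open>ennreal\<close> sends negative reals to 0, so the inequality can be
      read in the reals only once the right side is known to be nonnegative; the nonnegative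
      integrals below it show this.\<close>
    moreover have "0 \<le> c + e"
    proof (rule ccontr)
      assume "\<not> 0 \<le> c + e"
      have "\<forall>\<^sub>F n in sequentially. c + e \<ge> 0"
        using c[OF that] by eventually_elim (use integral_nonneg_AE[OF nonneg] in \<open>force intro: order_trans\<close>)
      then show False using \<open>\<not> 0 \<le> c + e\<close> by simp
    qed
    ultimately show ?thesis by (simp add: ennreal_le_iff)
  qed
  then show "(LINT x|M. g x) \<le> c" by (rule field_le_epsilon)
qed

section \<open>Almost minimizing convex combinations of tails\<close>

lemma convex_on_entropy: "convex_on UNIV entropy"
proof (rule f''_ge0_imp_convex)
  fix x :: real
  show "(entropy has_real_derivative arsinh x) (at x)" by (rule entropy_has_derivative)
  show "(arsinh has_real_derivative 1 / sqrt (x\<^sup>2 + 1)) (at x)"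
    by (auto intro!: derivative_eq_intros)
qed auto

text \<open>Weights on the tail from \<open>k\<close> to \<open>N\<close>, extended by zero to all
  indices, so that combinations with different ranges can be averaged directly.\<close>

definition convex_weights :: "nat \<Rightarrow> nat \<Rightarrow> (nat \<Rightarrow> real) \<Rightarrow> bool" where
  "convex_weights k N c \<longleftrightarrow> (\<forall>n. c n \<ge> 0) \<and> (\<forall>n. n \<notin> {k..N} \<longrightarrow> c n = 0) \<and> (\<Sum>n\<le>N. c n) = 1"

lemma convex_weights_sum_extend:
  fixes f :: "nat \<Rightarrow> 'a::real_vector"
  assumes "convex_weights k N c" "N \<le> N'"
  shows "(\<Sum>n\<le>N'. c n *\<^sub>R f n) = (\<Sum>n\<le>N. c n *\<^sub>R f n)"
  by (rule sum.mono_neutral_right) (use assms in \<open>auto simp: convex_weights_def\<close>)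

lemma convex_weights_extend:
  assumes "convex_weights k N c" "N \<le> N'" "k' \<le> k"
  shows "convex_weights k' N' c"
proof -
  have "(\<Sum>n\<le>N'. c n) = (\<Sum>n\<le>N. c n)"
    using convex_weights_sum_extend[OF assms(1,2), of "\<lambda>_. 1::real"] by simp
  then show ?thesis using assms by (auto simp: convex_weights_def)
qed

lemma convex_weights_midpoint:
  assumes "convex_weights k N c" "convex_weights k N d"
  shows "convex_weights k N (\<lambda>n. (c n + d n) / 2)"
  using assms by (auto simp: convex_weights_def sum.distrib simp flip: sum_divide_distrib)

text \<open>Komlos-type selection: convex combinations of tails almost minimizing a strongly convex
  functional form a Cauchy sequence in \<open>L\<^sup>1\<close>.\<close>

lemma convex_combinations_converge:
  fixes V :: "nat \<Rightarrow> 'a \<Rightarrow> real ^ 'n"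
  assumes M: "finite_measure M"
    and V: "\<And>n. V n \<in> borel_measurable M"
    and int: "\<And>n. integrable M (\<lambda>s. \<Sum>i\<in>UNIV. entropy (V n s $ i))"
    and K: "\<And>n. (LINT s|M. (\<Sum>i\<in>UNIV. entropy (V n s $ i))) \<le> K"
  obtains c :: "nat \<Rightarrow> nat \<Rightarrow> real" and N :: "nat \<Rightarrow> nat" and v :: "'a \<Rightarrow> real ^ 'n" where
    "\<And>k. convex_weights k (N k) (c k)"
    "v \<in> borel_measurable M"
    "AE s in M. (\<lambda>k. \<Sum>n\<le>N k. c k n *\<^sub>R V n s) \<longlonglongrightarrow> v s"
    "\<And>k. integrable M (\<lambda>s. \<Sum>n\<le>N k. c k n *\<^sub>R V n s)"
    "integrable M v"
    "(\<lambda>k. LINT s|M. norm ((\<Sum>n\<le>N k. c k n *\<^sub>R V n s) - v s)) \<longlonglongrightarrow> 0"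
proof -
  interpret finite_measure M by fact
  define H where "H z = (\<Sum>i\<in>UNIV. entropy (z $ i))" for z :: "real ^ 'n"
  define w where "w N c s = (\<Sum>n\<le>N. c n *\<^sub>R V n s)" for N :: nat and c s
  define E where "E N c = (LINT s|M. H (w N c s))" for N c
  have H0: "H z \<ge> 0" for z by (simp add: H_def sum_nonneg entropy_nonneg)
  have Hm: "(\<lambda>s. H (f s)) \<in> borel_measurable M" if "f \<in> borel_measurable M" for f
  proof -
    have "continuous_on UNIV H" unfolding H_def
      by (intro continuous_intros continuous_on_compose2[OF continuous_on_entropy[of UNIV]]) auto
    from borel_measurable_continuous_on[OF this that] show ?thesis .
  qed
  have wm: "w N c \<in> borel_measurable M" for N c
    unfolding w_def using V by (intro borel_measurable_sum borel_measurable_scaleR) auto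
  have convH: "H (w N c s) \<le> (\<Sum>n\<le>N. c n * H (V n s))" if "convex_weights k N c" for k N c s
  proof -
    have "H (w N c s) = (\<Sum>i\<in>UNIV. entropy (\<Sum>n\<le>N. c n * V n s $ i))"
      by (simp add: H_def w_def)
    also have "\<dots> \<le> (\<Sum>i\<in>UNIV. \<Sum>n\<le>N. c n * entropy (V n s $ i))"
    proof (rule sum_mono)
      fix i
      show "entropy (\<Sum>n\<le>N. c n * V n s $ i) \<le> (\<Sum>n\<le>N. c n * entropy (V n s $ i))"
        using convex_on_sum[OF _ _ convex_on_entropy, of "{..N}" c "\<lambda>n. V n s $ i"] that
        by (auto simp: convex_weights_def)
    qed
    also have "\<dots> = (\<Sum>n\<le>N. c n * H (V n s))"
      unfolding H_def sum_distrib_left by (rule sum.swap)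
    finally show ?thesis .
  qed
  have intH: "integrable M (\<lambda>s. H (w N c s))" if "convex_weights k N c" for k N c
  proof (rule Bochner_Integration.integrable_bound)
    show "integrable M (\<lambda>s. \<Sum>n\<le>N. c n * H (V n s))"
      using int by (intro Bochner_Integration.integrable_sum integrable_mult_right) (simp add: H_def)
    show "AE s in M. norm (H (w N c s)) \<le> norm (\<Sum>n\<le>N. c n * H (V n s))"
      using convH[OF that] H0 by (intro AE_I2) (smt (verit) real_norm_def)
  qed (rule Hm[OF wm])
  have EK: "E N c \<le> K" if cw: "convex_weights k N c" for k N c
  proof -
    have "E N c \<le> (LINT s|M. (\<Sum>n\<le>N. c n * H (V n s)))"
      unfolding E_def using int convH[OF cw]
      by (intro integral_mono intH[OF cw] Bochner_Integration.integrable_sum integrable_mult_right)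
        (simp_all add: H_def)
    also have "\<dots> = (\<Sum>n\<le>N. c n * (LINT s|M. H (V n s)))"
      using int by (subst Bochner_Integration.integral_sum) (auto simp: H_def)
    also have "\<dots> \<le> (\<Sum>n\<le>N. c n * K)"
      using cw K by (intro sum_mono mult_left_mono) (auto simp: convex_weights_def H_def)
    also have "\<dots> = K" using cw by (simp add: convex_weights_def flip: sum_distrib_right)
    finally show ?thesis .
  qed
  have E0: "E N c \<ge> 0" for N c unfolding E_def by (intro integral_nonneg_AE AE_I2 H0)
  \<comment> \<open>Values of the functional on the convex hull of the tail from \<open>k\<close>
    on. The hulls shrink as \<open>k\<close> grows, so the infima increase; they are bounded by
    \<open>K\<close> and hence converge.\<close>
  define S where "S k = {E N c | N c. convex_weights k N c}" for k
  have S_ne: "S k \<noteq> {}" for k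
  proof -
    have "convex_weights k k (\<lambda>n. if n = k then 1 else 0)" by (auto simp: convex_weights_def)
    then show ?thesis by (auto simp: S_def)
  qed
  have S_bdd: "bdd_below (S k)" for k by (rule bdd_belowI[of _ 0]) (use E0 in \<open>auto simp: S_def\<close>)
  define m where "m k = Inf (S k)" for k
  have m_le: "m k \<le> E N c" if "convex_weights k N c" for k N c
    unfolding m_def using that S_bdd by (auto intro!: cInf_lower simp: S_def)
  have m_mono: "incseq m"
  proof (rule incseq_SucI)
    fix k
    have "convex_weights k N c" if "convex_weights (Suc k) N c" for N c
      using convex_weights_extend[OF that order_refl] by simp
    then have "S (Suc k) \<subseteq> S k" unfolding S_def by blast
    then show "m k \<le> m (Suc k)"
      unfolding m_def by (intro cInf_superset_mono S_ne S_bdd)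
  qed
  have m_K: "m k \<le> K" for k
  proof -
    obtain N c where "convex_weights k N c" using S_ne[of k] by (auto simp: S_def)
    then show ?thesis using m_le EK by (meson order_trans)
  qed
  obtain L where L: "m \<longlonglongrightarrow> L" "\<And>k. m k \<le> L"
    using incseq_convergent[OF m_mono] m_K by blast
  define \<delta> where "\<delta> k = 1 / (real k + 1)" for k
  have \<delta>: "\<delta> k > 0" for k by (simp add: \<delta>_def)
  have "\<exists>N c. convex_weights k N c \<and> E N c < m k + \<delta> k" for k
  proof -
    have "Inf (S k) < m k + \<delta> k" using \<delta>[of k] by (simp add: m_def)
    from cInf_lessD[OF S_ne this] show ?thesis unfolding S_def by blast
  qed
  then obtain N c where Nc: "\<And>k. convex_weights k (N k) (c k)" "\<And>k. E (N k) (c k) < m k + \<delta> k"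
    by metis
  define f where "f k = w (N k) (c k)" for k
  have fm: "f k \<in> borel_measurable M" for k unfolding f_def by (rule wm)
  have fH: "integrable M (\<lambda>s. H (f k s))" for k unfolding f_def by (rule intH[OF Nc(1)])
  have fK: "(LINT s|M. H (f k s)) \<le> K" for k using EK[OF Nc(1)] unfolding f_def E_def .
  have card: "norm z \<le> 4 * H z + CARD('n)" for z :: "real ^ 'n"
  proof -
    have "norm z \<le> (\<Sum>i\<in>UNIV. \<bar>z $ i\<bar>)" by (rule norm_le_l1_cart)
    also have "\<dots> \<le> (\<Sum>i\<in>UNIV. 4 * entropy (z $ i) + 1)" by (intro sum_mono abs_le_entropy)
    finally show ?thesis by (simp add: H_def sum.distrib sum_distrib_left)
  qed
  have fi: "integrable M (f k)" for k
  proof (rule Bochner_Integration.integrable_bound)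
    show "integrable M (\<lambda>s. 4 * H (f k s) + CARD('n))" using fH by simp
    show "AE s in M. norm (f k s) \<le> norm (4 * H (f k s) + CARD('n))"
      using card by (intro AE_I2) (smt (verit) real_norm_def)
  qed (rule fm)
  \<comment> \<open>Coordinatewise sum of the scalar gap estimate; the numerator comes from \<open>1
    + \<bar>a\<bar> + \<bar>b\<bar> \<le> 3 + 4 * entropy a + 4 * entropy b\<close>.\<close>
  have gap: "norm (x - y) \<le> q * (H x + H y - 2 * H ((1/2) *\<^sub>R (x + y))) + (3 * CARD('n) + 4 * H x + 4 * H y) / q"
    if "q > 0" for q and x y :: "real ^ 'n"
  proof -
    have "norm (x - y) \<le> (\<Sum>i\<in>UNIV. \<bar>x $ i - y $ i\<bar>)" using norm_le_l1_cart[of "x - y"] by simp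
    also have "\<dots> \<le> (\<Sum>i\<in>UNIV. q * (entropy (x $ i) + entropy (y $ i) - 2 * entropy ((x $ i + y $ i) / 2))
        + (3 + 4 * entropy (x $ i) + 4 * entropy (y $ i)) / q)"
    proof (rule sum_mono)
      fix i
      have "(1 + \<bar>x $ i\<bar> + \<bar>y $ i\<bar>) / q \<le> (3 + 4 * entropy (x $ i) + 4 * entropy (y $ i)) / q"
        using that abs_le_entropy[of "x $ i"] abs_le_entropy[of "y $ i"] by (intro divide_right_mono) auto
      then show "\<bar>x $ i - y $ i\<bar> \<le> q * (entropy (x $ i) + entropy (y $ i) - 2 * entropy ((x $ i + y $ i) / 2))
        + (3 + 4 * entropy (x $ i) + 4 * entropy (y $ i)) / q"
        using abs_diff_le_entropy_gap[OF that, of "x $ i" "y $ i"] by linarith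
    qed
    also have "\<dots> = q * (H x + H y - 2 * H ((1/2) *\<^sub>R (x + y))) + (3 * CARD('n) + 4 * H x + 4 * H y) / q"
      unfolding H_def
      by (simp add: sum.distrib sum_subtractf sum_distrib_left sum_divide_distrib add_divide_distrib
          diff_divide_distrib right_diff_distrib distrib_left)
    finally show ?thesis .
  qed
  \<comment> \<open>Bounds the integral of that numerator, since both functional values are at most
    \<open>K\<close>.\<close>
  define B where "B = 3 * CARD('n) * measure M (space M) + 8 * K"
  have gapI: "(LINT s|M. norm (f a s - f b s)) \<le> q * (2 * (L - m j + \<delta> j)) + B / q"
    if q: "q > 0" and ab: "j \<le> a" "j \<le> b" for q a b j
  proof -
    define N' where "N' = max (N a) (N b)"
    define c' where "c' n = (c a n + c b n) / 2" for n
    have cw: "convex_weights j N' (c a)" "convex_weights j N' (c b)"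
      using ab unfolding N'_def by (auto intro: convex_weights_extend[OF Nc(1)])
    then have cw': "convex_weights j N' c'" unfolding c'_def by (rule convex_weights_midpoint)
    have ext: "f a s = w N' (c a) s" "f b s = w N' (c b) s" for s
      unfolding f_def w_def N'_def
      by (rule convex_weights_sum_extend[OF Nc(1), symmetric], simp)+
    have mid: "w N' c' s = (1/2) *\<^sub>R (f a s + f b s)" for s
      unfolding ext w_def c'_def
      by (simp add: scaleR_sum_right scaleR_add_right sum.distrib add_divide_distrib scaleR_add_left)
    have i: "integrable M (\<lambda>s. H ((1/2) *\<^sub>R (f a s + f b s)))" using intH[OF cw'] unfolding mid .
    \<comment> \<open>The midpoint of two combinations of the tail from \<open>j\<close> is again
      such a combination, so its value cannot fall below the infimum. This is what makes the
      convexity gap of two almost minimizers small.\<close>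
    have "m j \<le> (LINT s|M. H ((1/2) *\<^sub>R (f a s + f b s)))"
      using m_le[OF cw'] unfolding E_def mid .
    moreover have "(LINT s|M. H (f a s)) \<le> L + \<delta> j" if "j \<le> a" for a
    proof -
      have "\<delta> a \<le> \<delta> j" unfolding \<delta>_def using that by (intro divide_left_mono) auto
      then show ?thesis using Nc(2)[of a] L(2)[of a] unfolding E_def f_def by linarith
    qed
    from this[OF ab(1)] this[OF ab(2)]
    have "(LINT s|M. H (f a s)) + (LINT s|M. H (f b s)) \<le> 2 * (L + \<delta> j)" by simp
    ultimately have g: "(LINT s|M. H (f a s)) + (LINT s|M. H (f b s)) - 2 * (LINT s|M. H ((1/2) *\<^sub>R (f a s + f b s)))
        \<le> 2 * (L - m j + \<delta> j)" by (simp add: algebra_simps)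
    have "(LINT s|M. norm (f a s - f b s)) \<le> (LINT s|M. q * (H (f a s) + H (f b s) - 2 * H ((1/2) *\<^sub>R (f a s + f b s)))
        + (3 * CARD('n) + 4 * H (f a s) + 4 * H (f b s)) / q)"
      using fi fH i gap[OF q] by (intro integral_mono) (auto intro!: Bochner_Integration.integrable_add
        Bochner_Integration.integrable_diff integrable_mult_right integrable_divide)
    also have "\<dots> = q * ((LINT s|M. H (f a s)) + (LINT s|M. H (f b s)) - 2 * (LINT s|M. H ((1/2) *\<^sub>R (f a s + f b s))))
        + (3 * CARD('n) * measure M (space M) + 4 * (LINT s|M. H (f a s)) + 4 * (LINT s|M. H (f b s))) / q"
      using fH i by (simp add: mult.commute)
    also have "\<dots> \<le> q * (2 * (L - m j + \<delta> j)) + B / q"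
    proof (rule add_mono[OF mult_left_mono[OF g] divide_right_mono])
      show "3 * CARD('n) * measure M (space M) + 4 * (LINT s|M. H (f a s)) + 4 * (LINT s|M. H (f b s)) \<le> B"
        using fK[of a] fK[of b] by (simp add: B_def)
    qed (use q in auto)
    finally show ?thesis .
  qed
  have small: "\<exists>j. q * (2 * (L - m j + \<delta> j)) < e" if "e > 0" for q e
  proof -
    have "(\<lambda>j. q * (2 * (L - m j + \<delta> j))) \<longlonglongrightarrow> q * (2 * (L - L + 0))"
      unfolding \<delta>_def using LIMSEQ_inverse_real_of_nat
      by (intro tendsto_intros L(1)) (simp add: inverse_eq_divide add.commute)
    then have "\<forall>\<^sub>F j in sequentially. q * (2 * (L - m j + \<delta> j)) < e"
      by (rule order_tendstoD) (use that in simp)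
    then show ?thesis by (auto simp: eventually_sequentially)
  qed
  have B0: "B \<ge> 0"
  proof -
    have "K \<ge> 0" using E0[of "N 0" "c 0"] EK[OF Nc(1), of 0] by linarith
    then show ?thesis by (simp add: B_def)
  qed
  have cauchy: "\<exists>j. \<forall>a\<ge>j. \<forall>b\<ge>j. (LINT s|M. norm (f a s - f b s)) < e" if e: "e > 0" for e
  proof -
    \<comment> \<open>\<open>q\<close> is fixed first and makes \<open>B / q\<close> smaller than
      e/2; only afterwards is \<open>j\<close> taken so large that the gap, multiplied by this
      \<open>q\<close>, is below e/2.\<close>
    define q where "q = (2 * B + 1) / e"
    have q: "q > 0" using B0 e by (simp add: q_def)
    have Bq: "B / q < e / 2" using B0 e by (simp add: q_def field_simps)
    obtain j where j: "q * (2 * (L - m j + \<delta> j)) < e / 2" using small[of "e/2"] e by auto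
    show ?thesis
    proof (intro exI allI impI)
      fix a b assume "j \<le> a" "j \<le> b"
      from gapI[OF q this] j Bq show "(LINT s|M. norm (f a s - f b s)) < e" by linarith
    qed
  qed
  obtain r where r: "strict_mono r" "AE s in M. Cauchy (\<lambda>k. f (r k) s)"
    using cauchy_L1_AE_cauchy_subseq[OF fi cauchy] by blast
  define v where "v s = lim (\<lambda>k. f (r k) s)" for s
  have vm: "v \<in> borel_measurable M" unfolding v_def
    using fm by (intro borel_measurable_lim_metric) auto
  have lim: "AE s in M. (\<lambda>k. f (r k) s) \<longlonglongrightarrow> v s"
    using r(2) by eventually_elim (simp add: v_def Cauchy_convergent_iff convergent_LIMSEQ_iff)
  have rk: "k \<le> r k" for k using seq_suble[OF r(1)] .
  \<comment> \<open>Fatou's lemma in the second index turns the Cauchy property into convergence in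
    L1 to the almost everywhere limit.\<close>
  have L1: "integrable M (\<lambda>s. norm (f (r k) s - v s)) \<and> (LINT s|M. norm (f (r k) s - v s)) \<le> e"
    if "e > 0" "\<And>a b. j \<le> a \<Longrightarrow> j \<le> b \<Longrightarrow> (LINT s|M. norm (f a s - f b s)) < e" "k \<ge> j" for e j k
  proof -
    have f1: "integrable M (\<lambda>s. norm (f (r k) s - f (r l) s))" for l using fi by simp
    have f2: "AE s in M. (\<lambda>l. norm (f (r k) s - f (r l) s)) \<longlonglongrightarrow> norm (f (r k) s - v s)"
      using lim by eventually_elim (intro tendsto_intros)
    have f3: "(\<lambda>s. norm (f (r k) s - v s)) \<in> borel_measurable M" using fm vm by measurable
    have f4: "\<forall>\<^sub>F l in sequentially. (LINT s|M. norm (f (r k) s - f (r l) s)) \<le> e + e'" if "e' > 0" for e'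
    proof (rule eventually_sequentiallyI[of j])
      fix l assume "j \<le> l"
      then show "(LINT s|M. norm (f (r k) s - f (r l) s)) \<le> e + e'"
        using \<open>\<And>a b. j \<le> a \<Longrightarrow> j \<le> b \<Longrightarrow> _\<close>[of "r k" "r l"] rk[of k] rk[of l] \<open>k \<ge> j\<close> that by simp
    qed
    from real_fatou[OF f1 _ f2 f3 f4] show ?thesis by auto
  qed
  obtain j0 where j0: "\<And>a b. j0 \<le> a \<Longrightarrow> j0 \<le> b \<Longrightarrow> (LINT s|M. norm (f a s - f b s)) < 1"
    using cauchy[of 1] by auto
  have "integrable M (\<lambda>s. f (r j0) s - v s)"
    using L1[of 1 j0 j0] j0 fm vm by (intro integrable_norm_cancel[where f = "\<lambda>s. f (r j0) s - v s"]) auto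
  from Bochner_Integration.integrable_diff[OF fi[of "r j0"] this] have vi: "integrable M v" by simp
  have conv: "(\<lambda>k. LINT s|M. norm (f (r k) s - v s)) \<longlonglongrightarrow> 0"
  proof (rule LIMSEQ_I)
    fix e :: real assume e: "e > 0"
    then obtain j where "\<And>a b. j \<le> a \<Longrightarrow> j \<le> b \<Longrightarrow> (LINT s|M. norm (f a s - f b s)) < e / 2"
      using cauchy[of "e/2"] by auto
    from L1[OF _ this] e show "\<exists>j. \<forall>k\<ge>j. norm ((LINT s|M. norm (f (r k) s - v s)) - 0) < e"
      by (intro exI[of _ j]) (force simp: integral_nonneg_AE)
  qed
  show thesis
  proof (rule that[of "\<lambda>k. N (r k)" "\<lambda>k. c (r k)" v])
    show "convex_weights k (N (r k)) (c (r k))" for k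
      by (rule convex_weights_extend[OF Nc(1) order_refl rk])
    show "integrable M (\<lambda>s. \<Sum>n\<le>N (r k). c (r k) n *\<^sub>R V n s)" for k
      using fi[of "r k"] unfolding f_def w_def[abs_def] .
  qed (use vm lim fi vi conv in \<open>simp_all add: f_def w_def\<close>)
qed

section \<open>Geometry of the junction\<close>

lemma edge_iff: "z \<in> edge i \<longleftrightarrow> z $ i \<ge> 0 \<and> (\<forall>j. j \<noteq> i \<longrightarrow> z $ j = 0)"
proof
  assume "z \<in> edge i"
  then show "z $ i \<ge> 0 \<and> (\<forall>j. j \<noteq> i \<longrightarrow> z $ j = 0)" by (auto simp: edge_def axis_def)
next
  assume "z $ i \<ge> 0 \<and> (\<forall>j. j \<noteq> i \<longrightarrow> z $ j = 0)"
  then have "z = (z $ i) *\<^sub>R axis i 1 \<and> z $ i \<ge> 0" by (auto simp: vec_eq_iff axis_def)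
  then show "z \<in> edge i" unfolding edge_def by blast
qed

lemma sum_edge_components:
  fixes f :: "'n::finite \<Rightarrow> real"
  assumes "\<And>j. j \<noteq> i \<Longrightarrow> f j = 0"
  shows "(\<Sum>j\<in>UNIV. f j) = f i"
proof -
  have "(\<Sum>j\<in>UNIV. f j) = (\<Sum>j\<in>UNIV. if j = i then f i else 0)"
    using assms by (intro sum.cong) auto
  then show ?thesis by simp
qed

lemma norm_eq_abs_component:
  fixes z :: "real ^ 'n::finite"
  assumes "\<And>j. j \<noteq> i \<Longrightarrow> z $ j = 0"
  shows "norm z = \<bar>z $ i\<bar>"
  unfolding norm_vec_def L2_set_def using sum_edge_components[of i "\<lambda>j. (norm (z $ j))\<^sup>2"] assms by simp

lemma norm_edge: "z \<in> edge i \<Longrightarrow> norm z = z $ i"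
  using norm_eq_abs_component[of i z] by (auto simp: edge_iff)

lemma junctionE:
  assumes "z \<in> junction"
  obtains i where "z \<in> edge i"
  using assms by (auto simp: junction_def)

lemma junction_component_nonneg: "z \<in> junction \<Longrightarrow> z $ j \<ge> 0"
  by (erule junctionE) (metis edge_iff order_refl)

text \<open>On the junction the modulus is linear, so its derivative along a curve is a linear image
  of the velocity and no chain rule for a nonsmooth function is involved.\<close>

lemma norm_junction: "z \<in> junction \<Longrightarrow> norm z = (\<Sum>i\<in>UNIV. z $ i)"
  by (erule junctionE) (metis edge_iff norm_edge sum_edge_components)

lemma closed_edge: "closed (edge i :: (real ^ 'n::finite) set)"
proof -
  have "edge i = (\<Inter>j. {z. (if j = i then 0 else z $ j) = 0}) \<inter> {z. 0 \<le> z $ i}" for i :: 'n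
    by (auto simp: edge_iff)
  moreover have "closed {z::real^'n. (if j = i then 0 else z $ j) = 0}" for j
    by (cases "j = i") (simp_all add: closed_Collect_eq continuous_on_component)
  moreover have "closed {z::real^'n. 0 \<le> z $ i}"
    by (intro closed_Collect_le continuous_intros)
  ultimately show ?thesis by (metis (mono_tags, lifting) closed_INT closed_Int)
qed

lemma closed_junction: "closed (junction :: (real ^ 'n::finite) set)"
  unfolding junction_def by (auto intro: closed_edge)

lemma indicator_other_edge:
  "z \<in> edge i \<Longrightarrow> z \<noteq> 0 \<Longrightarrow> j \<noteq> i \<Longrightarrow> indicator (edge j - {0}) z = (0::real)"
  by (auto simp: edge_iff vec_eq_iff indicator_def)

lemma running_cost_edge:
  assumes "z \<in> edge i" "z \<noteq> 0"
  shows "running_cost l l_star z a \<tau> = l i (norm z) a \<tau>"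
  using sum_edge_components[of i "\<lambda>j. l j (norm z) a \<tau> * indicator (edge j - {0}) z"]
    indicator_other_edge[OF assms] assms by (simp add: running_cost_def)

lemma running_cost_vertex: "running_cost l l_star 0 a \<tau> = vertex_cost l l_star \<tau>"
  by (simp add: running_cost_def)

lemma terminal_cost_edge:
  assumes "z \<in> edge i" "z \<noteq> 0"
  shows "terminal_cost g g_star z = g i (norm z)"
  using sum_edge_components[of i "\<lambda>j. g j (norm z) * indicator (edge j - {0}) z"]
    indicator_other_edge[OF assms] assms by (simp add: terminal_cost_def)

lemma terminal_cost_vertex: "terminal_cost g g_star 0 = min g_star (MIN i. g i 0)"
  by (simp add: terminal_cost_def)

lemma vertex_cost_le: "vertex_cost l l_star \<tau> \<le> l i 0 0 \<tau>"
  unfolding vertex_cost_def by (intro min.coboundedI2 Min_le) auto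

lemma measurable_compose_continuous_on:
  fixes h :: "'b::second_countable_topology \<Rightarrow> 'c::topological_space"
  assumes "continuous_on S h" "S \<in> sets borel" "f \<in> borel_measurable M" "\<And>s. s \<in> space M \<Longrightarrow> f s \<in> S"
  shows "(\<lambda>s. h (f s)) \<in> borel_measurable M"
proof -
  have "f \<in> M \<rightarrow>\<^sub>M restrict_space borel S"
    using assms by (intro measurable_restrict_space2) auto
  from measurable_compose[OF this borel_measurable_continuous_on_restrict[OF assms(1)]] show ?thesis .
qed

lemma abs_le_powr: 
  assumes "p > 1"
  shows "\<bar>a::real\<bar> \<le> 1 + \<bar>a\<bar> powr p"
proof (cases "\<bar>a\<bar> \<le> 1")
  case False
  then have "\<bar>a\<bar> powr 1 \<le> \<bar>a\<bar> powr p" using assms by (intro powr_mono) auto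
  then show ?thesis by simp
qed (simp add: add_increasing2)

section \<open>Running and terminal costs\<close>

locale junction_problem =
  fixes p T g_star :: real
    and g :: "'n::finite \<Rightarrow> real \<Rightarrow> real"
    and l_star :: "real \<Rightarrow> real"
    and l l_y l_a :: "'n \<Rightarrow> real \<Rightarrow> real \<Rightarrow> real \<Rightarrow> real"
  assumes T: "T > 0"
    and p: "p > 1"
    and g_cont: "\<And>i. continuous_on {0..} (g i)"
    and g_bdd: "\<And>i. bounded (g i ` {0..})"
    and l_star_cont: "continuous_on {0..T} l_star"
    and l_cont: "\<And>i. continuous_on ({0..} \<times> UNIV \<times> {0..T}) (\<lambda>(y, a, s). l i y a s)"
    and l_diff: "\<And>i y a s. y \<ge> 0 \<Longrightarrow> s \<in> {0..T} \<Longrightarrow>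
      ((\<lambda>(y', a'). l i y' a' s) has_derivative (\<lambda>(h, k). l_y i y a s * h + l_a i y a s * k))
        (at (y, a) within {0..} \<times> UNIV)"
    and l_a_cont: "\<And>i. continuous_on ({0..} \<times> UNIV \<times> {0..T}) (\<lambda>(y, a, s). l_a i y a s)"
    and H1: "\<And>i. \<exists>C\<^sub>0>0.
      (\<forall>y\<ge>0. \<forall>a. \<forall>s\<in>{0..T}. l i y a s \<ge> C\<^sub>0 * (\<bar>a\<bar> powr p - 1)) \<and>
      (\<forall>s\<in>{0..T}. l_star s \<ge> - C\<^sub>0)"
    and H3: "\<And>i r. r > 0 \<Longrightarrow> \<exists>c\<ge>0. \<forall>y\<in>{0..r}. \<forall>a. \<forall>s\<in>{0..T}.
      \<bar>l_y i y a s\<bar> \<le> c * (\<bar>a\<bar> powr p + 1) \<and>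
      \<bar>l_a i y a s\<bar> \<le> c * (\<bar>a\<bar> powr (p - 1) + 1)"
    and H4: "\<And>i y s. y \<ge> 0 \<Longrightarrow> s \<in> {0..T} \<Longrightarrow> strictly_convex (\<lambda>a. l i y a s)"
begin

lemma DERIV_l_a:
  assumes "y \<ge> 0" "s \<in> {0..T}"
  shows "((\<lambda>a. l i y a s) has_real_derivative l_a i y a s) (at a)"
proof -
  have "((\<lambda>a. (y, a)) has_derivative (\<lambda>k. (0, k))) (at a)"
    by (auto intro!: derivative_eq_intros)
  moreover have "(\<lambda>a. (y, a)) ` UNIV \<subseteq> {0..} \<times> UNIV" using assms by auto
  ultimately have "((\<lambda>(y', a'). l i y' a' s) \<circ> (\<lambda>a. (y, a)) has_derivative
      (\<lambda>(h, k). l_y i y a s * h + l_a i y a s * k) \<circ> (\<lambda>k. (0, k))) (at a)"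
    using l_diff[OF assms, of i a] by (intro diff_chain_within) (auto intro: has_derivative_subset)
  then show ?thesis by (simp add: o_def has_field_derivative_def)
qed

lemma DERIV_l_y:
  assumes "y \<ge> 0" "s \<in> {0..T}"
  shows "((\<lambda>y. l i y a s) has_real_derivative l_y i y a s) (at y within {0..})"
proof -
  have "((\<lambda>y. (y, a)) has_derivative (\<lambda>h. (h, 0))) (at y within {0..})"
    by (auto intro!: derivative_eq_intros)
  moreover have "(\<lambda>y. (y, a)) ` {0..} \<subseteq> {0..} \<times> UNIV" by auto
  ultimately have "((\<lambda>(y', a'). l i y' a' s) \<circ> (\<lambda>y. (y, a)) has_derivative
      (\<lambda>(h, k). l_y i y a s * h + l_a i y a s * k) \<circ> (\<lambda>h. (h, 0))) (at y within {0..})"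
    using l_diff[OF assms, of i a] by (intro diff_chain_within) (auto intro: has_derivative_subset)
  then show ?thesis by (simp add: o_def has_field_derivative_def)
qed

lemma convex_l:
  assumes "y \<ge> 0" "s \<in> {0..T}"
  shows "convex_on UNIV (\<lambda>a. l i y a s)"
proof (rule convex_onI)
  fix \<theta> a b :: real assume \<theta>: "0 < \<theta>" "\<theta> < 1"
  show "l i y ((1 - \<theta>) *\<^sub>R a + \<theta> *\<^sub>R b) s \<le> (1 - \<theta>) * l i y a s + \<theta> * l i y b s"
  proof (cases "a = b")
    case True
    have "(1 - \<theta>) * z + \<theta> * z = z" for z :: real by (simp add: algebra_simps)
    then show ?thesis using True by simp
  next
    case False
    then have "l i y ((1 - \<theta>) * a + \<theta> * b) s < (1 - \<theta>) * l i y a s + \<theta> * l i y b s"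
      using H4[OF assms, of i] \<theta> unfolding strictly_convex_def by blast
    then show ?thesis by simp
  qed
qed (rule convex_UNIV)

text \<open>The tangent is taken at velocity 0 because trajectories have zero velocity almost
  everywhere at the vertex, and there the resulting minorant must be exact.\<close>

lemma l_tangent:
  assumes "y \<ge> 0" "s \<in> {0..T}"
  shows "l i y a s \<ge> l i y 0 s + l_a i y 0 s * a"
proof -
  have "l i y a s - l i y 0 s \<ge> l_a i y 0 s * (a - 0)"
    by (rule convex_on_imp_above_tangent[OF convex_l[OF assms]])
      (auto intro: has_field_derivative_at_within DERIV_l_a assms)
  then show ?thesis by simp
qed

lemma H3_uniform:
  assumes "r > 0"
  shows "\<exists>c\<ge>0. \<forall>i. \<forall>y\<in>{0..r}. \<forall>a. \<forall>s\<in>{0..T}.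
      \<bar>l_y i y a s\<bar> \<le> c * (\<bar>a\<bar> powr p + 1) \<and> \<bar>l_a i y a s\<bar> \<le> c * (\<bar>a\<bar> powr (p - 1) + 1)"
proof -
  obtain c where c: "\<And>i. c i \<ge> 0" "\<And>i y a s. y \<in> {0..r} \<Longrightarrow> s \<in> {0..T} \<Longrightarrow>
      \<bar>l_y i y a s\<bar> \<le> c i * (\<bar>a\<bar> powr p + 1) \<and> \<bar>l_a i y a s\<bar> \<le> c i * (\<bar>a\<bar> powr (p - 1) + 1)"
    using H3[OF assms] by metis
  have le: "c i \<le> (\<Sum>i\<in>UNIV. c i)" for i by (rule member_le_sum) (use c in auto)
  show ?thesis
  proof (intro exI[of _ "\<Sum>i\<in>UNIV. c i"] conjI allI ballI)
    show "0 \<le> (\<Sum>i\<in>UNIV. c i)" using c by (simp add: sum_nonneg)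
    fix i y a s assume *: "y \<in> {0..r}" "s \<in> {0..T}"
    have "c i * (\<bar>a\<bar> powr p + 1) \<le> (\<Sum>i\<in>UNIV. c i) * (\<bar>a\<bar> powr p + 1)"
      "c i * (\<bar>a\<bar> powr (p - 1) + 1) \<le> (\<Sum>i\<in>UNIV. c i) * (\<bar>a\<bar> powr (p - 1) + 1)"
      using le by (intro mult_right_mono; simp)+
    with c(2)[OF *, of i a]
    show "\<bar>l_y i y a s\<bar> \<le> (\<Sum>i\<in>UNIV. c i) * (\<bar>a\<bar> powr p + 1)"
      "\<bar>l_a i y a s\<bar> \<le> (\<Sum>i\<in>UNIV. c i) * (\<bar>a\<bar> powr (p - 1) + 1)" by linarith+
  qed
qed

text \<open>Compares costs at two positions with the same velocity. The error is uniformly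
  integrated when the velocities are bounded in L^p.\<close>

lemma l_lipschitz:
  assumes r: "r > 0"
  shows "\<exists>c\<ge>0. \<forall>i y y' a s. y \<in> {0..r} \<longrightarrow> y' \<in> {0..r} \<longrightarrow> s \<in> {0..T} \<longrightarrow>
    \<bar>l i y a s - l i y' a s\<bar> \<le> c * (\<bar>a\<bar> powr p + 1) * \<bar>y - y'\<bar>"
proof -
  obtain c where c: "c \<ge> 0" "\<And>i y a s. y \<in> {0..r} \<Longrightarrow> s \<in> {0..T} \<Longrightarrow> \<bar>l_y i y a s\<bar> \<le> c * (\<bar>a\<bar> powr p + 1)"
    using H3_uniform[OF r] by blast
  show ?thesis
  proof (intro exI[of _ c] conjI allI impI c(1))
    fix i y y' a s assume *: "y \<in> {0..r}" "y' \<in> {0..r}" "s \<in> {0..T}"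
    have "norm (l i y a s - l i y' a s) \<le> c * (\<bar>a\<bar> powr p + 1) * norm (y - y')"
    proof (rule field_differentiable_bound[where S = "{0..r}" and f' = "\<lambda>y. l_y i y a s"])
      fix z assume z: "z \<in> {0..r}"
      show "((\<lambda>y. l i y a s) has_field_derivative l_y i z a s) (at z within {0..r})"
        by (rule has_field_derivative_subset[OF DERIV_l_y]) (use z * in auto)
      show "norm (l_y i z a s) \<le> c * (\<bar>a\<bar> powr p + 1)" using c(2)[OF z *(3)] by simp
    qed (use * in auto)
    then show "\<bar>l i y a s - l i y' a s\<bar> \<le> c * (\<bar>a\<bar> powr p + 1) * \<bar>y - y'\<bar>" by simp
  qed
qed

lemma l_rest_bounded:
  assumes r: "r > 0"
  shows "\<exists>B\<ge>0. \<forall>i. \<forall>y\<in>{0..r}. \<forall>s\<in>{0..T}. \<bar>l i y 0 s\<bar> \<le> B"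
proof -
  have "\<exists>B. \<forall>y\<in>{0..r}. \<forall>s\<in>{0..T}. \<bar>l i y 0 s\<bar> \<le> B" for i
  proof -
    have "continuous_on ({0..r} \<times> {0} \<times> {0..T}) (\<lambda>(y, a, s). l i y a s)"
      by (rule continuous_on_subset[OF l_cont]) auto
    then have "compact ((\<lambda>(y, a, s). l i y a s) ` ({0..r} \<times> {0} \<times> {0..T}))"
      by (intro compact_continuous_image compact_Times) auto
    then obtain B where "\<forall>z\<in>(\<lambda>(y, a, s). l i y a s) ` ({0..r} \<times> {0} \<times> {0..T}). norm z \<le> B"
      by (meson bounded_iff compact_imp_bounded)
    then show ?thesis by (intro exI[of _ B]) force
  qed
  then obtain B where B: "\<And>i y s. y \<in> {0..r} \<Longrightarrow> s \<in> {0..T} \<Longrightarrow> \<bar>l i y 0 s\<bar> \<le> B i" by metis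
  have Bnn: "B i \<ge> 0" for i using B[of 0 0 i] r T by auto
  have BS: "B i \<le> (\<Sum>i\<in>UNIV. B i)" for i by (rule member_le_sum) (use Bnn in auto)
  show ?thesis
  proof (intro exI[of _ "\<Sum>i\<in>UNIV. B i"] conjI allI ballI)
    show "0 \<le> (\<Sum>i\<in>UNIV. B i)" using Bnn by (simp add: sum_nonneg)
    fix i y s assume "y \<in> {0..r}" "s \<in> {0..T}"
    then show "\<bar>l i y 0 s\<bar> \<le> (\<Sum>i\<in>UNIV. B i)" using B BS[of i] by (meson order_trans)
  qed
qed

text \<open>The mean value theorem from rest to a, with |a| (|a|^(p-1) + 1) \<le> 2 (|a|^p + 1). It
  makes the cost of every trajectory finite.\<close>

lemma l_growth:
  assumes r: "r > 0"
  shows "\<exists>C\<ge>0. \<forall>i. \<forall>y\<in>{0..r}. \<forall>a. \<forall>s\<in>{0..T}. \<bar>l i y a s\<bar> \<le> C * (\<bar>a\<bar> powr p + 1)"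
proof -
  obtain c where c: "c \<ge> 0" "\<And>i y a s. y \<in> {0..r} \<Longrightarrow> s \<in> {0..T} \<Longrightarrow> \<bar>l_a i y a s\<bar> \<le> c * (\<bar>a\<bar> powr (p - 1) + 1)"
    using H3_uniform[OF r] by blast
  obtain B where B: "B \<ge> 0" "\<And>i y s. y \<in> {0..r} \<Longrightarrow> s \<in> {0..T} \<Longrightarrow> \<bar>l i y 0 s\<bar> \<le> B"
    using l_rest_bounded[OF r] by blast
  show ?thesis
  proof (intro exI[of _ "B + 2 * c"] conjI allI ballI)
    show "0 \<le> B + 2 * c" using B c by simp
    fix i y a s assume *: "y \<in> {0..r}" "s \<in> {0..T}"
    have "norm (l i y a s - l i y 0 s) \<le> c * (\<bar>a\<bar> powr (p - 1) + 1) * norm (a - 0)"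
    proof (rule field_differentiable_bound[where S = "{-\<bar>a\<bar>..\<bar>a\<bar>}" and f' = "\<lambda>a. l_a i y a s"])
      fix b assume b: "b \<in> {-\<bar>a\<bar>..\<bar>a\<bar>}"
      show "((\<lambda>a. l i y a s) has_field_derivative l_a i y b s) (at b within {-\<bar>a\<bar>..\<bar>a\<bar>})"
        by (rule has_field_derivative_at_within[OF DERIV_l_a]) (use * in auto)
      have "\<bar>b\<bar> powr (p - 1) \<le> \<bar>a\<bar> powr (p - 1)" using b p by (intro powr_mono2) auto
      then have "c * (\<bar>b\<bar> powr (p - 1) + 1) \<le> c * (\<bar>a\<bar> powr (p - 1) + 1)"
        using c(1) by (intro mult_left_mono) auto
      then show "norm (l_a i y b s) \<le> c * (\<bar>a\<bar> powr (p - 1) + 1)"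
        using c(2)[OF *, of i b] by simp
    qed auto
    also have "\<dots> = c * (\<bar>a\<bar> powr p + \<bar>a\<bar>)"
      using powr_mult_base[of "\<bar>a\<bar>" "p - 1"] by (simp add: algebra_simps)
    also have "\<dots> \<le> c * (2 * (\<bar>a\<bar> powr p + 1))"
      using abs_le_powr[OF p, of a] c(1) by (intro mult_left_mono) auto
    finally have "\<bar>l i y a s\<bar> \<le> B + c * (2 * (\<bar>a\<bar> powr p + 1))" using B(2)[OF *, of i] by simp
    also have "B \<le> B * (\<bar>a\<bar> powr p + 1)" using B(1) by (simp add: distrib_left)
    finally show "\<bar>l i y a s\<bar> \<le> (B + 2 * c) * (\<bar>a\<bar> powr p + 1)" by (simp add: algebra_simps)
  qed
qed

lemma coercivity:
  "\<exists>c\<^sub>0>0. \<exists>C\<^sub>1\<ge>0. (\<forall>i. \<forall>y\<ge>0. \<forall>a. \<forall>s\<in>{0..T}. l i y a s \<ge> c\<^sub>0 * \<bar>a\<bar> powr p - C\<^sub>1) \<and>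
     (\<forall>s\<in>{0..T}. vertex_cost l l_star s \<ge> - C\<^sub>1)"
proof -
  obtain C where "\<forall>i. C i > 0 \<and> (\<forall>y\<ge>0. \<forall>a. \<forall>s\<in>{0..T}. l i y a s \<ge> C i * (\<bar>a\<bar> powr p - 1)) \<and>
      (\<forall>s\<in>{0..T}. l_star s \<ge> - C i)"
    using choice[OF allI[OF H1]] ..
  then have C: "\<And>i. C i > 0" "\<And>i y a s. y \<ge> 0 \<Longrightarrow> s \<in> {0..T} \<Longrightarrow> l i y a s \<ge> C i * (\<bar>a\<bar> powr p - 1)"
    "\<And>i s. s \<in> {0..T} \<Longrightarrow> l_star s \<ge> - C i"
    by blast+
  \<comment> \<open>(H1) may hold with a different constant on each edge: the smallest serves as
    coefficient of the power, the largest as the subtracted constant.\<close>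
  define c\<^sub>0 where "c\<^sub>0 = Min (range C)"
  define C\<^sub>1 where "C\<^sub>1 = Max (range C)"
  have c: "c\<^sub>0 \<le> C i" "C i \<le> C\<^sub>1" for i by (auto simp: c\<^sub>0_def C\<^sub>1_def)
  have c0: "c\<^sub>0 > 0" using C(1) by (auto simp: c\<^sub>0_def)
  have l: "l i y a s \<ge> c\<^sub>0 * \<bar>a\<bar> powr p - C\<^sub>1" if "y \<ge> 0" "s \<in> {0..T}" for i y a s
  proof -
    have "c\<^sub>0 * \<bar>a\<bar> powr p \<le> C i * \<bar>a\<bar> powr p" using c by (intro mult_right_mono) auto
    then show ?thesis using C(2)[OF that, of i a] c(2)[of i] by (simp add: algebra_simps)
  qed
  have C1: "0 \<le> C\<^sub>1" using c0 c(1)[of undefined] c(2)[of undefined] by linarith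
  have v: "vertex_cost l l_star s \<ge> - C\<^sub>1" if s: "s \<in> {0..T}" for s
  proof -
    have "l_star s \<ge> - C\<^sub>1" using C(3)[OF s, of undefined] c(2)[of undefined] by linarith
    moreover have "(MIN i. l i 0 0 s) \<ge> - C\<^sub>1" using l[where y = 0 and a = 0 and s = s] s by (intro Min.boundedI) auto
    ultimately show ?thesis by (simp add: vertex_cost_def)
  qed
  show ?thesis
    by (rule exI[of _ c\<^sub>0], rule conjI[OF c0], rule exI[of _ C\<^sub>1]) (use C1 l v in auto)
qed

section \<open>Bounds and semicontinuity of the terminal cost\<close>

lemma terminal_cost_bounded: "\<exists>G\<ge>0. \<forall>z\<in>junction. \<bar>terminal_cost g g_star z\<bar> \<le> G"
proof -
  have "\<forall>i. \<exists>B. \<forall>r\<ge>0. \<bar>g i r\<bar> \<le> B"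
  proof
    fix i
    obtain B where "\<forall>x\<in>g i ` {0..}. norm x \<le> B" using g_bdd[of i] unfolding bounded_iff by blast
    then show "\<exists>B. \<forall>r\<ge>0. \<bar>g i r\<bar> \<le> B" by (intro exI[of _ B]) auto
  qed
  then obtain B where B: "\<And>i r. r \<ge> 0 \<Longrightarrow> \<bar>g i r\<bar> \<le> B i" by metis
  have Bnn: "B i \<ge> 0" for i using B[of 0 i] by auto
  have BS: "B i \<le> (\<Sum>i\<in>UNIV. B i)" for i by (rule member_le_sum) (use Bnn in auto)
  show ?thesis
  proof (intro exI[of _ "\<bar>g_star\<bar> + (\<Sum>i\<in>UNIV. B i)"] conjI ballI)
    show "0 \<le> \<bar>g_star\<bar> + (\<Sum>i\<in>UNIV. B i)" using Bnn by (simp add: sum_nonneg)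
    fix z :: "real ^ 'n" assume "z \<in> junction"
    then obtain i where i: "z \<in> edge i" by (rule junctionE)
    show "\<bar>terminal_cost g g_star z\<bar> \<le> \<bar>g_star\<bar> + (\<Sum>i\<in>UNIV. B i)"
    proof (cases "z = 0")
      case True
      have "(MIN i. g i 0) \<in> range (\<lambda>i. g i 0)" by (rule Min_in) auto
      then obtain j where "(MIN i. g i 0) = g j 0" by (elim rangeE)
      then show ?thesis using B[of 0 j] BS[of j] Bnn[of j] True by (auto simp: terminal_cost_vertex)
    next
      case False
      then show ?thesis using terminal_cost_edge[OF i] B[of "norm z" i] BS[of i] by auto
    qed
  qed
qed

text \<open>The value at the vertex is at most every limit along an edge, so the cost can only jump
  upwards when the vertex is left. Near any other point the i-th component stays positive, which
  keeps the sequence on one edge, where the cost is continuous.\<close>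

lemma terminal_cost_lsc:
  assumes Z: "Z \<longlonglongrightarrow> z" "\<And>n. Z n \<in> junction" "z \<in> junction" and e: "e > 0"
  shows "\<forall>\<^sub>F n in sequentially. terminal_cost g g_star (Z n) \<ge> terminal_cost g g_star z - e"
proof (cases "z = 0")
  case True
  have "(\<lambda>n. norm (Z n)) \<longlonglongrightarrow> 0" using tendsto_norm[OF Z(1)] True by simp
  have "\<forall>\<^sub>F n in sequentially. \<bar>g i (norm (Z n)) - g i 0\<bar> < e" for i
  proof -
    have "(\<lambda>n. g i (norm (Z n))) \<longlonglongrightarrow> g i 0"
      by (rule continuous_on_tendsto_compose[OF g_cont \<open>(\<lambda>n. norm (Z n)) \<longlonglongrightarrow> 0\<close>]) auto
    then show ?thesis using e by (simp add: tendsto_iff dist_real_def)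
  qed
  then have "\<forall>\<^sub>F n in sequentially. \<forall>i. \<bar>g i (norm (Z n)) - g i 0\<bar> < e"
    by (rule eventually_all_finite)
  then show ?thesis
  proof eventually_elim
    fix n assume *: "\<forall>i. \<bar>g i (norm (Z n)) - g i 0\<bar> < e"
    obtain i where i: "Z n \<in> edge i" using Z(2) junctionE by blast
    show "terminal_cost g g_star (Z n) \<ge> terminal_cost g g_star z - e"
    proof (cases "Z n = 0")
      case True
      then show ?thesis using \<open>z = 0\<close> e by simp
    next
      case False
      have "(MIN i. g i 0) \<le> g i 0" by (rule Min_le) auto
      then have "terminal_cost g g_star z \<le> g i 0" using True by (simp add: terminal_cost_vertex min.coboundedI2)
      then show ?thesis using *[rule_format, of i] terminal_cost_edge[OF i False] by (simp add: abs_less_iff)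
    qed
  qed
next
  case False
  obtain i where i: "z \<in> edge i" using Z(3) by (rule junctionE)
  have zi: "z $ i > 0" using False norm_edge[OF i] by (metis zero_less_norm_iff)
  have "(\<lambda>n. Z n $ i) \<longlonglongrightarrow> z $ i" using Z(1) by (rule tendsto_vec_nth)
  then have ev: "\<forall>\<^sub>F n in sequentially. Z n $ i > 0" using zi by (rule order_tendstoD)
  have "(\<lambda>n. g i (norm (Z n))) \<longlonglongrightarrow> g i (norm z)"
    by (rule continuous_on_tendsto_compose[OF g_cont tendsto_norm[OF Z(1)]]) auto
  then have "\<forall>\<^sub>F n in sequentially. \<bar>g i (norm (Z n)) - g i (norm z)\<bar> < e"
    using e by (simp add: tendsto_iff dist_real_def)
  with ev show ?thesis
  proof eventually_elim
    fix n assume n: "Z n $ i > 0" "\<bar>g i (norm (Z n)) - g i (norm z)\<bar> < e"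
    obtain j where j: "Z n \<in> edge j" using Z(2) junctionE by blast
    then have "j = i" using n by (metis edge_iff less_irrefl)
    moreover have "Z n \<noteq> 0" using n by auto
    ultimately show "terminal_cost g g_star (Z n) \<ge> terminal_cost g g_star z - e"
      using n terminal_cost_edge[OF j] terminal_cost_edge[OF i False] by (simp add: abs_less_iff)
  qed
qed

end

section \<open>Velocities of trajectories\<close>

lemma primitive_on_bounded_linear:
  fixes y v :: "real \<Rightarrow> 'a::euclidean_space" and f :: "'a \<Rightarrow> 'b::euclidean_space"
  assumes f: "bounded_linear f" and p: "primitive_on a b y v" and "a \<le> b"
  shows "primitive_on a b (\<lambda>s. f (y s)) (\<lambda>s. f (v s))"
proof (rule has_weak_deriv_imp_primitive_on)
  show "has_weak_deriv a b (\<lambda>s. f (y s)) (\<lambda>s. f (v s))"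
    by (rule has_weak_deriv_bounded_linear[OF f primitive_on_imp_has_weak_deriv[OF p \<open>a \<le> b\<close>]])
  show "continuous_on {a..b} (\<lambda>s. f (y s))"
    by (rule bounded_linear.continuous_on[OF f primitive_on_continuous[OF p]])
qed fact

lemma bounded_linear_sum_components: "bounded_linear (\<lambda>z :: real ^ 'n. \<Sum>i\<in>UNIV. z $ i)"
  by (intro bounded_linear_sum bounded_linear_vec_nth)

text \<open>Such a vector is parallel to the edge of z, and zero if z is the vertex.\<close>

lemma edge_tangent:
  assumes "z \<in> edge i" "\<And>j. z $ j = 0 \<Longrightarrow> a $ j = 0"
  shows "(\<Sum>j\<in>UNIV. a $ j) = a $ i" "norm a = \<bar>a $ i\<bar>"
  using assms sum_edge_components[of i "\<lambda>j. a $ j"] norm_eq_abs_component[of i a]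
  by (auto simp: edge_iff)

lemma primitive_on_junction_zero_deriv:
  fixes y v :: "real \<Rightarrow> real ^ 'n"
  assumes pr: "primitive_on a b y v" and "a \<le> b" and J: "\<And>s. s \<in> {a..b} \<Longrightarrow> y s \<in> junction"
  shows "AE s in lborel_on a b. \<forall>i. y s $ i = 0 \<longrightarrow> v s $ i = 0"
proof -
  have "AE s in lborel_on a b. y s $ i = 0 \<longrightarrow> v s $ i = 0" for i
    by (rule primitive_on_nonneg_zero_deriv[OF primitive_on_bounded_linear[OF bounded_linear_vec_nth pr \<open>a \<le> b\<close>]])
      (use J junction_component_nonneg in blast)
  then have "AE s in lborel_on a b. \<forall>i\<in>UNIV. y s $ i = 0 \<longrightarrow> v s $ i = 0"
    by (intro AE_finite_allI) auto
  then show ?thesis by simp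
qed

context junction_problem
begin

text \<open>\<open>v\<close> may be any representative of the derivative, which avoids the choice
  made in \<open>weak_deriv\<close>. The final clause is tangency to the junction; in particular the
  velocity vanishes almost everywhere at the vertex.\<close>

definition velocity :: "real \<Rightarrow> (real \<Rightarrow> real ^ 'n) \<Rightarrow> (real \<Rightarrow> real ^ 'n) \<Rightarrow> bool" where
  "velocity t y v \<longleftrightarrow> primitive_on t T y v \<and> in_Lp p t T v \<and> (\<forall>s\<in>{t..T}. y s \<in> junction) \<and>
     (AE s in lborel_on t T. \<forall>i. y s $ i = 0 \<longrightarrow> v s $ i = 0)"

lemma velocityI:
  assumes t: "t \<le> T" and pr: "primitive_on t T y v" and Lp: "in_Lp p t T v"
    and J: "\<And>s. s \<in> {t..T} \<Longrightarrow> y s \<in> junction"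
  shows "velocity t y v"
  using primitive_on_junction_zero_deriv[OF pr t J] assms by (simp add: velocity_def)

lemma in_Lp_continuous:
  fixes y :: "real \<Rightarrow> 'a::euclidean_space"
  assumes "continuous_on {t..T} y"
  shows "in_Lp p t T y"
  unfolding in_Lp_def set_borel_measurable_iff_lborel_on set_integrable_iff_lborel_on
proof
  show "y \<in> borel_measurable (lborel_on t T)"
    by (rule continuous_imp_measurable_lborel_on[OF assms])
  show "integrable (lborel_on t T) (\<lambda>s. norm (y s) powr p)"
    using p by (intro continuous_imp_integrable_lborel_on continuous_on_powr' continuous_on_norm assms
      continuous_on_const) auto
qed

lemma velocity_exists:
  assumes y: "y \<in> trajectories p T t x" and t: "t \<le> T"
  obtains v where "velocity t y v"
proof -
  obtain v where v: "in_Lp p t T v" "has_weak_deriv t T y v"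
    using y by (auto simp: trajectories_def W1p_def)
  have "continuous_on {t..T} y" and J: "\<And>s. s \<in> {t..T} \<Longrightarrow> y s \<in> junction"
    using y by (auto simp: trajectories_def)
  from has_weak_deriv_imp_primitive_on[OF v(2) this(1) t] have "velocity t y v"
    by (intro velocityI t v J)
  then show thesis by (rule that)
qed

lemma velocity_trajectory:
  assumes vel: "velocity t y v" and t: "t \<le> T"
  shows "y \<in> trajectories p T t (y t)"
proof -
  have pr: "primitive_on t T y v" using vel by (simp add: velocity_def)
  have c: "continuous_on {t..T} y" by (rule primitive_on_continuous[OF pr])
  show ?thesis
    using vel c in_Lp_continuous[OF c] primitive_on_imp_has_weak_deriv[OF pr t]
    by (auto simp: trajectories_def W1p_def velocity_def)
qed

lemma velocity_weak_deriv:
  assumes vel: "velocity t y v" and t: "t \<le> T"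
  shows "AE s in lborel_on t T. weak_deriv t T y s = v s"
    and "AE s in lborel_on t T. weak_deriv t T (\<lambda>s. norm (y s)) s = (\<Sum>i\<in>UNIV. v s $ i)"
    and "weak_deriv t T y \<in> borel_measurable (lborel_on t T)"
    and "weak_deriv t T (\<lambda>s. norm (y s)) \<in> borel_measurable (lborel_on t T)"
proof -
  have wd: "has_weak_deriv t T y v"
    using vel primitive_on_imp_has_weak_deriv t by (auto simp: velocity_def)
  have wn: "has_weak_deriv t T (\<lambda>s. norm (y s)) (\<lambda>s. \<Sum>i\<in>UNIV. v s $ i)"
    by (rule has_weak_deriv_cong[OF has_weak_deriv_bounded_linear[OF bounded_linear_sum_components wd]])
      (use vel in \<open>simp add: velocity_def norm_junction\<close>)
  show "AE s in lborel_on t T. weak_deriv t T y s = v s" by (rule weak_deriv_AE_eq[OF wd t])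
  show "AE s in lborel_on t T. weak_deriv t T (\<lambda>s. norm (y s)) s = (\<Sum>i\<in>UNIV. v s $ i)"
    by (rule weak_deriv_AE_eq[OF wn t])
  have "has_weak_deriv t T y (weak_deriv t T y)"
    unfolding weak_deriv_def by (rule someI[where P = "has_weak_deriv t T y", OF wd])
  from has_weak_derivD(2)[OF this] show "weak_deriv t T y \<in> borel_measurable (lborel_on t T)" by auto
  have "has_weak_deriv t T (\<lambda>s. norm (y s)) (weak_deriv t T (\<lambda>s. norm (y s)))"
    unfolding weak_deriv_def by (rule someI[where P = "has_weak_deriv t T (\<lambda>s. norm (y s))", OF wn])
  from has_weak_derivD(2)[OF this]
  show "weak_deriv t T (\<lambda>s. norm (y s)) \<in> borel_measurable (lborel_on t T)" by auto
qed

lemma velocity_norm: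
  assumes "velocity t y v"
  shows "AE s in lborel_on t T. norm (v s) = \<bar>\<Sum>i\<in>UNIV. v s $ i\<bar>"
proof -
  have "AE s in lborel_on t T. \<forall>i. y s $ i = 0 \<longrightarrow> v s $ i = 0" using assms by (simp add: velocity_def)
  then show ?thesis using AE_lborel_on_Icc
  proof eventually_elim
    fix s assume *: "\<forall>i. y s $ i = 0 \<longrightarrow> v s $ i = 0" "s \<in> {t..T}"
    then have "y s \<in> junction" using assms by (simp add: velocity_def)
    then obtain i where "y s \<in> edge i" by (rule junctionE)
    from edge_tangent[OF this, of "v s"] * show "norm (v s) = \<bar>\<Sum>i\<in>UNIV. v s $ i\<bar>" by simp
  qed
qed

section \<open>Measurability and integrability of the running cost; energy estimate\<close>

lemma measurable_l:
  assumes t: "0 \<le> t" and y: "y \<in> borel_measurable (lborel_on t T)" "\<And>s. s \<in> {t..T} \<Longrightarrow> y s \<ge> 0"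
    and a: "a \<in> borel_measurable (lborel_on t T)"
  shows "(\<lambda>s. l i (y s) (a s) s) \<in> borel_measurable (lborel_on t T)"
proof -
  have "(\<lambda>s. s) \<in> borel_measurable (lborel_on t T)"
    by (rule continuous_imp_measurable_lborel_on) (intro continuous_intros)
  then have "(\<lambda>s. (y s, a s, s)) \<in> borel_measurable (lborel_on t T)"
    using y(1) a by (intro borel_measurable_Pair)
  from measurable_compose_continuous_on[OF l_cont _ this, of i] show ?thesis
    using t y(2) by (auto simp: space_restrict_space borel_closed closed_Times)
qed

lemma measurable_vertex_cost:
  assumes t: "0 \<le> t"
  shows "vertex_cost l l_star \<in> borel_measurable (lborel_on t T)"
proof -
  have "l_star \<in> borel_measurable (lborel_on t T)"
    by (rule continuous_imp_measurable_lborel_on[OF continuous_on_subset[OF l_star_cont]]) (use t in auto)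
  moreover have "(\<lambda>s. MIN i. l i 0 0 s) \<in> borel_measurable (lborel_on t T)"
  proof (rule borel_measurableI_greater)
    fix c
    have "{s \<in> space (lborel_on t T). c < (MIN i. l i 0 0 s)} = {s \<in> space (lborel_on t T). \<forall>i\<in>UNIV. c < l i 0 0 s}"
      by auto
    also have "\<dots> \<in> sets (lborel_on t T)"
      using measurable_l[OF t, of "\<lambda>_. 0" "\<lambda>_. 0"]
      by (intro sets.sets_Collect_finite_All' borel_measurable_less borel_measurable_const) auto
    finally show "{s \<in> space (lborel_on t T). c < (MIN i. l i 0 0 s)} \<in> sets (lborel_on t T)" .
  qed
  ultimately show ?thesis unfolding vertex_cost_def[abs_def] by (auto intro: borel_measurable_min)
qed

lemma measurable_indicator_curve:
  fixes y :: "real \<Rightarrow> 'a::euclidean_space"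
  assumes "y \<in> borel_measurable (lborel_on t T)" "A \<in> sets borel"
  shows "(\<lambda>s. indicator A (y s) :: real) \<in> borel_measurable (lborel_on t T)"
  by (rule measurable_compose[OF assms(1)]) (use assms(2) in simp)

lemma edge_minus_zero_borel: "edge i - {0} \<in> sets borel"
  by (intro sets.Diff borel_closed closed_edge) auto

lemma measurable_running_cost:
  assumes t: "0 \<le> t" and y: "y \<in> borel_measurable (lborel_on t T)"
    and a: "a \<in> borel_measurable (lborel_on t T)"
  shows "(\<lambda>s. running_cost l l_star (y s) (a s) s) \<in> borel_measurable (lborel_on t T)"
proof -
  have ny: "(\<lambda>s. norm (y s)) \<in> borel_measurable (lborel_on t T)"
    by (rule measurable_compose[OF y borel_measurable_norm])
  show ?thesis unfolding running_cost_def
    by (intro borel_measurable_add borel_measurable_sum borel_measurable_times measurable_l t a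
      ny y measurable_indicator_curve edge_minus_zero_borel measurable_vertex_cost) auto
qed

text \<open>The coercive bound is confined to \<open>z \<noteq> 0\<close> since at the vertex the
  running cost does not see the velocity.\<close>

lemma running_cost_bounds:
  "\<exists>c\<^sub>0>0. \<exists>C\<^sub>1\<ge>0. \<forall>z\<in>junction. \<forall>a. \<forall>s\<in>{0..T}. running_cost l l_star z a s \<ge> - C\<^sub>1 \<and>
     (z \<noteq> 0 \<longrightarrow> running_cost l l_star z a s \<ge> c\<^sub>0 * \<bar>a\<bar> powr p - C\<^sub>1)"
proof -
  obtain c C where c: "c > 0" "C \<ge> 0"
    "\<And>i y a s. y \<ge> 0 \<Longrightarrow> s \<in> {0..T} \<Longrightarrow> l i y a s \<ge> c * \<bar>a\<bar> powr p - C"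
    "\<And>s. s \<in> {0..T} \<Longrightarrow> vertex_cost l l_star s \<ge> - C"
    using coercivity by blast
  have "running_cost l l_star z a s \<ge> - C \<and> (z \<noteq> 0 \<longrightarrow> running_cost l l_star z a s \<ge> c * \<bar>a\<bar> powr p - C)"
    if z: "z \<in> junction" and s: "s \<in> {0..T}" for z :: "real ^ 'n" and a s
  proof (cases "z = 0")
    case True
    then show ?thesis using c(4)[OF s] by (simp add: running_cost_vertex)
  next
    case False
    obtain i where i: "z \<in> edge i" using z by (rule junctionE)
    have "c * \<bar>a\<bar> powr p \<ge> 0" using c(1) by simp
    then show ?thesis using c(3)[OF _ s, of "norm z" a i] by (simp add: running_cost_edge[OF i False])
  qed
  then show ?thesis using c(1,2) by blast
qed

lemma velocity_powr_integrable:
  assumes "velocity t y v"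
  shows "integrable (lborel_on t T) (\<lambda>s. norm (v s) powr p)"
  using assms unfolding velocity_def in_Lp_def set_integrable_iff_lborel_on by blast

lemma velocity_measurable:
  assumes "velocity t y v"
  shows "y \<in> borel_measurable (lborel_on t T)" "v \<in> borel_measurable (lborel_on t T)"
    "(\<lambda>s. \<Sum>i\<in>UNIV. v s $ i) \<in> borel_measurable (lborel_on t T)" "continuous_on {t..T} y"
proof -
  have pr: "primitive_on t T y v" using assms by (simp add: velocity_def)
  show c: "continuous_on {t..T} y" by (rule primitive_on_continuous[OF pr])
  show "y \<in> borel_measurable (lborel_on t T)" by (rule continuous_imp_measurable_lborel_on[OF c])
  have "integrable (lborel_on t T) v" using pr by (simp add: primitive_on_def)
  then show "v \<in> borel_measurable (lborel_on t T)" by (rule borel_measurable_integrable)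
  from borel_measurable_continuous_on[OF linear_continuous_on[OF bounded_linear_sum_components] this]
  show "(\<lambda>s. \<Sum>i\<in>UNIV. v s $ i) \<in> borel_measurable (lborel_on t T)" .
qed

lemma running_cost_integrable:
  assumes vel: "velocity t y v" and t: "0 \<le> t"
  shows "integrable (lborel_on t T) (\<lambda>s. running_cost l l_star (y s) (\<Sum>i\<in>UNIV. v s $ i) s)"
proof -
  interpret finite_measure "lborel_on t T" by (rule finite_measure_lborel_on)
  obtain r where "\<forall>x\<in>{t..T}. norm (y x) \<le> r"
    using compact_imp_bounded[OF compact_continuous_image[OF velocity_measurable(4)[OF vel] compact_Icc]]
    unfolding bounded_iff by blast
  then have r: "norm (y s) \<le> max r 1" if "s \<in> {t..T}" for s using that by (meson max.coboundedI1)
  have "max r 1 > 0" by simp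
  then obtain C where C: "C \<ge> 0"
    "\<And>i y a s. y \<in> {0..max r 1} \<Longrightarrow> s \<in> {0..T} \<Longrightarrow> \<bar>l i y a s\<bar> \<le> C * (\<bar>a\<bar> powr p + 1)"
    using l_growth[OF \<open>max r 1 > 0\<close>] by blast
  obtain c\<^sub>0 C\<^sub>1 where C1: "C\<^sub>1 \<ge> 0" "\<And>z a s. z \<in> junction \<Longrightarrow> s \<in> {0..T} \<Longrightarrow> running_cost l l_star z a s \<ge> - C\<^sub>1"
    using running_cost_bounds by blast
  have up: "running_cost l l_star z a s \<le> C * (\<bar>a\<bar> powr p + 1)"
    if z: "z \<in> junction" "norm z \<le> max r 1" and s: "s \<in> {0..T}" for z a s
  proof (cases "z = 0")
    case True
    \<comment> \<open>\<open>undefined\<close> is an arbitrary edge: the vertex cost lies below the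
      cost of rest on each of them.\<close>
    have "l undefined 0 0 s \<le> C * (\<bar>0\<bar> powr p + 1)" using C(2)[of 0 s undefined 0] s by (auto simp: abs_le_iff)
    also have "\<dots> \<le> C * (\<bar>a\<bar> powr p + 1)" using C(1) by (intro mult_left_mono) auto
    finally show ?thesis
      using vertex_cost_le[of l l_star s undefined] True by (simp add: running_cost_vertex)
  next
    case False
    obtain i where i: "z \<in> edge i" using z(1) by (rule junctionE)
    then show ?thesis using C(2)[of "norm z" s i a] z(2) s
      by (simp add: running_cost_edge[OF i False] abs_le_iff)
  qed
  show ?thesis
  proof (rule Bochner_Integration.integrable_bound)
    show "integrable (lborel_on t T) (\<lambda>s. C * (norm (v s) powr p + 1) + C\<^sub>1)"
      using velocity_powr_integrable[OF vel] by simp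
    show "(\<lambda>s. running_cost l l_star (y s) (\<Sum>i\<in>UNIV. v s $ i) s) \<in> borel_measurable (lborel_on t T)"
      by (intro measurable_running_cost t velocity_measurable[OF vel])
    show "AE s in lborel_on t T. norm (running_cost l l_star (y s) (\<Sum>i\<in>UNIV. v s $ i) s)
        \<le> norm (C * (norm (v s) powr p + 1) + C\<^sub>1)"
      using velocity_norm[OF vel] AE_lborel_on_Icc
    proof eventually_elim
      fix s assume n: "norm (v s) = \<bar>\<Sum>i\<in>UNIV. v s $ i\<bar>" and s: "s \<in> {t..T}"
      have J: "y s \<in> junction" using vel s by (simp add: velocity_def)
      have s0: "s \<in> {0..T}" using s t by simp
      have "C * (norm (v s) powr p + 1) \<ge> 0" using C(1) by simp
      then show "norm (running_cost l l_star (y s) (\<Sum>i\<in>UNIV. v s $ i) s) \<le> norm (C * (norm (v s) powr p + 1) + C\<^sub>1)"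
        using up[OF J r[OF s] s0, of "\<Sum>i\<in>UNIV. v s $ i"] C1(2)[OF J s0, of "\<Sum>i\<in>UNIV. v s $ i"] C1(1) n
        by (simp add: abs_le_iff)
    qed
  qed
qed

text \<open>Allows the cost to be computed from any velocity instead of the chosen weak derivative
  of the modulus.\<close>

lemma total_cost_velocity:
  assumes vel: "velocity t y v" and t: "t \<in> {0..T}"
  shows "total_cost T l l_star g g_star t y =
    (LINT s|lborel_on t T. running_cost l l_star (y s) (\<Sum>i\<in>UNIV. v s $ i) s) + terminal_cost g g_star (y T)"
proof -
  have t': "0 \<le> t" "t \<le> T" using t by auto
  have "(LINT s|lborel_on t T. running_cost l l_star (y s) (weak_deriv t T (\<lambda>s. norm (y s)) s) s)
     = (LINT s|lborel_on t T. running_cost l l_star (y s) (\<Sum>i\<in>UNIV. v s $ i) s)"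
  proof (rule integral_cong_AE)
    show "AE s in lborel_on t T. running_cost l l_star (y s) (weak_deriv t T (\<lambda>s. norm (y s)) s) s
        = running_cost l l_star (y s) (\<Sum>i\<in>UNIV. v s $ i) s"
      using velocity_weak_deriv(2)[OF vel t'(2)] by eventually_elim simp
  qed (intro measurable_running_cost velocity_measurable[OF vel] velocity_weak_deriv[OF vel] t')+
  then show ?thesis by (simp add: total_cost_def set_integral_eq_lborel_on)
qed

text \<open>At the vertex the cost gives no control of the velocity, but the velocity is zero there
  almost everywhere; elsewhere coercivity applies.\<close>

lemma energy_bound:
  "\<exists>c\<^sub>0>0. \<exists>A\<ge>0. \<forall>t\<in>{0..T}. \<forall>y v. velocity t y v \<longrightarrow>
     c\<^sub>0 * (LINT s|lborel_on t T. norm (v s) powr p) \<le> total_cost T l l_star g g_star t y + A"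
proof -
  obtain c\<^sub>0 C\<^sub>1 where c0: "c\<^sub>0 > 0" "C\<^sub>1 \<ge> 0"
    and lo: "\<And>z a s. z \<in> junction \<Longrightarrow> s \<in> {0..T} \<Longrightarrow> running_cost l l_star z a s \<ge> - C\<^sub>1 \<and>
     (z \<noteq> 0 \<longrightarrow> running_cost l l_star z a s \<ge> c\<^sub>0 * \<bar>a\<bar> powr p - C\<^sub>1)"
    using running_cost_bounds by blast
  obtain G where G: "G \<ge> 0" "\<And>z. z \<in> junction \<Longrightarrow> \<bar>terminal_cost g g_star z\<bar> \<le> G"
    using terminal_cost_bounded by blast
  have "c\<^sub>0 * (LINT s|lborel_on t T. norm (v s) powr p) \<le> total_cost T l l_star g g_star t y + (C\<^sub>1 * T + G)"
    if t: "t \<in> {0..T}" and vel: "velocity t y v" for t y v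
  proof -
    interpret finite_measure "lborel_on t T" by (rule finite_measure_lborel_on)
    have t': "0 \<le> t" "t \<le> T" using t by auto
    have "(LINT s|lborel_on t T. c\<^sub>0 * norm (v s) powr p - C\<^sub>1)
       \<le> (LINT s|lborel_on t T. running_cost l l_star (y s) (\<Sum>i\<in>UNIV. v s $ i) s)"
    proof (rule integral_mono_AE)
      show "integrable (lborel_on t T) (\<lambda>s. c\<^sub>0 * norm (v s) powr p - C\<^sub>1)"
        using velocity_powr_integrable[OF vel] by simp
      have "AE s in lborel_on t T. \<forall>i. y s $ i = 0 \<longrightarrow> v s $ i = 0" using vel by (simp add: velocity_def)
      then show "AE s in lborel_on t T. c\<^sub>0 * norm (v s) powr p - C\<^sub>1
         \<le> running_cost l l_star (y s) (\<Sum>i\<in>UNIV. v s $ i) s"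
        using velocity_norm[OF vel] AE_lborel_on_Icc
      proof eventually_elim
        fix s assume z: "\<forall>i. y s $ i = 0 \<longrightarrow> v s $ i = 0" and n: "norm (v s) = \<bar>\<Sum>i\<in>UNIV. v s $ i\<bar>"
          and s: "s \<in> {t..T}"
        have J: "y s \<in> junction" using vel s by (simp add: velocity_def)
        have s0: "s \<in> {0..T}" using s t' by simp
        show "c\<^sub>0 * norm (v s) powr p - C\<^sub>1 \<le> running_cost l l_star (y s) (\<Sum>i\<in>UNIV. v s $ i) s"
        proof (cases "y s = 0")
          case True
          then have "v s = 0" using z by (simp add: vec_eq_iff)
          then show ?thesis using lo[OF J s0] p by simp
        next
          case False
          then show ?thesis using lo[OF J s0] n by simp
        qed
      qed
    qed (rule running_cost_integrable[OF vel t'(1)])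
    moreover have "(LINT s|lborel_on t T. c\<^sub>0 * norm (v s) powr p - C\<^sub>1)
       = c\<^sub>0 * (LINT s|lborel_on t T. norm (v s) powr p) - C\<^sub>1 * (T - t)"
      using velocity_powr_integrable[OF vel] t'
      by (simp add: measure_restrict_space space_restrict_space)
    moreover have "\<bar>terminal_cost g g_star (y T)\<bar> \<le> G"
      using vel t' by (intro G) (auto simp: velocity_def)
    \<comment> \<open>Makes the additive constant independent of the initial time.\<close>
    moreover have "C\<^sub>1 * (T - t) \<le> C\<^sub>1 * T" using c0(2) t' by (intro mult_left_mono) auto
    ultimately show ?thesis unfolding total_cost_velocity[OF vel t] by linarith
  qed
  moreover have "C\<^sub>1 * T + G \<ge> 0" using c0 G T by simp
  ultimately show ?thesis using c0(1) by blast
qed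

end

section \<open>Lower semicontinuity\<close>

lemma convex_weights_norm:
  fixes f :: "nat \<Rightarrow> 'a::real_normed_vector"
  assumes c: "convex_weights k N c" and f: "\<And>n. n \<ge> k \<Longrightarrow> norm (f n - l) \<le> e"
  shows "norm ((\<Sum>n\<le>N. c n *\<^sub>R f n) - l) \<le> e"
proof -
  have "(\<Sum>n\<le>N. c n *\<^sub>R f n) - l = (\<Sum>n\<le>N. c n *\<^sub>R (f n - l))"
    using c by (simp add: convex_weights_def scaleR_diff_right sum_subtractf flip: scaleR_sum_left)
  also have "norm \<dots> \<le> (\<Sum>n\<le>N. c n * e)"
  proof (rule sum_norm_le)
    fix n
    show "norm (c n *\<^sub>R (f n - l)) \<le> c n * e"
      using c f[of n] by (cases "n \<ge> k") (auto simp: convex_weights_def intro!: mult_left_mono)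
  qed
  also have "\<dots> = e" using c by (simp add: convex_weights_def flip: sum_distrib_right)
  finally show ?thesis .
qed

lemma convex_weights_le:
  fixes f g :: "nat \<Rightarrow> real"
  assumes c: "convex_weights k N c" and f: "\<And>n. n \<ge> k \<Longrightarrow> f n \<le> g n"
  shows "(\<Sum>n\<le>N. c n * f n) \<le> (\<Sum>n\<le>N. c n * g n)"
proof (rule sum_mono)
  fix n
  show "c n * f n \<le> c n * g n"
    using c f[of n] by (cases "n \<ge> k") (auto simp: convex_weights_def intro!: mult_left_mono)
qed

lemma convex_weights_const: "convex_weights k N c \<Longrightarrow> (\<Sum>n\<le>N. c n * (e::real)) = e"
  by (simp add: convex_weights_def flip: sum_distrib_right)

context junction_problem
begin

text \<open>A minorant of the running cost near \<open>z\<close> that is convex in the velocity \<open>a \<in> \<real>\<^sup>N\<close>. At the vertex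
  it is the affine function given by the tangents at rest on all edges, which is where
  \<open>vertex_cost \<le> l i 0 0\<close> enters.\<close>

definition lower_lagrangian :: "real ^ 'n \<Rightarrow> real \<Rightarrow> real ^ 'n \<Rightarrow> real" where
  "lower_lagrangian z s a =
     (\<Sum>i\<in>UNIV. l i (norm z) (a $ i) s * indicator (edge i - {0}) z) +
     (vertex_cost l l_star s + (\<Sum>i\<in>UNIV. l_a i 0 0 s * a $ i)) * indicator {0} z"

lemma lower_lagrangian_edge:
  assumes "z \<in> edge i" "z \<noteq> 0"
  shows "lower_lagrangian z s a = l i (norm z) (a $ i) s"
  using sum_edge_components[of i "\<lambda>j. l j (norm z) (a $ j) s * indicator (edge j - {0}) z"]
    indicator_other_edge[OF assms] assms by (simp add: lower_lagrangian_def)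

lemma lower_lagrangian_vertex:
  "lower_lagrangian 0 s a = vertex_cost l l_star s + (\<Sum>i\<in>UNIV. l_a i 0 0 s * a $ i)"
  by (simp add: lower_lagrangian_def)

lemma lower_lagrangian_convex:
  assumes z: "z \<in> junction" and s: "s \<in> {0..T}" and c: "convex_weights k N c"
  shows "lower_lagrangian z s (\<Sum>n\<le>N. c n *\<^sub>R a n) \<le> (\<Sum>n\<le>N. c n * lower_lagrangian z s (a n))"
proof (cases "z = 0")
  case True
  have "(\<Sum>i\<in>UNIV. l_a i 0 0 s * (\<Sum>n\<le>N. c n * a n $ i)) = (\<Sum>n\<le>N. c n * (\<Sum>i\<in>UNIV. l_a i 0 0 s * a n $ i))"
    unfolding sum_distrib_left by (subst sum.swap) (simp add: mult.left_commute)
  then show ?thesis using convex_weights_const[OF c, of "vertex_cost l l_star s"] True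
    by (simp add: lower_lagrangian_vertex distrib_left sum.distrib)
next
  case False
  obtain i where i: "z \<in> edge i" using z by (rule junctionE)
  show ?thesis
    using convex_on_sum[OF _ _ convex_l[OF norm_ge_zero s], of "{..N}" c "\<lambda>n. a n $ i" i z] c
    by (simp add: lower_lagrangian_edge[OF i False] convex_weights_def)
qed

lemma lower_lagrangian_continuous:
  assumes z: "z \<in> junction" and s: "s \<in> {0..T}" and a: "a \<longlonglongrightarrow> b"
  shows "(\<lambda>k. lower_lagrangian z s (a k)) \<longlonglongrightarrow> lower_lagrangian z s b"
proof (cases "z = 0")
  case True
  then show ?thesis unfolding True lower_lagrangian_vertex by (intro tendsto_intros a)
next
  case False
  obtain i where i: "z \<in> edge i" using z by (rule junctionE)
  have "isCont (\<lambda>a. l i (norm z) a s) (b $ i)"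
    by (rule DERIV_isCont[OF DERIV_l_a[OF norm_ge_zero s]])
  from isCont_tendsto_compose[OF this tendsto_vec_nth[OF a]]
  show ?thesis by (simp add: lower_lagrangian_edge[OF i False])
qed

text \<open>On tangent velocities the minorant is exact, so the limit curve loses nothing when its
  cost is replaced; at the vertex, tangent means zero.\<close>

lemma lower_lagrangian_tangent:
  assumes z: "z \<in> junction" and a: "\<And>j. z $ j = 0 \<Longrightarrow> a $ j = 0"
  shows "lower_lagrangian z s a = running_cost l l_star z (\<Sum>i\<in>UNIV. a $ i) s"
proof (cases "z = 0")
  case True
  then show ?thesis using a by (simp add: lower_lagrangian_vertex running_cost_vertex)
next
  case False
  obtain i where i: "z \<in> edge i" using z by (rule junctionE)
  show ?thesis
    using edge_tangent(1)[OF i a] by (simp add: lower_lagrangian_edge[OF i False] running_cost_edge[OF i False])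
qed

text \<open>Convex combinations of velocities need not vanish where y is at the vertex, and the
  affine minorant there has no lower bound. The term with \<open>D\<close> compensates its slope,
  which gives the nonnegativity that Fatou's lemma needs.\<close>

lemma lower_lagrangian_lower_bound:
  "\<exists>C\<ge>0. \<exists>D\<ge>0. \<forall>z\<in>junction. \<forall>s\<in>{0..T}. \<forall>a. lower_lagrangian z s a + C + D * (\<Sum>i\<in>UNIV. \<bar>a $ i\<bar>) \<ge> 0"
proof -
  obtain c C where c: "c > 0" "C \<ge> 0"
    "\<And>i y a s. y \<ge> 0 \<Longrightarrow> s \<in> {0..T} \<Longrightarrow> l i y a s \<ge> c * \<bar>a\<bar> powr p - C"
    "\<And>s. s \<in> {0..T} \<Longrightarrow> vertex_cost l l_star s \<ge> - C"
    using coercivity by blast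
  obtain D where D: "D \<ge> 0" "\<And>i y a s. y \<in> {0..1} \<Longrightarrow> s \<in> {0..T} \<Longrightarrow> \<bar>l_a i y a s\<bar> \<le> D * (\<bar>a\<bar> powr (p - 1) + 1)"
    using H3_uniform[of 1] by auto
  have "lower_lagrangian z s a + C + D * (\<Sum>i\<in>UNIV. \<bar>a $ i\<bar>) \<ge> 0"
    if z: "z \<in> junction" and s: "s \<in> {0..T}" for z s and a :: "real ^ 'n"
  proof (cases "z = 0")
    case True
    have "- (\<Sum>i\<in>UNIV. l_a i 0 0 s * a $ i) = (\<Sum>i\<in>UNIV. - (l_a i 0 0 s * a $ i))" by (simp add: sum_negf)
    also have "\<dots> \<le> (\<Sum>i\<in>UNIV. D * \<bar>a $ i\<bar>)"
    proof (rule sum_mono)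
      fix i
      have "- (l_a i 0 0 s * a $ i) \<le> \<bar>l_a i 0 0 s\<bar> * \<bar>a $ i\<bar>" by (simp flip: abs_mult)
      \<comment> \<open>At rest the growth bound on \<open>l_a\<close> reduces to \<open>D\<close>,
        since \<open>0 powr (p - 1) = 0\<close>.\<close>
      also have "\<dots> \<le> D * \<bar>a $ i\<bar>" using D(2)[of 0 s i 0] s p by (intro mult_right_mono) auto
      finally show "- (l_a i 0 0 s * a $ i) \<le> D * \<bar>a $ i\<bar>" .
    qed
    finally have "- (\<Sum>i\<in>UNIV. l_a i 0 0 s * a $ i) \<le> D * (\<Sum>i\<in>UNIV. \<bar>a $ i\<bar>)" by (simp add: sum_distrib_left)
    then show ?thesis using c(4)[OF s] True by (simp add: lower_lagrangian_vertex)
  next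
    case False
    obtain i where i: "z \<in> edge i" using z by (rule junctionE)
    have "c * \<bar>a $ i\<bar> powr p \<ge> 0" "D * (\<Sum>i\<in>UNIV. \<bar>a $ i\<bar>) \<ge> 0" using c(1) D(1) by (auto intro: mult_nonneg_nonneg sum_nonneg)
    then show ?thesis using c(3)[where y = "norm z" and a = "a $ i" and i = i, OF norm_ge_zero s] unfolding lower_lagrangian_edge[OF i False] by linarith
  qed
  then show ?thesis using c(2) D(1) by blast
qed

text \<open>If z is farther than \<delta> from the vertex, then z' lies on the same edge and the
  Lipschitz estimate in the position suffices. If z is the vertex, z' may lie on any edge, and the
  tangent at rest on that edge is used. Points with 0 < |z| \<le> \<delta> are left out because z'
  could then be on another edge.\<close>

lemma lower_lagrangian_le_running_cost:
  assumes r: "r > 0"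
  shows "\<exists>c\<ge>0. \<forall>z\<in>junction. \<forall>z'\<in>junction. \<forall>s\<in>{0..T}. \<forall>a \<delta>. norm z \<le> r \<longrightarrow> norm z' \<le> r \<longrightarrow>
     norm (z' - z) \<le> \<delta> \<longrightarrow> (z = 0 \<or> norm z > \<delta>) \<longrightarrow> (\<forall>j. z' $ j = 0 \<longrightarrow> a $ j = 0) \<longrightarrow>
     lower_lagrangian z s a \<le> running_cost l l_star z' (\<Sum>i\<in>UNIV. a $ i) s + c * (norm a powr p + 1) * \<delta>"
proof -
  obtain c where c: "c \<ge> 0" "\<And>i y y' a s. y \<in> {0..r} \<Longrightarrow> y' \<in> {0..r} \<Longrightarrow> s \<in> {0..T} \<Longrightarrow>
    \<bar>l i y a s - l i y' a s\<bar> \<le> c * (\<bar>a\<bar> powr p + 1) * \<bar>y - y'\<bar>"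
    using l_lipschitz[OF r] by blast
  have "lower_lagrangian z s a \<le> running_cost l l_star z' (\<Sum>i\<in>UNIV. a $ i) s + c * (norm a powr p + 1) * \<delta>"
    if z: "z \<in> junction" "z' \<in> junction" and s: "s \<in> {0..T}" and n: "norm z \<le> r" "norm z' \<le> r"
      and d: "norm (z' - z) \<le> \<delta>" "z = 0 \<or> norm z > \<delta>" and a: "\<And>j. z' $ j = 0 \<Longrightarrow> a $ j = 0"
    for z z' :: "real ^ 'n" and s a \<delta>
  proof -
    have d0: "\<delta> \<ge> 0" using d(1) norm_ge_zero order_trans by blast
    obtain i where i: "z' \<in> edge i" using z(2) by (rule junctionE)
    note t = edge_tangent[OF i a]
    have nz: "\<bar>norm z' - norm z\<bar> \<le> \<delta>" using norm_triangle_ineq3[of z' z] d(1) by linarith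
    have lip: "l i (norm z) (a $ i) s \<le> l i (norm z') (a $ i) s + c * (norm a powr p + 1) * \<delta>"
    proof -
      have "\<bar>l i (norm z) (a $ i) s - l i (norm z') (a $ i) s\<bar> \<le> c * (norm a powr p + 1) * \<bar>norm z - norm z'\<bar>"
        using c(2)[of "norm z" "norm z'" s i "a $ i"] n s t(2) by simp
      also have "\<dots> \<le> c * (norm a powr p + 1) * \<delta>"
        using nz c(1) by (intro mult_left_mono) auto
      finally show ?thesis by (simp add: abs_le_iff)
    qed
    show ?thesis
    proof (cases "z = 0")
      case True
      show ?thesis
      proof (cases "z' = 0")
        case True
        then have "lower_lagrangian z s a = running_cost l l_star z' (\<Sum>i\<in>UNIV. a $ i) s"
          using lower_lagrangian_tangent[OF z(2) a] \<open>z = 0\<close> by simp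
        then show ?thesis using c(1) d0 by simp
      next
        case False
        \<comment> \<open>The velocity is tangent at z', so only the tangent slope of the edge of z'
          survives in the affine minorant.\<close>
        have "(\<Sum>j\<in>UNIV. l_a j 0 0 s * a $ j) = l_a i 0 0 s * a $ i"
          by (rule sum_edge_components) (use i a in \<open>auto simp: edge_iff\<close>)
        then have "lower_lagrangian z s a \<le> l i 0 0 s + l_a i 0 0 s * a $ i"
          using vertex_cost_le[of l l_star s i] True by (simp add: lower_lagrangian_vertex)
        also have "\<dots> \<le> l i (norm z) (a $ i) s" using l_tangent[of 0 s i "a $ i"] s True by simp
        also note lip
        finally show ?thesis using t(1) by (simp add: running_cost_edge[OF i False])
      qed
    next
      case False
      then have nd: "norm z > \<delta>" using d(2) by simp
      obtain j where j: "z \<in> edge j" using z(1) by (rule junctionE)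
      \<comment> \<open>The j-th component of z is its norm and exceeds \<delta>, so a perturbation
        of size \<delta> cannot make it vanish.\<close>
      have "\<bar>(z' - z) $ j\<bar> \<le> \<delta>" using component_le_norm_cart[of "z' - z" j] d(1) by linarith
      then have "z' $ j > 0" using nd norm_edge[OF j] by (simp add: abs_le_iff)
      then have ji: "j = i" "z' \<noteq> 0" using i by (auto simp: edge_iff)
      show ?thesis using lip t(1) j unfolding ji(1)
        by (simp add: running_cost_edge[OF i ji(2)] lower_lagrangian_edge[OF _ False])
    qed
  qed
  then show ?thesis using c(1) by blast
qed

lemma measurable_lower_lagrangian:
  assumes t: "0 \<le> t" and y: "y \<in> borel_measurable (lborel_on t T)"
    and a: "a \<in> borel_measurable (lborel_on t T)"
  shows "(\<lambda>s. lower_lagrangian (y s) s (a s)) \<in> borel_measurable (lborel_on t T)"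
proof -
  have ny: "(\<lambda>s. norm (y s)) \<in> borel_measurable (lborel_on t T)"
    by (rule measurable_compose[OF y borel_measurable_norm])
  have ai: "(\<lambda>s. a s $ i) \<in> borel_measurable (lborel_on t T)" for i
    using borel_measurable_continuous_on[OF linear_continuous_on[OF bounded_linear_vec_nth] a] .
  have la: "(\<lambda>s. l_a i 0 0 s) \<in> borel_measurable (lborel_on t T)" for i
  proof (rule continuous_imp_measurable_lborel_on)
    have "continuous_on {t..T} ((\<lambda>(y, a, s). l_a i y a s) \<circ> (\<lambda>s. (0, 0, s)))"
      by (rule continuous_on_compose) (auto intro!: continuous_intros continuous_on_subset[OF l_a_cont] simp: t order_trans[OF t])
    then show "continuous_on {t..T} (\<lambda>s. l_a i 0 0 s)" by (simp add: o_def)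
  qed
  show ?thesis unfolding lower_lagrangian_def
    by (intro borel_measurable_add borel_measurable_sum borel_measurable_times measurable_l t ai la
      ny y measurable_indicator_curve edge_minus_zero_borel measurable_vertex_cost) auto
qed

text \<open>The identity between the increments of the curves and the integrals of their velocities
  is linear, so it passes to convex combinations. Uniform convergence gives the limit of one side
  and L1 convergence that of the other; no combined curve has to lie in the junction.\<close>

lemma velocity_limit:
  assumes t: "t \<in> {0..T}"
    and vel: "\<And>n. velocity t (Z n) (V n)"
    and K: "\<And>n. (LINT s|lborel_on t T. norm (V n s) powr p) \<le> K"
    and conv: "\<And>n s. s \<in> {t..T} \<Longrightarrow> norm (Z n s - y s) \<le> 1 / (real n + 1)"
  obtains c :: "nat \<Rightarrow> nat \<Rightarrow> real" and N :: "nat \<Rightarrow> nat" and v :: "real \<Rightarrow> real ^ 'n" where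
    "\<And>k. convex_weights k (N k) (c k)"
    "AE s in lborel_on t T. (\<lambda>k. \<Sum>n\<le>N k. c k n *\<^sub>R V n s) \<longlonglongrightarrow> v s"
    "\<And>k. integrable (lborel_on t T) (\<lambda>s. \<Sum>n\<le>N k. c k n *\<^sub>R V n s)"
    "(\<lambda>k. LINT s|lborel_on t T. norm ((\<Sum>n\<le>N k. c k n *\<^sub>R V n s) - v s)) \<longlonglongrightarrow> 0"
    "primitive_on t T y v"
proof -
  let ?M = "lborel_on t T"
  interpret finite_measure ?M by (rule finite_measure_lborel_on)
  obtain C where C: "C \<ge> 0" "\<And>x. entropy x \<le> C * (1 + \<bar>x\<bar> powr p)"
    using entropy_le_powr[OF p] by blast
  have Vm: "V n \<in> borel_measurable ?M" for n by (rule velocity_measurable(2)[OF vel])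
  have ent: "(\<Sum>i\<in>UNIV. entropy (z $ i)) \<le> CARD('n) * (C * (1 + norm z powr p))" for z :: "real ^ 'n"
  proof -
    have "entropy (z $ i) \<le> C * (1 + norm z powr p)" for i
    proof -
      have "\<bar>z $ i\<bar> powr p \<le> norm z powr p"
        using component_le_norm_cart[of z i] p by (intro powr_mono2) auto
      then have "C * (1 + \<bar>z $ i\<bar> powr p) \<le> C * (1 + norm z powr p)"
        using C(1) by (intro mult_left_mono) auto
      with C(2)[of "z $ i"] show ?thesis by linarith
    qed
    then show ?thesis using sum_bounded_above[of UNIV "\<lambda>i. entropy (z $ i)" "C * (1 + norm z powr p)"] by simp
  qed
  have ub: "integrable ?M (\<lambda>s. CARD('n) * (C * (1 + norm (V n s) powr p)))" for n
    using velocity_powr_integrable[OF vel[of n]] by simp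
  have H0: "(\<Sum>i\<in>UNIV. entropy (z $ i)) \<ge> 0" for z :: "real ^ 'n" by (simp add: sum_nonneg entropy_nonneg)
  have ei: "integrable ?M (\<lambda>s. \<Sum>i\<in>UNIV. entropy (V n s $ i))" for n
  proof (rule Bochner_Integration.integrable_bound[OF ub[of n]])
    have "continuous_on UNIV (\<lambda>z::real^'n. \<Sum>i\<in>UNIV. entropy (z $ i))"
      by (intro continuous_intros continuous_on_compose2[OF continuous_on_entropy[of UNIV]]) auto
    from borel_measurable_continuous_on[OF this Vm]
    show "(\<lambda>s. \<Sum>i\<in>UNIV. entropy (V n s $ i)) \<in> borel_measurable ?M" .
    show "AE s in ?M. norm (\<Sum>i\<in>UNIV. entropy (V n s $ i)) \<le> norm (CARD('n) * (C * (1 + norm (V n s) powr p)))"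
    proof (rule AE_I2)
      fix s
      show "norm (\<Sum>i\<in>UNIV. entropy (V n s $ i)) \<le> norm (CARD('n) * (C * (1 + norm (V n s) powr p)))"
        using ent[of "V n s"] H0[of "V n s"] by simp
    qed
  qed
  have eK: "(LINT s|?M. (\<Sum>i\<in>UNIV. entropy (V n s $ i))) \<le> CARD('n) * (C * (measure ?M (space ?M) + K))" for n
  proof -
    have "(LINT s|?M. (\<Sum>i\<in>UNIV. entropy (V n s $ i))) \<le> (LINT s|?M. CARD('n) * (C * (1 + norm (V n s) powr p)))"
      by (rule integral_mono[OF ei ub ent])
    also have "\<dots> = CARD('n) * (C * (measure ?M (space ?M) + (LINT s|?M. norm (V n s) powr p)))"
      using velocity_powr_integrable[OF vel[of n]] by simp
    also have "\<dots> \<le> CARD('n) * (C * (measure ?M (space ?M) + K))"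
      using K[of n] C(1) by (intro mult_left_mono) auto
    finally show ?thesis .
  qed
  obtain c N v where cN: "\<And>k. convex_weights k (N k) (c k)"
    and v: "AE s in ?M. (\<lambda>k. \<Sum>n\<le>N k. c k n *\<^sub>R V n s) \<longlonglongrightarrow> v s"
      "\<And>k. integrable ?M (\<lambda>s. \<Sum>n\<le>N k. c k n *\<^sub>R V n s)" "integrable ?M v"
      "(\<lambda>k. LINT s|?M. norm ((\<Sum>n\<le>N k. c k n *\<^sub>R V n s) - v s)) \<longlonglongrightarrow> 0"
    by (rule convex_combinations_converge[where V = V, OF finite_measure_lborel_on Vm ei eK]) (rule that; assumption)
  have pr: "primitive_on t T y v"
    unfolding primitive_on_def
  proof (intro conjI ballI v(3))
    fix s assume s: "s \<in> {t..T}"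
    then have tt: "t \<in> {t..T}" by simp
    let ?w = "\<lambda>k r. \<Sum>n\<le>N k. c k n *\<^sub>R V n r"
    have iV: "integrable ?M (V n)" for n using vel[of n] by (simp add: velocity_def primitive_on_def)
    have lim1: "(\<lambda>k. LINT r|?M. indicator {..s} r *\<^sub>R ?w k r) \<longlonglongrightarrow> y s - y t"
    proof (rule LIM_zero_cancel, rule Lim_null_comparison)
      show "\<forall>\<^sub>F k in sequentially. norm ((LINT r|?M. indicator {..s} r *\<^sub>R ?w k r) - (y s - y t)) \<le> 2 * (1 / (real k + 1))"
      proof (intro always_eventually allI)
        fix k
        have "(LINT r|?M. indicator {..s} r *\<^sub>R ?w k r) = (LINT r|?M. (\<Sum>n\<le>N k. c k n *\<^sub>R (indicator {..s} r *\<^sub>R V n r)))"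
          by (simp add: scaleR_sum_right mult.commute)
        also have "\<dots> = (\<Sum>n\<le>N k. LINT r|?M. c k n *\<^sub>R (indicator {..s} r *\<^sub>R V n r))"
          by (intro Bochner_Integration.integral_sum integrable_scaleR_right integrable_indicator_scaleR iV) auto
        also have "\<dots> = (\<Sum>n\<le>N k. c k n *\<^sub>R (Z n s - Z n t))"
        proof (rule sum.cong[OF refl])
          fix n
          have "Z n s = Z n t + (LINT r|?M. indicator {..s} r *\<^sub>R V n r)"
            using vel[of n] s unfolding velocity_def primitive_on_def by blast
          then show "(LINT r|?M. c k n *\<^sub>R (indicator {..s} r *\<^sub>R V n r)) = c k n *\<^sub>R (Z n s - Z n t)"
            by (simp del: scaleR_scaleR)
        qed
        finally have eq: "(LINT r|?M. indicator {..s} r *\<^sub>R ?w k r) = (\<Sum>n\<le>N k. c k n *\<^sub>R (Z n s - Z n t))" .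
        show "norm ((LINT r|?M. indicator {..s} r *\<^sub>R ?w k r) - (y s - y t)) \<le> 2 * (1 / (real k + 1))"
          unfolding eq
        proof (rule convex_weights_norm[OF cN])
          \<comment> \<open>The weights sit on indices n \<ge> k, where the curves are within 1/(k +
            1) of y; the two endpoints give the factor 2.\<close>
          fix n assume "k \<le> n"
          then have "1 / (real n + 1) \<le> 1 / (real k + 1)" by (intro divide_left_mono) auto
          moreover have "norm (Z n s - Z n t - (y s - y t)) \<le> norm (Z n s - y s) + norm (Z n t - y t)"
            using norm_triangle_ineq4[of "Z n s - y s" "Z n t - y t"] by (simp add: algebra_simps)
          ultimately show "norm (Z n s - Z n t - (y s - y t)) \<le> 2 * (1 / (real k + 1))"
            using conv[OF s, of n] conv[OF tt, of n] by linarith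
        qed
      qed
      have "(\<lambda>k. 2 * (1 / (real k + 1))) \<longlonglongrightarrow> 2 * 0"
        using LIMSEQ_inverse_real_of_nat
        by (intro tendsto_mult tendsto_const) (simp add: inverse_eq_divide add.commute)
      then show "(\<lambda>k. 2 * (1 / (real k + 1))) \<longlonglongrightarrow> 0" by simp
    qed
    have lim2: "(\<lambda>k. LINT r|?M. indicator {..s} r *\<^sub>R ?w k r) \<longlonglongrightarrow> (LINT r|?M. indicator {..s} r *\<^sub>R v r)"
    proof (rule LIM_zero_cancel, rule Lim_null_comparison[OF _ v(4)], intro always_eventually allI)
      fix k
      have "(LINT r|?M. indicator {..s} r *\<^sub>R ?w k r) - (LINT r|?M. indicator {..s} r *\<^sub>R v r)
         = (LINT r|?M. indicator {..s} r *\<^sub>R ?w k r - indicator {..s} r *\<^sub>R v r)"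
        by (intro Bochner_Integration.integral_diff[symmetric] integrable_indicator_scaleR v(2,3)) auto
      also have "norm \<dots> \<le> (LINT r|?M. norm (?w k r - v r))"
      proof (rule Bochner_Integration.integral_norm_bound_integral)
        show "integrable ?M (\<lambda>r. indicator {..s} r *\<^sub>R ?w k r - indicator {..s} r *\<^sub>R v r)"
          by (intro Bochner_Integration.integrable_diff integrable_indicator_scaleR v(2,3)) auto
        show "integrable ?M (\<lambda>r. norm (?w k r - v r))"
          by (intro integrable_norm Bochner_Integration.integrable_diff v(2,3))
        fix r
        show "norm (indicator {..s} r *\<^sub>R ?w k r - indicator {..s} r *\<^sub>R v r) \<le> norm (?w k r - v r)"
          by (cases "r \<le> s") auto
      qed
      finally show "norm ((LINT r|?M. indicator {..s} r *\<^sub>R ?w k r) - (LINT r|?M. indicator {..s} r *\<^sub>R v r))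
          \<le> (LINT r|?M. norm (?w k r - v r))" .
    qed
    from LIMSEQ_unique[OF lim1 lim2] show "y s = y t + (LINT r|?M. indicator {..s} r *\<^sub>R v r)"
      by (metis add.commute diff_add_cancel)
  qed
  show thesis by (rule that[OF cN v(1,2,4) pr])
qed

text \<open>The explicit rate can be arranged by a choice of subsequence; it lets the single number
  1/(k + 1) control all curves of the tail from k on.\<close>

lemma total_cost_lsc:
  assumes t: "t \<in> {0..T}"
    and vel: "\<And>n. velocity t (Z n) (V n)"
    and K: "\<And>n. (LINT s|lborel_on t T. norm (V n s) powr p) \<le> K"
    and conv: "\<And>n s. s \<in> {t..T} \<Longrightarrow> norm (Z n s - y s) \<le> 1 / (real n + 1)"
    and u: "\<And>n. total_cost T l l_star g g_star t (Z n) \<le> u + 1 / (real n + 1)"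
  shows "\<exists>v. velocity t y v \<and> total_cost T l l_star g g_star t y \<le> u"
proof -
  let ?M = "lborel_on t T"
  interpret finite_measure ?M by (rule finite_measure_lborel_on)
  have t': "0 \<le> t" "t \<le> T" using t by auto
  obtain c N v where cN: "\<And>k. convex_weights k (N k) (c k)"
    and lim: "AE s in ?M. (\<lambda>k. \<Sum>n\<le>N k. c k n *\<^sub>R V n s) \<longlonglongrightarrow> v s"
    and wi: "\<And>k. integrable ?M (\<lambda>s. \<Sum>n\<le>N k. c k n *\<^sub>R V n s)"
    and L1: "(\<lambda>k. LINT s|?M. norm ((\<Sum>n\<le>N k. c k n *\<^sub>R V n s) - v s)) \<longlonglongrightarrow> 0"
    and pr: "primitive_on t T y v"
    by (rule velocity_limit[OF t vel K conv]) (assumption | rule that)+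
  define w where "w k s = (\<Sum>n\<le>N k. c k n *\<^sub>R V n s)" for k s
  define \<delta> where "\<delta> k = 1 / (real k + 1)" for k
  have \<delta>0: "\<delta> k > 0" for k by (simp add: \<delta>_def)
  have \<delta>mono: "\<delta> n \<le> \<delta> k" if "k \<le> n" for n k
    unfolding \<delta>_def using that by (intro divide_left_mono) auto
  have \<delta>lim: "\<delta> \<longlonglongrightarrow> 0"
    unfolding \<delta>_def[abs_def] using LIMSEQ_inverse_real_of_nat by (simp add: inverse_eq_divide add.commute)
  have vi: "integrable ?M v" using pr by (simp add: primitive_on_def)
  have yc: "continuous_on {t..T} y" by (rule primitive_on_continuous[OF pr])
  have ZJ: "Z n s \<in> junction" if "s \<in> {t..T}" for n s using vel[of n] that by (simp add: velocity_def)
  have Zlim: "(\<lambda>n. Z n s) \<longlonglongrightarrow> y s" if "s \<in> {t..T}" for s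
  proof (rule LIM_zero_cancel, rule Lim_null_comparison[OF _ \<delta>lim])
    show "\<forall>\<^sub>F n in sequentially. norm (Z n s - y s) \<le> \<delta> n" using conv[OF that] by (simp add: \<delta>_def)
  qed
  have yJ: "y s \<in> junction" if "s \<in> {t..T}" for s
    using closed_sequentially[OF closed_junction _ Zlim[OF that]] ZJ[OF that] by blast
  obtain r0 where r0: "\<forall>s\<in>{t..T}. norm (y s) \<le> r0"
    using compact_imp_bounded[OF compact_continuous_image[OF yc compact_Icc]]
    unfolding bounded_iff by blast
  \<comment> \<open>The additional 1 makes room for the approximating curves, which stay within
    distance 1 of y.\<close>
  define r where "r = \<bar>r0\<bar> + 1"
  have r: "r > 0" by (simp add: r_def)
  have yr: "norm (y s) \<le> r" if "s \<in> {t..T}" for s using r0 that unfolding r_def by force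
  have Zr: "norm (Z n s) \<le> r" if "s \<in> {t..T}" for n s
  proof -
    have "\<delta> n \<le> 1" using \<delta>mono[of 0 n] by (simp add: \<delta>_def[of 0])
    then have "norm (Z n s - y s) \<le> 1" using conv[OF that, of n] unfolding \<delta>_def by linarith
    moreover have "norm (Z n s) \<le> norm (Z n s - y s) + norm (y s)" using norm_triangle_ineq[of "Z n s - y s" "y s"] by simp
    ultimately show ?thesis using r0 that unfolding r_def by force
  qed
  obtain C D where C: "C \<ge> 0" "D \<ge> 0"
    "\<And>z s a. z \<in> junction \<Longrightarrow> s \<in> {0..T} \<Longrightarrow> lower_lagrangian z s a + C + D * (\<Sum>i\<in>UNIV. \<bar>a $ i\<bar>) \<ge> 0"
    using lower_lagrangian_lower_bound by blast
  obtain c\<^sub>0 C\<^sub>1 where c0: "c\<^sub>0 > 0" "C\<^sub>1 \<ge> 0"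
    and lo: "\<And>z a s. z \<in> junction \<Longrightarrow> s \<in> {0..T} \<Longrightarrow> running_cost l l_star z a s \<ge> - C\<^sub>1 \<and>
     (z \<noteq> 0 \<longrightarrow> running_cost l l_star z a s \<ge> c\<^sub>0 * \<bar>a\<bar> powr p - C\<^sub>1)"
    using running_cost_bounds by blast
  obtain c' where c': "c' \<ge> 0"
    and below: "\<And>z z' s a d. z \<in> junction \<Longrightarrow> z' \<in> junction \<Longrightarrow> s \<in> {0..T} \<Longrightarrow> norm z \<le> r \<Longrightarrow> norm z' \<le> r \<Longrightarrow>
     norm (z' - z) \<le> d \<Longrightarrow> (z = 0 \<or> norm z > d) \<Longrightarrow> (\<forall>j. z' $ j = 0 \<longrightarrow> a $ j = 0) \<Longrightarrow>
     lower_lagrangian z s a \<le> running_cost l l_star z' (\<Sum>i\<in>UNIV. a $ i) s + c' * (norm a powr p + 1) * d"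
    using lower_lagrangian_le_running_cost[OF r] by blast
  \<comment> \<open>One shift that makes both the corrected minorant and the running costs
    nonnegative.\<close>
  define B where "B = max C C\<^sub>1"
  define m where "m = measure ?M (space ?M)"
  define R where "R n s = running_cost l l_star (Z n s) (\<Sum>i\<in>UNIV. V n s $ i) s" for n s
  define S where "S a = (\<Sum>i\<in>UNIV. \<bar>a $ i\<bar>)" for a :: "real ^ 'n"
  \<comment> \<open>Positions at which the comparison with curves at distance \<delta> is available.
    Any fixed position belongs to \<open>E k\<close> for all large k.\<close>
  define E where "E k = {z::real^'n. z = 0 \<or> norm z > \<delta> k}" for k
  define P where "P k s = indicator (E k) (y s) * (lower_lagrangian (y s) s (w k s) + B + D * S (w k s))" for k s
  define Q where "Q k s = (\<Sum>n\<le>N k. c k n * (R n s + B + c' * (norm (V n s) powr p + 1) * \<delta> k)) + D * S (w k s)" for k s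
  define F where "F s = lower_lagrangian (y s) s (v s) + B + D * S (v s)" for s
  have S0: "S a \<ge> 0" for a by (simp add: S_def sum_nonneg)
  have G0: "lower_lagrangian z s a + B + D * S a \<ge> 0" if "z \<in> junction" "s \<in> {0..T}" for z s a
    using C(3)[OF that, of a] by (simp add: B_def S_def)
  have R0: "R n s + B \<ge> 0" if "s \<in> {t..T}" for n s
  proof -
    have "s \<in> {0..T}" using that t' by simp
    from lo[OF ZJ[OF that, of n] this, of "\<Sum>i\<in>UNIV. V n s $ i"] show ?thesis by (auto simp: R_def B_def)
  qed
  have Scont: "continuous_on UNIV S" unfolding S_def by (intro continuous_intros)
  have Sint: "integrable ?M (\<lambda>s. S (f s))" if "integrable ?M f" for f
    unfolding S_def
    by (intro Bochner_Integration.integrable_sum integrable_abs integrable_bounded_linear[OF bounded_linear_vec_nth that])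
  have wint: "integrable ?M (w k)" for k using wi[of k] unfolding w_def[abs_def] .
  have Ri: "integrable ?M (R n)" for n
    using running_cost_integrable[OF vel[of n] t'(1)] unfolding R_def[abs_def] .
  have Vp: "integrable ?M (\<lambda>s. norm (V n s) powr p)" for n by (rule velocity_powr_integrable[OF vel])
  have ym: "y \<in> borel_measurable ?M" by (rule continuous_imp_measurable_lborel_on[OF yc])
  have Em: "E k \<in> sets borel" for k
  proof -
    have "E k = {0} \<union> {z. \<delta> k < norm z}" by (auto simp: E_def)
    moreover have "open {z::real^'n. \<delta> k < norm z}" by (intro open_Collect_less continuous_intros)
    ultimately show ?thesis by auto
  qed
  have Fm: "(\<lambda>s. lower_lagrangian (y s) s (a s) + B + D * S (a s)) \<in> borel_measurable ?M"
    if "integrable ?M a" for a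
    by (intro borel_measurable_add borel_measurable_times borel_measurable_const
        measurable_lower_lagrangian t' ym borel_measurable_integrable[OF that] borel_measurable_integrable[OF Sint[OF that]])
  have PQ: "AE s in ?M. 0 \<le> P k s \<and> P k s \<le> Q k s" for k
  proof -
    have "AE s in ?M. \<forall>n. \<forall>j. Z n s $ j = 0 \<longrightarrow> V n s $ j = 0"
      using vel unfolding velocity_def AE_all_countable by blast
    then show ?thesis using AE_lborel_on_Icc
    proof eventually_elim
      fix s assume ZV: "\<forall>n. \<forall>j. Z n s $ j = 0 \<longrightarrow> V n s $ j = 0" and s: "s \<in> {t..T}"
      have s0: "s \<in> {0..T}" using s t' by simp
      have t1: "0 \<le> c' * (norm (V n s) powr p + 1) * \<delta> k" for n
        using c' \<delta>0[of k] by (intro mult_nonneg_nonneg) auto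
      have Qpos: "0 \<le> (\<Sum>n\<le>N k. c k n * (R n s + B + c' * (norm (V n s) powr p + 1) * \<delta> k))"
        using cN[of k] by (intro sum_nonneg mult_nonneg_nonneg add_nonneg_nonneg[OF R0[OF s] t1])
          (simp add: convex_weights_def)
      show "0 \<le> P k s \<and> P k s \<le> Q k s"
      proof (cases "y s \<in> E k")
        case False
        then show ?thesis using Qpos C(2) S0[of "w k s"] by (simp add: P_def Q_def)
      next
        case True
        have "lower_lagrangian (y s) s (w k s) \<le> (\<Sum>n\<le>N k. c k n * lower_lagrangian (y s) s (V n s))"
          unfolding w_def by (rule lower_lagrangian_convex[OF yJ[OF s] s0 cN])
        also have "\<dots> \<le> (\<Sum>n\<le>N k. c k n * (R n s + c' * (norm (V n s) powr p + 1) * \<delta> k))"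
        proof (rule convex_weights_le[OF cN])
          fix n assume "k \<le> n"
          then have "norm (Z n s - y s) \<le> \<delta> k" using conv[OF s, of n] \<delta>mono[of k n] by (simp add: \<delta>_def)
          then show "lower_lagrangian (y s) s (V n s) \<le> R n s + c' * (norm (V n s) powr p + 1) * \<delta> k"
            unfolding R_def using True ZV
            by (intro below yJ[OF s] ZJ[OF s] s0 yr[OF s] Zr[OF s]) (auto simp: E_def)
        qed
        also have "\<dots> + B = (\<Sum>n\<le>N k. c k n * (R n s + B + c' * (norm (V n s) powr p + 1) * \<delta> k))"
          using convex_weights_const[OF cN[of k], of B]
          by (simp add: distrib_left sum.distrib)
        finally have "lower_lagrangian (y s) s (w k s) + B
            \<le> (\<Sum>n\<le>N k. c k n * (R n s + B + c' * (norm (V n s) powr p + 1) * \<delta> k))" by simp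
        then show ?thesis using True G0[OF yJ[OF s] s0, of "w k s"] by (simp add: P_def Q_def)
      qed
    qed
  qed
  have Qterm: "integrable ?M (\<lambda>s. c k n * (R n s + B + c' * (norm (V n s) powr p + 1) * \<delta> k))" for k n
    using Ri Vp by simp
  have Qi: "integrable ?M (Q k)" for k
    unfolding Q_def[abs_def]
    by (intro Bochner_Integration.integrable_add Bochner_Integration.integrable_sum integrable_mult_right Sint wint Qterm)
  have Pm: "P k \<in> borel_measurable ?M" for k
    unfolding P_def[abs_def]
    by (intro borel_measurable_times measurable_indicator_curve ym Em Fm wint)
  have Pi: "integrable ?M (P k)" for k
  proof (rule Bochner_Integration.integrable_bound[OF Qi[of k] Pm])
    show "AE s in ?M. norm (P k s) \<le> norm (Q k s)" using PQ[of k] by eventually_elim simp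
  qed
  have Plim: "AE s in ?M. (\<lambda>k. P k s) \<longlonglongrightarrow> F s"
    using lim AE_lborel_on_Icc
  proof eventually_elim
    fix s assume l: "(\<lambda>k. \<Sum>n\<le>N k. c k n *\<^sub>R V n s) \<longlonglongrightarrow> v s" and s: "s \<in> {t..T}"
    have s0: "s \<in> {0..T}" using s t' by simp
    have l': "(\<lambda>k. w k s) \<longlonglongrightarrow> v s" using l by (simp add: w_def)
    have "\<forall>\<^sub>F k in sequentially. y s \<in> E k"
    proof (cases "y s = 0")
      case False
      have "\<forall>\<^sub>F k in sequentially. \<delta> k < norm (y s)" by (rule order_tendstoD(2)[OF \<delta>lim]) (use False in simp)
      then show ?thesis by eventually_elim (simp add: E_def)
    qed (simp add: E_def)
    then have "\<forall>\<^sub>F k in sequentially. lower_lagrangian (y s) s (w k s) + B + D * S (w k s) = P k s"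
      by eventually_elim (simp add: P_def)
    moreover have "(\<lambda>k. S (w k s)) \<longlonglongrightarrow> S (v s)"
      by (rule continuous_on_tendsto_compose[OF Scont l']) auto
    then have "(\<lambda>k. lower_lagrangian (y s) s (w k s) + B + D * S (w k s)) \<longlonglongrightarrow> F s"
      unfolding F_def by (intro tendsto_intros lower_lagrangian_continuous yJ[OF s] s0 l')
    ultimately show "(\<lambda>k. P k s) \<longlonglongrightarrow> F s" by (rule Lim_transform_eventually[rotated])
  qed
  \<comment> \<open>The desired bound for the running cost of y, increased by the integrals of the
    two corrections contained in \<open>F\<close>.\<close>
  define \<Gamma> where "\<Gamma> = u - terminal_cost g g_star (y T) + B * m + D * (LINT s|?M. S (v s))"
  \<comment> \<open>Convergence in L1 is used here: it shows that the linear correction has the same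
    integral before and after the limit.\<close>
  have Slim: "(\<lambda>k. LINT s|?M. S (w k s)) \<longlonglongrightarrow> (LINT s|?M. S (v s))"
  proof (rule LIM_zero_cancel, rule Lim_null_comparison)
    show "(\<lambda>k. CARD('n) * (LINT s|?M. norm (w k s - v s))) \<longlonglongrightarrow> 0"
      using tendsto_mult_right_zero[OF L1, of "CARD('n)"] by (simp add: w_def)
    show "\<forall>\<^sub>F k in sequentially. norm ((LINT s|?M. S (w k s)) - (LINT s|?M. S (v s))) \<le> CARD('n) * (LINT s|?M. norm (w k s - v s))"
    proof (intro always_eventually allI)
      fix k
      have "(LINT s|?M. S (w k s)) - (LINT s|?M. S (v s)) = (LINT s|?M. S (w k s) - S (v s))"
        by (intro Bochner_Integration.integral_diff[symmetric] Sint wint vi)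
      also have "norm \<dots> \<le> (LINT s|?M. CARD('n) * norm (w k s - v s))"
      proof (rule Bochner_Integration.integral_norm_bound_integral)
        show "integrable ?M (\<lambda>s. S (w k s) - S (v s))" by (intro Bochner_Integration.integrable_diff Sint wint vi)
        show "integrable ?M (\<lambda>s. CARD('n) * norm (w k s - v s))"
          by (intro integrable_mult_right integrable_norm Bochner_Integration.integrable_diff wint vi)
        fix s
        have "norm (S (w k s) - S (v s)) = \<bar>\<Sum>i\<in>UNIV. \<bar>w k s $ i\<bar> - \<bar>v s $ i\<bar>\<bar>"
          by (simp add: S_def sum_subtractf)
        also have "\<dots> \<le> (\<Sum>i\<in>UNIV. \<bar>\<bar>w k s $ i\<bar> - \<bar>v s $ i\<bar>\<bar>)" by (rule sum_abs)
        also have "\<dots> \<le> (\<Sum>i\<in>(UNIV::'n set). norm (w k s - v s))"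
        proof (rule sum_mono)
          fix i
          show "\<bar>\<bar>w k s $ i\<bar> - \<bar>v s $ i\<bar>\<bar> \<le> norm (w k s - v s)"
            using component_le_norm_cart[of "w k s - v s" i] abs_triangle_ineq3[of "w k s $ i" "v s $ i"] by simp
        qed
        finally show "norm (S (w k s) - S (v s)) \<le> CARD('n) * norm (w k s - v s)" by simp
      qed
      finally show "norm ((LINT s|?M. S (w k s)) - (LINT s|?M. S (v s))) \<le> CARD('n) * (LINT s|?M. norm (w k s - v s))"
        by simp
    qed
  qed
  have bound: "\<forall>\<^sub>F k in sequentially. (LINT s|?M. P k s) \<le> \<Gamma> + e" if e: "e > 0" for e
  proof -
    have TT: "T \<in> {t..T}" using t' by simp
    have "\<forall>\<^sub>F n in sequentially. terminal_cost g g_star (Z n T) \<ge> terminal_cost g g_star (y T) - e/2"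
      by (rule terminal_cost_lsc[OF Zlim[OF TT] ZJ[OF TT] yJ[OF TT]]) (use e in simp)
    then obtain k0 where k0: "\<And>n. n \<ge> k0 \<Longrightarrow> terminal_cost g g_star (Z n T) \<ge> terminal_cost g g_star (y T) - e/2"
      by (auto simp: eventually_sequentially)
    have "(\<lambda>k. \<delta> k + c' * (K + m) * \<delta> k + D * ((LINT s|?M. S (w k s)) - (LINT s|?M. S (v s)))) \<longlonglongrightarrow>
        0 + c' * (K + m) * 0 + D * ((LINT s|?M. S (v s)) - (LINT s|?M. S (v s)))"
      by (intro tendsto_intros \<delta>lim Slim)
    then have "\<forall>\<^sub>F k in sequentially. \<delta> k + c' * (K + m) * \<delta> k + D * ((LINT s|?M. S (w k s)) - (LINT s|?M. S (v s))) < e/2"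
      by (rule order_tendstoD) (use e in simp)
    moreover have "\<forall>\<^sub>F k in sequentially. k \<ge> k0" by (rule eventually_ge_at_top)
    ultimately show ?thesis
    proof eventually_elim
      fix k assume small: "\<delta> k + c' * (K + m) * \<delta> k + D * ((LINT s|?M. S (w k s)) - (LINT s|?M. S (v s))) < e/2"
        and k: "k \<ge> k0"
      have "(LINT s|?M. P k s) \<le> (LINT s|?M. Q k s)"
        using PQ[of k] by (intro integral_mono_AE Pi Qi) (auto elim: eventually_mono)
      also have "\<dots> = (LINT s|?M. (\<Sum>n\<le>N k. c k n * (R n s + B + c' * (norm (V n s) powr p + 1) * \<delta> k))) + (LINT s|?M. D * S (w k s))"
        unfolding Q_def
        by (intro Bochner_Integration.integral_add Bochner_Integration.integrable_sum Qterm integrable_mult_right Sint wint)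
      also have "(LINT s|?M. (\<Sum>n\<le>N k. c k n * (R n s + B + c' * (norm (V n s) powr p + 1) * \<delta> k)))
        = (\<Sum>n\<le>N k. LINT s|?M. c k n * (R n s + B + c' * (norm (V n s) powr p + 1) * \<delta> k))"
        by (intro Bochner_Integration.integral_sum Qterm)
      also have "\<dots> = (\<Sum>n\<le>N k. c k n * ((LINT s|?M. R n s) + B * m + c' * ((LINT s|?M. norm (V n s) powr p) + m) * \<delta> k))"
        using Ri Vp by (simp add: m_def mult.commute)
      \<comment> \<open>The integral of \<open>R n\<close> is the total cost minus the terminal
        cost. The former is at most u + \<delta> by hypothesis, the latter for n \<ge> k0 at least
        that of y minus e/2.\<close>
      also have "\<dots> \<le> (\<Sum>n\<le>N k. c k n * (u + \<delta> k - terminal_cost g g_star (y T) + e/2 + B * m + c' * (K + m) * \<delta> k))"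
      proof (rule convex_weights_le[OF cN])
        fix n assume n: "k \<le> n"
        have "(LINT s|?M. R n s) = total_cost T l l_star g g_star t (Z n) - terminal_cost g g_star (Z n T)"
          using total_cost_velocity[OF vel[of n] t] by (simp add: R_def)
        also have "\<dots> \<le> u + \<delta> n - (terminal_cost g g_star (y T) - e/2)"
          using u[of n] k0[of n] n k by (simp add: \<delta>_def)
        also have "\<dots> \<le> u + \<delta> k - terminal_cost g g_star (y T) + e/2" using \<delta>mono[OF n] by simp
        finally have "(LINT s|?M. R n s) \<le> u + \<delta> k - terminal_cost g g_star (y T) + e/2" .
        moreover have "c' * ((LINT s|?M. norm (V n s) powr p) + m) * \<delta> k \<le> c' * (K + m) * \<delta> k"
          using K[of n] c' \<delta>0[of k] by (intro mult_right_mono mult_left_mono) auto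
        ultimately show "(LINT s|?M. R n s) + B * m + c' * ((LINT s|?M. norm (V n s) powr p) + m) * \<delta> k
            \<le> u + \<delta> k - terminal_cost g g_star (y T) + e/2 + B * m + c' * (K + m) * \<delta> k" by linarith
      qed
      also have "\<dots> = u + \<delta> k - terminal_cost g g_star (y T) + e/2 + B * m + c' * (K + m) * \<delta> k"
        by (rule convex_weights_const[OF cN])
      finally show "(LINT s|?M. P k s) \<le> \<Gamma> + e"
        using small by (simp add: \<Gamma>_def right_diff_distrib)
    qed
  qed
  have P0: "AE s in ?M. P k s \<ge> 0" for k using PQ[of k] by eventually_elim simp
  have "F \<in> borel_measurable ?M" using Fm[OF vi] unfolding F_def[abs_def] .
  from real_fatou[OF Pi P0 Plim this bound]
  have Fi: "integrable ?M F" and FG: "(LINT s|?M. F s) \<le> \<Gamma>" by blast+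
  define L where "L s = lower_lagrangian (y s) s (v s)" for s
  have LF: "L s = F s - B - D * S (v s)" for s by (simp add: L_def F_def)
  have Li: "integrable ?M L" unfolding LF[abs_def]
    by (intro Bochner_Integration.integrable_diff Fi integrable_mult_right Sint vi integrable_const)
  have LI: "(LINT s|?M. L s) \<le> u - terminal_cost g g_star (y T)"
  proof -
    have "(LINT s|?M. L s) = (LINT s|?M. F s) - B * m - D * (LINT s|?M. S (v s))"
      unfolding LF using Fi Sint[OF vi] by (simp add: m_def mult.commute)
    then show ?thesis using FG by (simp add: \<Gamma>_def)
  qed
  have zero: "AE s in ?M. \<forall>i. y s $ i = 0 \<longrightarrow> v s $ i = 0"
    by (rule primitive_on_junction_zero_deriv[OF pr t'(2) yJ])
  have "in_Lp p t T v"
    unfolding in_Lp_def set_borel_measurable_iff_lborel_on set_integrable_iff_lborel_on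
  proof
    show vm: "v \<in> borel_measurable ?M" using vi by (rule borel_measurable_integrable)
    show "integrable ?M (\<lambda>s. norm (v s) powr p)"
    proof (rule Bochner_Integration.integrable_bound)
      show "integrable ?M (\<lambda>s. (L s + C\<^sub>1) / c\<^sub>0)" using Li by simp
      show "(\<lambda>s. norm (v s) powr p) \<in> borel_measurable ?M"
        using vm by measurable
      show "AE s in ?M. norm (norm (v s) powr p) \<le> norm ((L s + C\<^sub>1) / c\<^sub>0)"
        using zero AE_lborel_on_Icc
      proof eventually_elim
        fix s assume z: "\<forall>i. y s $ i = 0 \<longrightarrow> v s $ i = 0" and s: "s \<in> {t..T}"
        have s0: "s \<in> {0..T}" using s t' by simp
        have Lr: "L s = running_cost l l_star (y s) (\<Sum>i\<in>UNIV. v s $ i) s"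
          unfolding L_def by (rule lower_lagrangian_tangent[OF yJ[OF s]]) (use z in blast)
        have "c\<^sub>0 * norm (v s) powr p \<le> L s + C\<^sub>1"
        proof (cases "y s = 0")
          case True
          then have "v s = 0" using z by (simp add: vec_eq_iff)
          then show ?thesis using lo[OF yJ[OF s] s0, of 0] Lr p by simp
        next
          case False
          obtain i where i: "y s \<in> edge i" using yJ[OF s] by (rule junctionE)
          have "norm (v s) = \<bar>\<Sum>i\<in>UNIV. v s $ i\<bar>" using edge_tangent[OF i, of "v s"] z by simp
          then show ?thesis using lo[OF yJ[OF s] s0, of "\<Sum>i\<in>UNIV. v s $ i"] Lr False by simp
        qed
        then have "norm (v s) powr p \<le> (L s + C\<^sub>1) / c\<^sub>0" using c0(1) by (simp add: field_simps)
        also have "\<dots> \<le> norm ((L s + C\<^sub>1) / c\<^sub>0)" unfolding real_norm_def by (rule abs_ge_self)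
        finally show "norm (norm (v s) powr p) \<le> norm ((L s + C\<^sub>1) / c\<^sub>0)" by (simp del: abs_divide)
      qed
    qed
  qed
  then have vely: "velocity t y v" by (intro velocityI t' pr yJ)
  have "(LINT s|?M. running_cost l l_star (y s) (\<Sum>i\<in>UNIV. v s $ i) s) = (LINT s|?M. L s)"
  proof (rule integral_cong_AE)
    show "AE s in ?M. running_cost l l_star (y s) (\<Sum>i\<in>UNIV. v s $ i) s = L s"
      using zero AE_lborel_on_Icc
    proof eventually_elim
      fix s assume z: "\<forall>i. y s $ i = 0 \<longrightarrow> v s $ i = 0" and s: "s \<in> {t..T}"
      show "running_cost l l_star (y s) (\<Sum>i\<in>UNIV. v s $ i) s = L s"
        unfolding L_def by (rule lower_lagrangian_tangent[OF yJ[OF s], symmetric]) (use z in blast)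
    qed
    show "(\<lambda>s. running_cost l l_star (y s) (\<Sum>i\<in>UNIV. v s $ i) s) \<in> borel_measurable ?M"
      using running_cost_integrable[OF vely t'(1)] by (rule borel_measurable_integrable)
  qed (use Li in auto)
  then have "total_cost T l l_star g g_star t y \<le> u"
    using LI total_cost_velocity[OF vely t] by simp
  then show ?thesis using vely by blast
qed

section \<open>Existence and a priori bounds\<close>

lemma velocity_constant:
  assumes "x \<in> junction" "t \<le> T"
  shows "velocity t (\<lambda>_. x) (\<lambda>_. 0)"
proof (rule velocityI)
  show "primitive_on t T (\<lambda>_. x) (\<lambda>_. 0)" by (simp add: primitive_on_def)
  show "in_Lp p t T (\<lambda>_. 0 :: real ^ 'n)"
    by (simp add: in_Lp_def set_borel_measurable_def set_integrable_def)
qed (use assms in auto)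

text \<open>The bound depends on the starting point only through a radius and not on t. This makes
  the final constants depend on |x| alone.\<close>

lemma total_cost_constant_bounded:
  assumes r: "r > 0"
  shows "\<exists>U. \<forall>x\<in>junction. \<forall>t\<in>{0..T}. norm x \<le> r \<longrightarrow> total_cost T l l_star g g_star t (\<lambda>_. x) \<le> U"
proof -
  obtain B where B: "B \<ge> 0" "\<And>i y s. y \<in> {0..r} \<Longrightarrow> s \<in> {0..T} \<Longrightarrow> \<bar>l i y 0 s\<bar> \<le> B"
    using l_rest_bounded[OF r] by blast
  obtain G where G: "G \<ge> 0" "\<And>z. z \<in> junction \<Longrightarrow> \<bar>terminal_cost g g_star z\<bar> \<le> G"
    using terminal_cost_bounded by blast
  have "total_cost T l l_star g g_star t (\<lambda>_. x) \<le> B * T + G"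
    if x: "x \<in> junction" "norm x \<le> r" and t: "t \<in> {0..T}" for x t
  proof -
    have t': "0 \<le> t" "t \<le> T" using t by auto
    interpret finite_measure "lborel_on t T" by (rule finite_measure_lborel_on)
    note vel = velocity_constant[OF x(1) t'(2)]
    have "running_cost l l_star x 0 s \<le> B" if s: "s \<in> {0..T}" for s
    proof (cases "x = 0")
      case True
      have "l undefined 0 0 s \<le> B" using B(2)[of 0 s undefined] s r by auto
      then show ?thesis using vertex_cost_le[of l l_star s undefined] True by (simp add: running_cost_vertex)
    next
      case False
      obtain i where i: "x \<in> edge i" using x(1) by (rule junctionE)
      show ?thesis using B(2)[of "norm x" s i] x(2) s by (auto simp: running_cost_edge[OF i False])
    qed
    then have "(LINT s|lborel_on t T. running_cost l l_star x 0 s) \<le> (LINT s|lborel_on t T. B)"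
      using running_cost_integrable[OF vel t'(1)] t'
      by (intro integral_mono) (auto simp: space_restrict_space)
    also have "\<dots> = B * (T - t)"
      using t' by (simp add: measure_restrict_space space_restrict_space)
    also have "\<dots> \<le> B * T" using B(1) t' by (intro mult_left_mono) auto
    finally have "(LINT s|lborel_on t T. running_cost l l_star x 0 s) \<le> B * T" .
    moreover have "terminal_cost g g_star x \<le> G" using G(2)[OF x(1)] by simp
    ultimately show ?thesis unfolding total_cost_velocity[OF vel t] by simp
  qed
  then show ?thesis by blast
qed

text \<open>The pointwise bound \<open>a \<le> m + a\<^sup>p / m\<^sup>p\<^sup>-\<^sup>1\<close> replaces Hoelder's inequality.\<close>

lemma velocity_increment:
  assumes vel: "velocity t y v" and t: "t \<in> {0..T}" and m: "m > 0"
    and K: "(LINT s|lborel_on t T. norm (v s) powr p) \<le> K"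
    and cd: "t \<le> c" "c \<le> d" "d \<le> T"
  shows "norm (y d - y c) \<le> m * (d - c) + K * m powr (1 - p)"
proof -
  let ?M = "lborel_on t T"
  interpret finite_measure ?M by (rule finite_measure_lborel_on)
  have pr: "primitive_on t T y v" using vel by (simp add: velocity_def)
  have vi: "integrable ?M v" using pr by (simp add: primitive_on_def)
  have pt: "a \<le> m + m powr (1 - p) * a powr p" if "a \<ge> 0" for a
  proof (cases "a \<le> m")
    \<comment> \<open>For a > m the decreasing power 1 - p gives a^(1-p) \<le> m^(1-p);
      multiplication by a^p turns the left side into a.\<close>
    case False
    then have "a powr (1 - p) \<le> m powr (1 - p)" using m p by (intro powr_mono2') auto
    then have "a powr (1 - p) * a powr p \<le> m powr (1 - p) * a powr p" by (intro mult_right_mono) auto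
    moreover have "a powr (1 - p) * a powr p = a" using False m by (simp flip: powr_add)
    ultimately show ?thesis using m by simp
  qed (simp add: add_increasing2)
  have ii: "integrable ?M (indicator {c<..d} :: real \<Rightarrow> real)"
    using integrable_indicator_scaleR[of t T "\<lambda>_. 1 :: real" "{c<..d}"] by simp
  have I: "(LINT s|?M. indicator {c<..d} s) = d - c"
  proof -
    have "(LINT s|?M. indicator {c<..d} s) = (LINT s:{t..T}|lborel. indicator {c<..d} s :: real)"
      by (simp add: set_integral_eq_lborel_on)
    also have "\<dots> = (LINT s|lborel. indicator {c<..d} s)"
      unfolding set_lebesgue_integral_def using cd
      by (intro Bochner_Integration.integral_cong refl) (auto simp: indicator_def)
    also have "\<dots> = d - c" using cd by simp
    finally show ?thesis .
  qed
  have "norm (y d - y c) = norm (LINT s|?M. indicator {c<..d} s *\<^sub>R v s)"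
    using primitive_on_increment[OF pr cd] by simp
  also have "\<dots> \<le> (LINT s|?M. m * indicator {c<..d} s + m powr (1 - p) * norm (v s) powr p)"
  proof (rule Bochner_Integration.integral_norm_bound_integral)
    show "integrable ?M (\<lambda>s. indicator {c<..d} s *\<^sub>R v s)" by (rule integrable_indicator_scaleR[OF vi]) simp
    show "integrable ?M (\<lambda>s. m * indicator {c<..d} s + m powr (1 - p) * norm (v s) powr p)"
      using ii velocity_powr_integrable[OF vel] by simp
    fix s
    show "norm (indicator {c<..d} s *\<^sub>R v s) \<le> m * indicator {c<..d} s + m powr (1 - p) * norm (v s) powr p"
      using pt[of "norm (v s)"] by (cases "s \<in> {c<..d}") auto
  qed
  also have "\<dots> = m * (d - c) + m powr (1 - p) * (LINT s|?M. norm (v s) powr p)"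
    using ii velocity_powr_integrable[OF vel] I by simp
  also have "\<dots> \<le> m * (d - c) + m powr (1 - p) * K"
    using K by (intro add_left_mono mult_left_mono) auto
  finally show ?thesis by (simp add: mult.commute)
qed

lemma velocity_bounded:
  assumes vel: "velocity t y v" and t: "t \<in> {0..T}"
    and K: "(LINT s|lborel_on t T. norm (v s) powr p) \<le> K" and s: "s \<in> {t..T}"
  shows "norm (y s) \<le> norm (y t) + T + K"
proof -
  \<comment> \<open>The choice m = 1 is enough for boundedness; equicontinuity will need large
    m.\<close>
  have "norm (y s - y t) \<le> 1 * (s - t) + K * 1 powr (1 - p)"
    by (rule velocity_increment[OF vel t _ K]) (use s in auto)
  then have "norm (y s - y t) \<le> T + K" using s t by simp
  moreover have "norm (y s) \<le> norm (y s - y t) + norm (y t)" using norm_triangle_ineq[of "y s - y t" "y t"] by simp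
  ultimately show ?thesis by linarith
qed

text \<open>A real infimum is a lower bound only if the set is bounded below; the energy estimate
  provides the bound -A.\<close>

lemma value_function_le:
  assumes "y \<in> trajectories p T t x" "t \<in> {0..T}"
  shows "value_function p T l l_star g g_star x t \<le> total_cost T l l_star g g_star t y"
proof -
  obtain c\<^sub>0 A where A: "c\<^sub>0 > 0" "\<And>t y v. t \<in> {0..T} \<Longrightarrow> velocity t y v \<Longrightarrow>
     c\<^sub>0 * (LINT s|lborel_on t T. norm (v s) powr p) \<le> total_cost T l l_star g g_star t y + A"
    using energy_bound by blast
  have "- A \<le> total_cost T l l_star g g_star t z" if z: "z \<in> trajectories p T t x" for z
  proof -
    obtain v where v: "velocity t z v" using velocity_exists[OF z] assms(2) by auto
    have "0 \<le> c\<^sub>0 * (LINT s|lborel_on t T. norm (v s) powr p)"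
      using A(1) by (intro mult_nonneg_nonneg integral_nonneg_AE) auto
    then show ?thesis using A(2)[OF assms(2) v] by linarith
  qed
  then have "bdd_below (total_cost T l l_star g g_star t ` trajectories p T t x)"
    by (intro bdd_belowI2)
  then show ?thesis unfolding value_function_def using assms(1) by (rule cINF_lower)
qed

lemma optimal_trajectory_exists:
  assumes x: "x \<in> junction" and t: "t \<in> {0..T}"
  shows "optimal_trajectories p T l l_star g g_star t x \<noteq> {}"
proof -
  let ?M = "lborel_on t T"
  have t': "0 \<le> t" "t \<le> T" using t by auto
  obtain c\<^sub>0 A where A: "c\<^sub>0 > 0" "\<And>t y v. t \<in> {0..T} \<Longrightarrow> velocity t y v \<Longrightarrow>
     c\<^sub>0 * (LINT s|lborel_on t T. norm (v s) powr p) \<le> total_cost T l l_star g g_star t y + A"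
    using energy_bound by blast
  define u where "u = value_function p T l l_star g g_star x t"
  have ne: "trajectories p T t x \<noteq> {}"
    using velocity_trajectory[OF velocity_constant[OF x t'(2)] t'(2)] by blast
  have "\<exists>y v. y \<in> trajectories p T t x \<and> velocity t y v \<and> total_cost T l l_star g g_star t y < u + 1 / (real n + 1)" for n
  proof -
    have "Inf (total_cost T l l_star g g_star t ` trajectories p T t x) < u + 1 / (real n + 1)"
      by (simp add: u_def value_function_def)
    from cInf_lessD[OF _ this] ne obtain y where y: "y \<in> trajectories p T t x"
      "total_cost T l l_star g g_star t y < u + 1 / (real n + 1)" by auto
    obtain v where "velocity t y v" using velocity_exists[OF y(1) t'(2)] by blast
    with y show ?thesis by blast
  qed
  then obtain Y V where Y: "\<And>n. Y n \<in> trajectories p T t x" and V: "\<And>n. velocity t (Y n) (V n)"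
    and cost: "\<And>n. total_cost T l l_star g g_star t (Y n) < u + 1 / (real n + 1)"
    by metis
  \<comment> \<open>The minimizing sequence has cost at most u + 1, and the energy estimate adds
    \<open>A\<close> and divides by the coercivity constant.\<close>
  define K where "K = \<bar>u + 1 + A\<bar> / c\<^sub>0"
  have K: "(LINT s|?M. norm (V n s) powr p) \<le> K" for n
  proof -
    have "1 / (real n + 1) \<le> 1" by simp
    then have "c\<^sub>0 * (LINT s|?M. norm (V n s) powr p) \<le> \<bar>u + 1 + A\<bar>"
      using A(2)[OF t V[of n]] cost[of n] by linarith
    then show ?thesis using A(1) by (simp add: K_def field_simps)
  qed
  have Yt: "Y n t = x" for n using Y[of n] by (simp add: trajectories_def)
  have inc: "norm (Y n d - Y n c) \<le> m * \<bar>d - c\<bar> + K * m powr (1 - p)"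
    if "c \<in> {t..T}" "d \<in> {t..T}" "m > 0" for n c d m
  proof (cases "c \<le> d")
    case True
    then show ?thesis using velocity_increment[OF V t that(3) K, of c d n] that by simp
  next
    case False
    then show ?thesis using velocity_increment[OF V t that(3) K, of d c n] that by (simp add: norm_minus_commute)
  qed
  have bdd: "norm (Y n s) \<le> norm x + T + K" if "s \<in> {t..T}" for n s
    using velocity_bounded[OF V t K that] Yt by simp
  have equi: "\<exists>d>0. \<forall>n s'. s' \<in> {t..T} \<and> norm (s - s') < d \<longrightarrow> norm (Y n s - Y n s') < e"
    if s: "s \<in> {t..T}" and e: "e > 0" for s e
  proof -
      \<comment> \<open>Since p > 1, the energy term is below e/2 for large m; with m fixed, the
        distance e/(2m) makes the linear term less than e/2 as well.\<close>
      have "((\<lambda>m. K * m powr (1 - p)) \<longlongrightarrow> K * 0) at_top"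
        using p by (intro tendsto_intros tendsto_neg_powr filterlim_ident) auto
      then have "\<forall>\<^sub>F m in at_top. K * m powr (1 - p) < e/2"
        by (rule order_tendstoD) (use e in simp)
      moreover have "\<forall>\<^sub>F m::real in at_top. m > 0" by (rule eventually_gt_at_top)
      ultimately have "\<forall>\<^sub>F m in at_top. m > 0 \<and> K * m powr (1 - p) < e/2" by eventually_elim simp
      then obtain m where m: "m > 0" "K * m powr (1 - p) < e/2"
        using eventually_happens'[OF trivial_limit_at_top_linorder] by blast
      show ?thesis
      proof (intro exI[of _ "e / (2 * m)"] conjI allI impI)
        show "e / (2 * m) > 0" using e m by simp
        fix n s' assume s': "s' \<in> {t..T} \<and> norm (s - s') < e / (2 * m)"
        then have "m * \<bar>s - s'\<bar> < e / 2" using m by (simp add: field_simps)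
        then show "norm (Y n s - Y n s') < e" using inc[of s' s m n] s s' m by linarith
      qed
  qed
  obtain y k where k: "strict_mono (k :: nat \<Rightarrow> nat)"
    and unif: "\<And>e. 0 < e \<Longrightarrow> \<exists>N. \<forall>n s. n \<ge> N \<and> s \<in> {t..T} \<longrightarrow> norm (Y (k n) s - y s) < e"
    by (rule Arzela_Ascoli[OF compact_Icc bdd equi]) (assumption | rule that)+
  \<comment> \<open>Extracts indices with the explicit rate required by the semicontinuity lemma.
    They also satisfy j \<ge> n, so the cost estimate keeps its rate.\<close>
  have "\<exists>j\<ge>n. \<forall>s\<in>{t..T}. norm (Y j s - y s) \<le> 1 / (real n + 1)" for n
  proof -
    obtain N where N: "\<forall>m s. m \<ge> N \<and> s \<in> {t..T} \<longrightarrow> norm (Y (k m) s - y s) < 1 / (real n + 1)"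
      using unif[of "1 / (real n + 1)"] by auto
    have "k (max n N) \<ge> n" using seq_suble[OF k, of "max n N"] by simp
    moreover have "\<forall>s\<in>{t..T}. norm (Y (k (max n N)) s - y s) \<le> 1 / (real n + 1)"
      using N by (simp add: less_imp_le)
    ultimately show ?thesis by blast
  qed
  then obtain h where h: "\<And>n. h n \<ge> n" "\<And>n s. s \<in> {t..T} \<Longrightarrow> norm (Y (h n) s - y s) \<le> 1 / (real n + 1)"
    by metis
  have cost': "total_cost T l l_star g g_star t (Y (h n)) \<le> u + 1 / (real n + 1)" for n
  proof -
    have "1 / (real (h n) + 1) \<le> 1 / (real n + 1)" using h(1)[of n] by (intro divide_left_mono) auto
    then show ?thesis using cost[of "h n"] by linarith
  qed
  obtain v where v: "velocity t y v" and le: "total_cost T l l_star g g_star t y \<le> u"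
    using total_cost_lsc[where Z = "\<lambda>n. Y (h n)" and V = "\<lambda>n. V (h n)", OF t V K h(2) cost'] by blast
  have "y t = x"
  proof -
    \<comment> \<open>All curves start at x, and the rate at the time t carries this over to the
      limit.\<close>
    have "norm (x - y t) \<le> 0 + e" if "e > 0" for e
    proof -
      obtain n where "inverse (real (Suc n)) < e" using reals_Archimedean[OF \<open>e > 0\<close>] by blast
      then have "1 / (real n + 1) < e" by (simp add: inverse_eq_divide add.commute)
      then show ?thesis using h(2)[of t n] Yt[of "h n"] t' by simp
    qed
    then have "norm (x - y t) \<le> 0" by (rule field_le_epsilon)
    then show ?thesis by simp
  qed
  then have "y \<in> trajectories p T t x" using velocity_trajectory[OF v t'(2)] by simp
  moreover from this have "total_cost T l l_star g g_star t y = u"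
    using le value_function_le[OF _ t, of y x] unfolding u_def by simp
  ultimately show ?thesis by (auto simp: optimal_trajectories_def u_def)
qed

lemma optimal_trajectories_bounded:
  "\<exists>M R :: real \<Rightarrow> real. (\<forall>r\<ge>0. M r > 0 \<and> R r > 0) \<and>
      (\<forall>x\<in>junction. \<forall>t\<in>{0..T}. \<forall>y\<in>optimal_trajectories p T l l_star g g_star t x.
         W1p_norm p t T y \<le> M (norm x) \<and> (\<forall>s\<in>{t..T}. norm (y s) \<le> R (norm x)))"
proof -
  obtain c\<^sub>0 A where A: "c\<^sub>0 > 0" "\<And>t y v. t \<in> {0..T} \<Longrightarrow> velocity t y v \<Longrightarrow>
     c\<^sub>0 * (LINT s|lborel_on t T. norm (v s) powr p) \<le> total_cost T l l_star g g_star t y + A"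
    using energy_bound by blast
  \<comment> \<open>The radius |r| + 1 is positive for every real r and covers |x| = r.\<close>
  have "\<exists>U. \<forall>x\<in>junction. \<forall>t\<in>{0..T}. norm x \<le> \<bar>r\<bar> + 1 \<longrightarrow> total_cost T l l_star g g_star t (\<lambda>_. x) \<le> U" for r
    by (rule total_cost_constant_bounded) simp
  then obtain U where U: "\<And>r x t. x \<in> junction \<Longrightarrow> t \<in> {0..T} \<Longrightarrow> norm x \<le> \<bar>r\<bar> + 1 \<Longrightarrow>
      total_cost T l l_star g g_star t (\<lambda>_. x) \<le> U r"
    by metis
  define K where "K r = \<bar>U r + A\<bar> / c\<^sub>0" for r
  have K0: "K r \<ge> 0" for r using A(1) by (simp add: K_def)
  \<comment> \<open>The bound of \<open>velocity_bounded\<close> with initial modulus r and energy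
    at most \<open>K r\<close>.\<close>
  define R where "R r = \<bar>r\<bar> + T + K r" for r
  \<comment> \<open>The integral of |y|^p is at most T R^p and that of the velocity at most
    \<open>K r\<close>; the summand 1 makes positivity immediate.\<close>
  define M where "M r = (T * R r powr p + K r) powr (1 / p) + 1" for r
  have R0: "R r > 0" for r using K0[of r] T by (simp add: R_def)
  have M0: "M r > 0" for r by (simp add: M_def add_nonneg_pos)
  have "W1p_norm p t T y \<le> M (norm x) \<and> (\<forall>s\<in>{t..T}. norm (y s) \<le> R (norm x))"
    if x: "x \<in> junction" and t: "t \<in> {0..T}" and y: "y \<in> optimal_trajectories p T l l_star g g_star t x" for x t y
  proof -
    let ?M = "lborel_on t T"
    interpret finite_measure ?M by (rule finite_measure_lborel_on)
    have t': "0 \<le> t" "t \<le> T" using t by auto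
    have yt: "y \<in> trajectories p T t x" and opt: "total_cost T l l_star g g_star t y = value_function p T l l_star g g_star x t"
      using y by (auto simp: optimal_trajectories_def)
    obtain v where v: "velocity t y v" using velocity_exists[OF yt t'(2)] by blast
    have "total_cost T l l_star g g_star t y \<le> U (norm x)"
      using value_function_le[OF velocity_trajectory[OF velocity_constant[OF x t'(2)] t'(2)] t]
        U[OF x t, of "norm x"] opt by simp
    then have "c\<^sub>0 * (LINT s|?M. norm (v s) powr p) \<le> \<bar>U (norm x) + A\<bar>" using A(2)[OF t v] by linarith
    then have K: "(LINT s|?M. norm (v s) powr p) \<le> K (norm x)" using A(1) by (simp add: K_def field_simps)
    have "y t = x" using yt by (simp add: trajectories_def)
    then have R: "norm (y s) \<le> R (norm x)" if "s \<in> {t..T}" for s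
      using velocity_bounded[OF v t K that] by (simp add: R_def)
    have "(LINT s|?M. norm (weak_deriv t T y s) powr p) = (LINT s|?M. norm (v s) powr p)"
    proof (rule integral_cong_AE)
      show "AE s in ?M. norm (weak_deriv t T y s) powr p = norm (v s) powr p"
        using velocity_weak_deriv(1)[OF v t'(2)] by eventually_elim simp
      show "(\<lambda>s. norm (weak_deriv t T y s) powr p) \<in> borel_measurable ?M"
        using velocity_weak_deriv(3)[OF v t'(2)] by measurable
      show "(\<lambda>s. norm (v s) powr p) \<in> borel_measurable ?M" using velocity_measurable(2)[OF v] by measurable
    qed
    moreover have "(LINT s|?M. norm (y s) powr p) \<le> T * R (norm x) powr p"
    proof -
      have "integrable ?M (\<lambda>s. norm (y s) powr p)"
        using in_Lp_continuous[OF velocity_measurable(4)[OF v]]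
        unfolding in_Lp_def set_integrable_iff_lborel_on by blast
      then have "(LINT s|?M. norm (y s) powr p) \<le> (LINT s|?M. R (norm x) powr p)"
        using R p by (intro integral_mono) (auto simp: space_restrict_space intro!: powr_mono2)
      also have "\<dots> = R (norm x) powr p * (T - t)"
        using t' by (simp add: measure_restrict_space space_restrict_space)
      also have "\<dots> \<le> R (norm x) powr p * T" using t' by (intro mult_left_mono) auto
      finally show ?thesis by (simp add: mult.commute)
    qed
    ultimately have le: "(LINT s|?M. norm (y s) powr p) + (LINT s|?M. norm (weak_deriv t T y s) powr p)
        \<le> T * R (norm x) powr p + K (norm x)" using K by linarith
    have "W1p_norm p t T y \<le> (T * R (norm x) powr p + K (norm x)) powr (1 / p)"
      unfolding W1p_norm_def set_integral_eq_lborel_on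
      using le p by (intro powr_mono2) (auto intro!: add_nonneg_nonneg integral_nonneg_AE)
    then show ?thesis using R by (auto simp: M_def)
  qed
  then show ?thesis using M0 R0 by blast
qed

end

theorem proposition2p7:
  fixes p T g_star :: real
    and g :: "'n::finite \<Rightarrow> real \<Rightarrow> real"
    and l_star :: "real \<Rightarrow> real"
    and l l_y l_a :: "'n \<Rightarrow> real \<Rightarrow> real \<Rightarrow> real \<Rightarrow> real"
  assumes N: "CARD('n) > 1"
    and T: "T > 0"
    and p: "p > 1"
    and g_cont: "\<And>i. continuous_on {0..} (g i)"
    and g_bdd: "\<And>i. bounded (g i ` {0..})"
    and l_star_cont: "continuous_on {0..T} l_star"
    and l_cont: "\<And>i. continuous_on ({0..} \<times> UNIV \<times> {0..T}) (\<lambda>(y, a, s). l i y a s)"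
    and l_diff: "\<And>i y a s. y \<ge> 0 \<Longrightarrow> s \<in> {0..T} \<Longrightarrow>
      ((\<lambda>(y', a'). l i y' a' s) has_derivative (\<lambda>(h, k). l_y i y a s * h + l_a i y a s * k))
        (at (y, a) within {0..} \<times> UNIV)"
    and l_y_cont: "\<And>i. continuous_on ({0..} \<times> UNIV \<times> {0..T}) (\<lambda>(y, a, s). l_y i y a s)"
    and l_a_cont: "\<And>i. continuous_on ({0..} \<times> UNIV \<times> {0..T}) (\<lambda>(y, a, s). l_a i y a s)"
    and H1: "\<And>i. \<exists>C\<^sub>0>0.
      (\<forall>y\<ge>0. \<forall>a. \<forall>s\<in>{0..T}. l i y a s \<ge> C\<^sub>0 * (\<bar>a\<bar> powr p - 1)) \<and>
      (\<forall>s\<in>{0..T}. l_star s \<ge> - C\<^sub>0)"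
    and H2: "\<And>i r. r > 0 \<Longrightarrow> \<exists>\<omega>. modulus_of_continuity \<omega> \<and>
      (\<forall>y\<in>{0..r}. \<forall>a. \<forall>t\<^sub>1\<in>{0..T}. \<forall>t\<^sub>2\<in>{0..T}.
         \<bar>l i y a t\<^sub>1 - l i y a t\<^sub>2\<bar> \<le> (1 + \<bar>a\<bar> powr p) * \<omega> \<bar>t\<^sub>1 - t\<^sub>2\<bar>)"
    and H3: "\<And>i r. r > 0 \<Longrightarrow> \<exists>c\<ge>0. \<forall>y\<in>{0..r}. \<forall>a. \<forall>s\<in>{0..T}.
      \<bar>l_y i y a s\<bar> \<le> c * (\<bar>a\<bar> powr p + 1) \<and>
      \<bar>l_a i y a s\<bar> \<le> c * (\<bar>a\<bar> powr (p - 1) + 1)"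
    and H4: "\<And>i y s. y \<ge> 0 \<Longrightarrow> s \<in> {0..T} \<Longrightarrow> strictly_convex (\<lambda>a. l i y a s)"
  shows "(\<forall>x\<in>junction. \<forall>t\<in>{0..T}. optimal_trajectories p T l l_star g g_star t x \<noteq> {}) \<and>
    (\<exists>M R :: real \<Rightarrow> real. (\<forall>r\<ge>0. M r > 0 \<and> R r > 0) \<and>
      (\<forall>x\<in>junction. \<forall>t\<in>{0..T}. \<forall>y\<in>optimal_trajectories p T l l_star g g_star t x.
         W1p_norm p t T y \<le> M (norm x) \<and>
         (\<forall>s\<in>{t..T}. norm (y s) \<le> R (norm x))))"
proof -
  interpret junction_problem p T g_star g l_star l l_y l_a
    by unfold_locales (fact T p g_cont g_bdd l_star_cont l_cont l_diff l_a_cont H1 H3 H4)+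
  show ?thesis
    using optimal_trajectory_exists optimal_trajectories_bounded by blast
qed

end
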